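(* Let $n\ge 1$ and $k\ge n+1$ be integers, and let $H_{k,n}$, $\sigma_{k,n}$ and $B^{\mathbb R}_{k,n}$ be the Gaussian Gram hafnian, its root mean square, and the explicit coefficient defined in the context. Then $\sigma_{k,n}>0$ and $$\sigma_{k,n}^2=\mathbb E H_{k,n}^2=(2n-1)!!\prod_{q=0}^{n-1}(k+2q).$$ The law of $H_{k,n}$ has a bounded continuous density $f_{k,n}$ satisfying $$\sup_{z\in\mathbb R} f_{k,n}(z)=f_{k,n}(0)\le \frac{B^{\mathbb R}_{k,n}}{2\sigma_{k,n}}.$$ Consequently, for every $z\in\mathbb R$ and $\varepsilon\ge 0$, $$\mathbb P\{|H_{k,n}-z|\le \varepsilon\sigma_{k,n}\}\le\min\{1,B^{\mathbb R}_{k,n}\varepsilon\}.$$ If, in addition, $k\ge n+2$, then $$B^{\mathbb R}_{k,n}\le \frac{2}{\sqrt\pi}\,n^{3/8}\exp\left\{\frac{3n^2+n}{4(k-n-1)}\right\}.$$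
   Context: For integers $n,k\ge1$, let $X\in\mathbb R^{k\times 2n}$ have independent standard normal entries, with columns $x_1,\ldots,x_{2n}\in\mathbb R^k$. Let $\mathcal M_{2n}$ be the set of perfect matchings of $\{1,\ldots,2n\}$, and let $$H_{k,n}=\sum_{\mathfrak m\in\mathcal M_{2n}}\ \prod_{\{i,j\}\in\mathfrak m}\langle x_i,x_j\rangle$$ (the hafnian of $X^{\mathsf T}X$; diagonal entries do not enter), where $\langle\cdot,\cdot\rangle$ is the Euclidean inner product. Put $\sigma_{k,n}:=(\mathbb E H_{k,n}^2)^{1/2}$. For $d>1$, let $\chi_d^2$ denote a chi-square random variable with $d$ degrees of freedom and $$\gamma_d:=\mathbb E[(\chi_d^2)^{-1/2}]=2^{-1/2}\frac{\Gamma((d-1)/2)}{\Gamma(d/2)}.$$ For $n\ge1$ and $k\ge n+1$ define $$B^{\mathbb R}_{k,n}:=\sqrt{\frac2\pi}\,\sigma_{k,n}\left(\prod_{j=0}^{n-1}\gamma_{k-j}\right)\left(\prod_{r=2}^{n}\gamma_{2r-1}\right).$$ Empty products equal one. *)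

theory Defs
  imports "HOL-Probability.Probability"
begin

definition perfect_matchings :: "'a set \<Rightarrow> 'a set set set" where
  "perfect_matchings V = {m. partition_on V m \<and> (\<forall>e\<in>m. card e = 2)}"

(* For an edge e = {i, j} with i < j we have Min e = i and Max e = j; the Gram matrix
   is symmetric, so the order of the two indices is irrelevant. *)
definition hafnian :: "nat \<Rightarrow> (nat \<Rightarrow> nat \<Rightarrow> real) \<Rightarrow> real" where
  "hafnian n A = (\<Sum>m\<in>perfect_matchings {1..2*n}. \<Prod>e\<in>m. A (Min e) (Max e))"

(* x a i is the entry in row a and column i of a matrix with k rows, so the i-th column
   is the vector (x 1 i, ..., x k i). *)
definition gram :: "nat \<Rightarrow> (nat \<Rightarrow> nat \<Rightarrow> real) \<Rightarrow> nat \<Rightarrow> nat \<Rightarrow> real" where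
  "gram k x i j = (\<Sum>a=1..k. x a i * x a j)"

definition gaussian_matrix ::
    "'w measure \<Rightarrow> nat \<Rightarrow> nat \<Rightarrow> (nat \<Rightarrow> nat \<Rightarrow> 'w \<Rightarrow> real) \<Rightarrow> bool" where
  "gaussian_matrix M k m X \<longleftrightarrow>
     prob_space.indep_vars M (\<lambda>_. borel) (\<lambda>(a, i). X a i) ({1..k} \<times> {1..m}) \<and>
     (\<forall>a\<in>{1..k}. \<forall>i\<in>{1..m}. distributed M lborel (X a i) std_normal_density)"

definition gram_hafnian ::
    "nat \<Rightarrow> nat \<Rightarrow> (nat \<Rightarrow> nat \<Rightarrow> 'w \<Rightarrow> real) \<Rightarrow> 'w \<Rightarrow> real" where
  "gram_hafnian k n X \<omega> = hafnian n (gram k (\<lambda>a i. X a i \<omega>))"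

definition gram_hafnian_rms ::
    "'w measure \<Rightarrow> nat \<Rightarrow> nat \<Rightarrow> (nat \<Rightarrow> nat \<Rightarrow> 'w \<Rightarrow> real) \<Rightarrow> real" where
  "gram_hafnian_rms M k n X = sqrt (prob_space.expectation M (\<lambda>\<omega>. (gram_hafnian k n X \<omega>)\<^sup>2))"

definition chi_square_density :: "real \<Rightarrow> real \<Rightarrow> real" where
  "chi_square_density d x =
     (if x \<le> 0 then 0
      else x powr (d / 2 - 1) * exp (- x / 2) / (2 powr (d / 2) * Gamma (d / 2)))"

definition chi_square_distribution :: "real \<Rightarrow> real measure" where
  "chi_square_distribution d = density lborel (\<lambda>x. ennreal (chi_square_density d x))"

definition chi_square_gamma :: "real \<Rightarrow> real" where
  "chi_square_gamma d = (LINT x|chi_square_distribution d. x powr (- 1 / 2))"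

definition B_real ::
    "'w measure \<Rightarrow> nat \<Rightarrow> nat \<Rightarrow> (nat \<Rightarrow> nat \<Rightarrow> 'w \<Rightarrow> real) \<Rightarrow> real" where
  "B_real M k n X =
     sqrt (2 / pi) * gram_hafnian_rms M k n X
       * (\<Prod>j<n. chi_square_gamma (real k - real j))
       * (\<Prod>r=2..n. chi_square_gamma (2 * real r - 1))"

fun double_fact :: "nat \<Rightarrow> nat" where
  "double_fact 0 = 1"
| "double_fact (Suc 0) = 1"
| "double_fact (Suc (Suc m)) = Suc (Suc m) * double_fact m"

lemma nn_integral_powr_exp_half:
  fixes p :: real
  assumes "p > 0"
  shows "(\<integral>\<^sup>+x. ennreal (if x \<le> 0 then 0 else x powr (p - 1) * exp (- x / 2)) \<partial>lborel)
           = ennreal (2 powr p * Gamma p)"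
proof -
  let ?f = "\<lambda>x::real. ennreal (if x \<le> 0 then 0 else x powr (p - 1) * exp (- x / 2))"
  have "(\<integral>\<^sup>+x. ?f x \<partial>lborel) = ennreal \<bar>2\<bar> * (\<integral>\<^sup>+t. ?f (0 + 2 * t) \<partial>lborel)"
    by (rule nn_integral_real_affine) auto
  also have "(\<integral>\<^sup>+t. ?f (0 + 2 * t) \<partial>lborel)
      = (\<integral>\<^sup>+t. ennreal (2 powr (p - 1)) * ennreal (indicator {0..} t * t powr (p - 1) / exp t) \<partial>lborel)"
    by (intro nn_integral_cong)
       (auto simp: indicator_def powr_mult exp_minus field_simps simp flip: ennreal_mult')
  also have "\<dots> = ennreal (2 powr (p - 1)) * ennreal (Gamma p)"
    using Gamma_conv_nn_integral_real[OF assms] by (subst nn_integral_cmult) auto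
  finally show ?thesis
    using assms by (simp add: powr_diff ennreal_mult'[symmetric] Gamma_real_pos_exp flip: ennreal_numeral)
qed

lemma prob_space_chi_square_distribution:
  assumes "d > 0"
  shows "prob_space (chi_square_distribution d)"
proof
  let ?C = "2 powr (d / 2) * Gamma (d / 2)"
  have C: "?C > 0" using assms by (intro mult_pos_pos Gamma_real_pos) auto
  have "emeasure (chi_square_distribution d) (space (chi_square_distribution d))
      = (\<integral>\<^sup>+x. ennreal (chi_square_density d x) \<partial>lborel)"
    unfolding chi_square_distribution_def chi_square_density_def
    by (subst emeasure_density) auto
  also have "\<dots> = (\<integral>\<^sup>+x. ennreal (1 / ?C)
      * ennreal (if x \<le> 0 then 0 else x powr (d / 2 - 1) * exp (- x / 2)) \<partial>lborel)"
    using C by (intro nn_integral_cong) (auto simp: chi_square_density_def simp flip: ennreal_mult')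
  also have "\<dots> = ennreal (1 / ?C) * ennreal ?C"
    using assms by (subst nn_integral_cmult) (auto simp: nn_integral_powr_exp_half)
  also have "\<dots> = ennreal (1 / ?C * ?C)" using C by (subst ennreal_mult') auto
  also have "1 / ?C * ?C = 1" using C by (metis nonzero_divide_eq_eq less_irrefl)
  finally have "emeasure (chi_square_distribution d) (space (chi_square_distribution d)) = ennreal 1" .
  then show "emeasure (chi_square_distribution d) (space (chi_square_distribution d)) = 1" by simp
qed

lemma chi_square_gamma_eq:
  assumes "d > 1"
  shows "integrable (chi_square_distribution d) (\<lambda>x. x powr (- 1 / 2))"
    and "chi_square_gamma d = 2 powr (- 1 / 2) * Gamma ((d - 1) / 2) / Gamma (d / 2)"
proof -
  let ?C = "2 powr (d / 2) * Gamma (d / 2)"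
  let ?v = "2 powr (- 1 / 2) * Gamma ((d - 1) / 2) / Gamma (d / 2)"
  have C: "?C > 0" using assms by (intro mult_pos_pos Gamma_real_pos) auto
  have v: "?v \<ge> 0" using assms by (intro divide_nonneg_pos mult_nonneg_nonneg
      less_imp_le[OF Gamma_real_pos] Gamma_real_pos) auto
  have [measurable]: "(\<lambda>x. chi_square_density d x) \<in> borel_measurable borel"
    unfolding chi_square_density_def by measurable
  have "(\<integral>\<^sup>+x. ennreal (x powr (- 1 / 2)) \<partial>chi_square_distribution d)
      = (\<integral>\<^sup>+x. ennreal (chi_square_density d x) * ennreal (x powr (- 1 / 2)) \<partial>lborel)"
    unfolding chi_square_distribution_def by (subst nn_integral_density) auto
  also have "\<dots> = (\<integral>\<^sup>+x. ennreal (1 / ?C)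
      * ennreal (if x \<le> 0 then 0 else x powr ((d - 1) / 2 - 1) * exp (- x / 2)) \<partial>lborel)"
  proof (intro nn_integral_cong)
    fix x :: real
    have "x powr (d / 2 - 1) * x powr (- 1 / 2) = x powr ((d - 1) / 2 - 1)"
      by (simp add: powr_add[symmetric] diff_divide_distrib)
    then show "ennreal (chi_square_density d x) * ennreal (x powr (- 1 / 2))
        = ennreal (1 / ?C) * ennreal (if x \<le> 0 then 0 else x powr ((d - 1) / 2 - 1) * exp (- x / 2))"
      using C by (auto simp: chi_square_density_def mult_ac simp flip: ennreal_mult'')
  qed
  also have "\<dots> = ennreal (1 / ?C) * ennreal (2 powr ((d - 1) / 2) * Gamma ((d - 1) / 2))"
    using assms by (subst nn_integral_cmult) (auto simp: nn_integral_powr_exp_half)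
  also have "\<dots> = ennreal (1 / ?C * (2 powr ((d - 1) / 2) * Gamma ((d - 1) / 2)))"
    using C by (subst ennreal_mult') auto
  also have "1 / ?C * (2 powr ((d - 1) / 2) * Gamma ((d - 1) / 2)) = ?v"
  proof -
    have "2 powr ((d - 1) / 2) = 2 powr (- 1 / 2) * (2::real) powr (d / 2)"
      by (simp add: powr_add[symmetric] field_simps)
    then show ?thesis by simp
  qed
  finally have *: "(\<integral>\<^sup>+x. ennreal (x powr (- 1 / 2)) \<partial>chi_square_distribution d) = ennreal ?v" .
  have m: "(\<lambda>x::real. x powr (- 1 / 2)) \<in> borel_measurable (chi_square_distribution d)"
    unfolding chi_square_distribution_def by simp
  have "has_bochner_integral (chi_square_distribution d) (\<lambda>x. x powr (- 1 / 2)) ?v"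
    by (rule has_bochner_integral_nn_integral[OF m _ v *]) auto
  then show "integrable (chi_square_distribution d) (\<lambda>x. x powr (- 1 / 2))"
    and "chi_square_gamma d = ?v"
    unfolding chi_square_gamma_def by (auto simp: has_bochner_integral_iff)
qed

end

theory Submission
  imports Defs "HOL-Real_Asymp.Real_Asymp"
begin

text \<open>
Write $H_{k,n}$ for the Gram hafnian of $2n$ standard Gaussian columns in $k$ dimensions and
$\Phi_{k,n}(s) = E\, e^{i s H_{k,n}}$ for its characteristic function.  Expanding along one column $x$
gives $H = \langle x, W\rangle$, where $W$ depends on the other columns only.  Conditionally on
those, $H$ is centred normal with standard deviation $|W|$.  Hence $H$ has the density
$f(z) = E\,\varphi_{|W|}(z)$ with $\varphi_\sigma$ the centred normal density of standard deviation
$\sigma$; this is continuous and largest at $0$ as soon as $E\,|W|^{-1}$ is finite.  Moreover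
$\Phi_{k,n}(s) = E\, e^{-s^2|W|^2/2} \ge 0$, so $2\pi f(0) = \int \Phi_{k,n}$, and it remains to bound
this integral (\<open>gram_haf_density\<close>, \<open>nn_integral_char_gram_haf\<close>).

The bound follows by induction on $n$ from the domination (\<open>char_gram_haf_reduction\<close>)
  $$|\Phi_{k,n}(s)| \le E\, |\Phi_{k-1,n-1}(s\,|u|\,|t|)|,$$
with $u$ and $t$ independent standard Gaussian vectors of dimensions $k$ and $2n-1$: integrating over
$s$ produces the factor $E|u|^{-1}\,E|t|^{-1} = \gamma_k\gamma_{2n-1}$.  Here $u$ is one column of the
matrix.  Given $u$, a rotation of the rows turns it into $|u|$ times a basis vector
$e_a$, and $t$ is the row $a$ of the remaining columns.

The key point is that the modulus of the conditional characteristic function given $t$ does not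
decrease when two entries $t_j, t_l$ are replaced by $\sqrt{t_j^2+t_l^2}$ and $0$.  With the other
columns fixed, the hafnian is a symmetric bilinear form
$B(x,y)$ of the columns $j$ and $l$.  With $Q(x) = B(x,x)$,
$B(x,y) = \frac12 Q(\frac{x+y}{\sqrt2}) - \frac12 Q(\frac{x-y}{\sqrt2})$, so a rotation of the two columns by
45 degrees factors the expectation as $F(\mu)\overline{F(\lambda)}$, where
$F(\tau) = E\,e^{iQ(x)/2}$ over vectors $x$ whose entry in row $a$ is $\tau$ and whose other entries
are Gaussian.  As $Q(x)+Q(y)$ is invariant under every rotation of
the pair $(x,y)$, $F(\lambda)F(\mu) = F(\nu)^2$ whenever $\lambda^2+\mu^2 = 2\nu^2$.  So the
modulus depends on $t_j^2+t_l^2$ only, and at $(\sqrt{t_j^2+t_l^2}, 0)$ the value itself is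
$|F(\nu)|^2 \ge 0$, whence nothing cancels when the remaining columns are averaged
(\<open>char_bilinear_collapse\<close>).  Once $t$ is concentrated in one entry, only one partner
of the column $u$ contributes, and the hafnian becomes $|u|\,|t|\,H_{k-1,n-1}$.

The second moment satisfies $E H_{k,n}^2 = (2n-1)(k+2n-2)\,E H_{k,n-1}^2$, again by expanding along
a column (\<open>second_moment_gram_haf\<close>).  The explicit bound for the coefficient combines
$\gamma_d^2 \le 1/(d-2)$ with a sharp estimate of $\Gamma(m+\frac12)/\Gamma(m)$ that makes the
product of the $\gamma_{2r-1}$ telescope (\<open>coefficient_bound\<close>).

All matrices live on one probability space, the product of standard normal
laws over a set of indices, later the pairs (row, column).  Conditioning on some coordinates
amounts to resampling the others, and invariance under rotations of pairs of coordinates carries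
all the changes of variables.
\<close>

section \<open>Independent standard normal coordinates\<close>

definition gauss :: "('i \<Rightarrow> real) measure" where
  "gauss = PiM UNIV (\<lambda>_. std_normal_distribution)"

lemma sets_gauss [measurable_cong]: "sets gauss = sets (PiM UNIV (\<lambda>_. borel))"
  unfolding gauss_def by (intro sets_PiM_cong) auto

lemma space_gauss [simp]: "space gauss = UNIV"
  by (simp add: gauss_def space_PiM)

interpretation std_normal: prob_space std_normal_distribution
  by (rule prob_space_normal_density) simp

interpretation gauss_product: product_prob_space "\<lambda>_. std_normal_distribution" UNIV
  by unfold_locales

interpretation gauss: prob_space gauss
  unfolding gauss_def by unfold_locales

interpretation gauss_pair: pair_prob_space gauss gauss
  by unfold_locales

lemma measurable_coordinate [measurable (raw)]: "(\<lambda>\<omega>. \<omega> p) \<in> borel_measurable gauss"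
  by (subst measurable_cong_sets[OF sets_gauss refl]) simp

lemma measurable_coordinate' [measurable_dest]:
  assumes "f \<in> N \<rightarrow>\<^sub>M gauss" "g \<in> L \<rightarrow>\<^sub>M N"
  shows "(\<lambda>x. f (g x) p) \<in> borel_measurable L"
  using measurable_compose[OF measurable_compose[OF assms(2,1)] measurable_coordinate] .

text \<open>Random matrices are built entry by entry, so this is how every map into the space is
shown to be measurable.\<close>

lemma measurable_gaussI:
  assumes "\<And>p. (\<lambda>x. f x p) \<in> borel_measurable M"
  shows "f \<in> M \<rightarrow>\<^sub>M gauss"
  by (subst measurable_cong_sets[OF refl sets_gauss]) (rule measurable_PiM_single', use assms in auto)

text \<open>The coordinates in \<open>J\<close> come from the first argument and the others from the second one. If both
arguments are independent, so is the mixture; integrating over one argument first is conditioning.\<close>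

definition resample :: "'i set \<Rightarrow> ('i \<Rightarrow> real) \<Rightarrow> ('i \<Rightarrow> real) \<Rightarrow> 'i \<Rightarrow> real" where
  "resample J \<omega>' \<omega> p = (if p \<in> J then \<omega>' p else \<omega> p)"

lemma measurable_resample [measurable]:
  assumes [measurable]: "f \<in> M \<rightarrow>\<^sub>M gauss" "g \<in> M \<rightarrow>\<^sub>M gauss"
  shows "(\<lambda>x. resample J (f x) (g x)) \<in> M \<rightarrow>\<^sub>M gauss"
proof (rule measurable_gaussI)
  fix p show "(\<lambda>x. resample J (f x) (g x) p) \<in> borel_measurable M"
    unfolding resample_def
    using measurable_compose[OF assms(1) measurable_coordinate]
      measurable_compose[OF assms(2) measurable_coordinate] by (cases "p \<in> J") auto
qed

text \<open>Cylinder sets determine the product measure, and the preimage of a cylinder set is a rectangle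
of two cylinder sets, one for each source of coordinates.\<close>

lemma distr_resample: "distr (gauss \<Otimes>\<^sub>M gauss) gauss (\<lambda>(\<omega>', \<omega>). resample J \<omega>' \<omega>) = gauss"
  (is "distr _ _ ?f = _")
proof -
  have f [measurable]: "?f \<in> gauss \<Otimes>\<^sub>M gauss \<rightarrow>\<^sub>M gauss"
    by measurable
  have "distr (gauss \<Otimes>\<^sub>M gauss) gauss ?f = PiM UNIV (\<lambda>_. std_normal_distribution)"
  proof (rule gauss_product.PiM_eq)
    show "sets (distr (gauss \<Otimes>\<^sub>M gauss) gauss ?f) = sets (PiM UNIV (\<lambda>_. std_normal_distribution))"
      by (simp add: gauss_def)
  next
    fix K :: "'a set" and F :: "'a \<Rightarrow> real set"
    assume K: "finite K" and F: "\<And>j. j \<in> K \<Longrightarrow> F j \<in> sets std_normal_distribution"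
    let ?N = "std_normal_distribution"
    let ?X = "\<lambda>K. prod_emb UNIV (\<lambda>_. ?N) K (Pi\<^sub>E K F)"
    have X: "?X L \<in> sets gauss" if "L \<subseteq> K" for L
      using that K F unfolding gauss_def by (intro sets_PiM_I) (auto intro: finite_subset)
    have eq: "?f -` ?X K \<inter> space (gauss \<Otimes>\<^sub>M gauss) = ?X (K \<inter> J) \<times> ?X (K - J)"
      by (auto simp: prod_emb_def space_pair_measure resample_def PiE_iff split: if_splits)
    have "emeasure (distr (gauss \<Otimes>\<^sub>M gauss) gauss ?f) (?X K)
        = emeasure (gauss \<Otimes>\<^sub>M gauss) (?X (K \<inter> J) \<times> ?X (K - J))"
      using X[of K] by (subst emeasure_distr) (auto simp: eq[symmetric])
    also have "\<dots> = emeasure gauss (?X (K \<inter> J)) * emeasure gauss (?X (K - J))"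
      by (rule gauss.emeasure_pair_measure_Times) (auto intro: X)
    also have "\<dots> = (\<Prod>j\<in>K \<inter> J. emeasure ?N (F j)) * (\<Prod>j\<in>K - J. emeasure ?N (F j))"
      unfolding gauss_def using K F
      by (subst (1 2) gauss_product.emeasure_PiM_emb) auto
    also have "\<dots> = (\<Prod>j\<in>K. emeasure ?N (F j))"
      using K by (metis prod.Int_Diff)
    finally show "emeasure (distr (gauss \<Otimes>\<^sub>M gauss) gauss ?f) (?X K) = (\<Prod>j\<in>K. emeasure ?N (F j))" .
  qed
  then show ?thesis by (simp add: gauss_def)
qed

lemma nn_integral_resample:
  assumes [measurable]: "f \<in> borel_measurable gauss"
  shows "(\<integral>\<^sup>+\<omega>. f \<omega> \<partial>gauss) = (\<integral>\<^sup>+\<omega>'. \<integral>\<^sup>+\<omega>. f (resample J \<omega>' \<omega>) \<partial>gauss \<partial>gauss)"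
proof -
  have "(\<integral>\<^sup>+\<omega>. f \<omega> \<partial>gauss) = (\<integral>\<^sup>+\<omega>. f \<omega> \<partial>distr (gauss \<Otimes>\<^sub>M gauss) gauss (\<lambda>(\<omega>', \<omega>). resample J \<omega>' \<omega>))"
    by (simp add: distr_resample)
  also have "\<dots> = (\<integral>\<^sup>+x. f (resample J (fst x) (snd x)) \<partial>(gauss \<Otimes>\<^sub>M gauss))"
    by (subst nn_integral_distr) (auto simp: case_prod_beta)
  also have "\<dots> = (\<integral>\<^sup>+\<omega>'. \<integral>\<^sup>+\<omega>. f (resample J \<omega>' \<omega>) \<partial>gauss \<partial>gauss)"
    by (subst gauss.nn_integral_fst[symmetric]) auto
  finally show ?thesis .
qed

lemma
  fixes f :: "_ \<Rightarrow> 'b::{banach, second_countable_topology}"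
  assumes f: "integrable gauss f"
  shows integral_resample: "(\<integral>\<omega>. f \<omega> \<partial>gauss) = (\<integral>\<omega>'. \<integral>\<omega>. f (resample J \<omega>' \<omega>) \<partial>gauss \<partial>gauss)"
    and integrable_resample: "integrable gauss (\<lambda>\<omega>'. \<integral>\<omega>. f (resample J \<omega>' \<omega>) \<partial>gauss)"
proof -
  have [measurable]: "f \<in> borel_measurable gauss" using f by auto
  have *: "integrable (gauss \<Otimes>\<^sub>M gauss) (\<lambda>(\<omega>', \<omega>). f (resample J \<omega>' \<omega>))"
  proof -
    have "integrable (distr (gauss \<Otimes>\<^sub>M gauss) gauss (\<lambda>(\<omega>', \<omega>). resample J \<omega>' \<omega>)) f"
      using f by (simp add: distr_resample)
    then show ?thesis by (subst (asm) integrable_distr_eq) (auto simp: case_prod_unfold)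
  qed
  have "(\<integral>\<omega>. f \<omega> \<partial>gauss) = (\<integral>\<omega>. f \<omega> \<partial>distr (gauss \<Otimes>\<^sub>M gauss) gauss (\<lambda>(\<omega>', \<omega>). resample J \<omega>' \<omega>))"
    by (simp add: distr_resample)
  also have "\<dots> = (\<integral>x. (case x of (\<omega>', \<omega>) \<Rightarrow> f (resample J \<omega>' \<omega>)) \<partial>(gauss \<Otimes>\<^sub>M gauss))"
    by (subst integral_distr) (auto simp: case_prod_unfold)
  also have "\<dots> = (\<integral>\<omega>'. \<integral>\<omega>. f (resample J \<omega>' \<omega>) \<partial>gauss \<partial>gauss)"
    using gauss_pair.integral_fst'[OF *] by simp
  finally show "(\<integral>\<omega>. f \<omega> \<partial>gauss) = (\<integral>\<omega>'. \<integral>\<omega>. f (resample J \<omega>' \<omega>) \<partial>gauss \<partial>gauss)" .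
  show "integrable gauss (\<lambda>\<omega>'. \<integral>\<omega>. f (resample J \<omega>' \<omega>) \<partial>gauss)"
    using gauss_pair.integrable_fst'[OF *] by simp
qed

lemma distr_coordinate: "distr gauss std_normal_distribution (\<lambda>\<omega>. \<omega> p) = std_normal_distribution"
  unfolding gauss_def by (rule gauss_product.PiM_component) simp

lemma nn_integral_coordinate:
  assumes [measurable]: "f \<in> borel_measurable borel"
  shows "(\<integral>\<^sup>+\<omega>. f (\<omega> p) \<partial>gauss) = (\<integral>\<^sup>+x. ennreal (std_normal_density x) * f x \<partial>lborel)"
proof -
  have "(\<integral>\<^sup>+\<omega>. f (\<omega> p) \<partial>gauss) = (\<integral>\<^sup>+x. f x \<partial>distr gauss std_normal_distribution (\<lambda>\<omega>. \<omega> p))"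
    by (subst nn_integral_distr) auto
  also have "\<dots> = (\<integral>\<^sup>+x. ennreal (std_normal_density x) * f x \<partial>lborel)"
    unfolding distr_coordinate by (subst nn_integral_density) auto
  finally show ?thesis .
qed

lemma nn_integral_shear_fst:
  fixes G :: "real \<Rightarrow> real \<Rightarrow> ennreal"
  assumes [measurable]: "case_prod G \<in> borel_measurable (borel \<Otimes>\<^sub>M borel)"
  shows "(\<integral>\<^sup>+y. \<integral>\<^sup>+x. G (x + a * y) y \<partial>lborel \<partial>lborel) = (\<integral>\<^sup>+y. \<integral>\<^sup>+x. G x y \<partial>lborel \<partial>lborel)"
proof (rule nn_integral_cong)
  fix y :: real
  show "(\<integral>\<^sup>+x. G (x + a * y) y \<partial>lborel) = (\<integral>\<^sup>+x. G x y \<partial>lborel)"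
    using nn_integral_real_affine[of "\<lambda>x. G x y" 1 "a * y"] by (simp add: add.commute)
qed

lemma nn_integral_shear_snd:
  fixes G :: "real \<Rightarrow> real \<Rightarrow> ennreal"
  assumes [measurable]: "case_prod G \<in> borel_measurable (borel \<Otimes>\<^sub>M borel)"
  shows "(\<integral>\<^sup>+y. \<integral>\<^sup>+x. G x (y + a * x) \<partial>lborel \<partial>lborel) = (\<integral>\<^sup>+y. \<integral>\<^sup>+x. G x y \<partial>lborel \<partial>lborel)"
proof -
  have m[measurable]: "case_prod G \<in> borel_measurable (borel \<Otimes>\<^sub>M borel)" by fact
  have "(\<integral>\<^sup>+y. \<integral>\<^sup>+x. G x (y + a * x) \<partial>lborel \<partial>lborel) = (\<integral>\<^sup>+x. \<integral>\<^sup>+y. G x (y + a * x) \<partial>lborel \<partial>lborel)"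
    by (rule lborel_pair.Fubini') measurable
  also have "\<dots> = (\<integral>\<^sup>+x. \<integral>\<^sup>+y. G x y \<partial>lborel \<partial>lborel)"
    by (rule nn_integral_shear_fst) measurable
  also have "\<dots> = (\<integral>\<^sup>+y. \<integral>\<^sup>+x. G x y \<partial>lborel \<partial>lborel)"
    by (rule lborel_pair.Fubini'[symmetric]) measurable
  finally show ?thesis .
qed

text \<open>A plane rotation is a product of three shears, and each shear preserves Lebesgue
measure by translation invariance in one variable. The half turn is excluded because the shears have slope
$\tan(\theta/2)$.\<close>

lemma nn_integral_rotation_lborel:
  fixes G :: "real \<Rightarrow> real \<Rightarrow> ennreal"
  assumes [measurable]: "case_prod G \<in> borel_measurable (borel \<Otimes>\<^sub>M borel)"
    and cs: "c\<^sup>2 + s\<^sup>2 = 1" and c: "c \<noteq> -1"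
  shows "(\<integral>\<^sup>+y. \<integral>\<^sup>+x. G (c * x + s * y) (- s * x + c * y) \<partial>lborel \<partial>lborel)
           = (\<integral>\<^sup>+y. \<integral>\<^sup>+x. G x y \<partial>lborel \<partial>lborel)"
proof -
  \<comment> \<open>The slope $\tan(\theta/2)$ of the horizontal shears; the vertical shear has slope $-\sin\theta$.\<close>
  define a where "a = s / (1 + c)"
  have c': "1 + c \<noteq> 0" using c by auto
  have s2: "s * s = (1 - c) * (1 + c)" using cs by (simp add: power2_eq_square algebra_simps)
  have as: "a * s = 1 - c" using c' s2 by (simp add: a_def field_simps)
  have ac: "a * (1 + c) = s" using c' by (simp add: a_def)
  have "(\<integral>\<^sup>+y. \<integral>\<^sup>+x. G x y \<partial>lborel \<partial>lborel) = (\<integral>\<^sup>+y. \<integral>\<^sup>+x. G (x + a * y) y \<partial>lborel \<partial>lborel)"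
    by (rule nn_integral_shear_fst[symmetric]) measurable
  also have "\<dots> = (\<integral>\<^sup>+y. \<integral>\<^sup>+x. G (x + a * (y + (-s) * x)) (y + (-s) * x) \<partial>lborel \<partial>lborel)"
    by (rule nn_integral_shear_snd[where G = "\<lambda>x y. G (x + a * y) y", symmetric]) measurable
  also have "\<dots> = (\<integral>\<^sup>+y. \<integral>\<^sup>+x. G ((x + a * y) + a * (y + (-s) * (x + a * y))) (y + (-s) * (x + a * y)) \<partial>lborel \<partial>lborel)"
    by (rule nn_integral_shear_fst[where G = "\<lambda>x y. G (x + a * (y + (-s) * x)) (y + (-s) * x)", symmetric]) measurable
  also have "\<dots> = (\<integral>\<^sup>+y. \<integral>\<^sup>+x. G (c * x + s * y) (- s * x + c * y) \<partial>lborel \<partial>lborel)"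
  proof (intro nn_integral_cong)
    fix x y :: real
    have 1: "y + (-s) * (x + a * y) = - s * x + c * y"
      using as by algebra
    have 2: "(x + a * y) + a * (- s * x + c * y) = c * x + s * y"
      using as ac by algebra
    show "G ((x + a * y) + a * (y + (-s) * (x + a * y))) (y + (-s) * (x + a * y))
        = G (c * x + s * y) (- s * x + c * y)"
      unfolding 1 2 ..
  qed
  finally show ?thesis by simp
qed


lemma measurable_gauss_upd [measurable]:
  assumes [measurable]: "g \<in> M \<rightarrow>\<^sub>M gauss" "h \<in> borel_measurable M"
  shows "(\<lambda>x. (g x)(p := h x)) \<in> M \<rightarrow>\<^sub>M gauss"
proof (rule measurable_gaussI)
  fix q show "(\<lambda>x. ((g x)(p := h x)) q) \<in> borel_measurable M"
    using measurable_compose[OF assms(1) measurable_coordinate, of q] by (cases "q = p") auto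
qed

lemma nn_integral_upd:
  assumes [measurable]: "f \<in> borel_measurable gauss"
  shows "(\<integral>\<^sup>+\<omega>. f \<omega> \<partial>gauss)
    = (\<integral>\<^sup>+\<omega>. \<integral>\<^sup>+x. ennreal (std_normal_density x) * f (fun_upd \<omega> p x) \<partial>lborel \<partial>gauss)"
proof -
  have "(\<integral>\<^sup>+\<omega>. f \<omega> \<partial>gauss) = (\<integral>\<^sup>+\<omega>'. \<integral>\<^sup>+\<omega>. f (resample (- {p}) \<omega>' \<omega>) \<partial>gauss \<partial>gauss)"
    by (rule nn_integral_resample) measurable
  also have "\<dots> = (\<integral>\<^sup>+\<omega>'. \<integral>\<^sup>+\<omega>. f (fun_upd \<omega>' p (\<omega> p)) \<partial>gauss \<partial>gauss)"
    by (intro nn_integral_cong arg_cong[where f = f]) (auto simp: resample_def)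
  also have "\<dots> = (\<integral>\<^sup>+\<omega>. \<integral>\<^sup>+x. ennreal (std_normal_density x) * f (fun_upd \<omega> p x) \<partial>lborel \<partial>gauss)"
    by (intro nn_integral_cong nn_integral_coordinate[where f = "\<lambda>x. f (fun_upd _ p x)"]) measurable
  finally show ?thesis .
qed

text \<open>Rotates each of the coordinate pairs $(p, \tau p)$, $p \in P$, by the same angle with cosine \<open>c\<close> and sine
\<open>s\<close>. In the uses \<open>\<tau>\<close> is an involution exchanging two rows or two columns of a matrix,
so that one rotation acts on two whole rows or columns.\<close>

definition rotate_pairs :: "('i \<Rightarrow> 'i) \<Rightarrow> 'i set \<Rightarrow> real \<Rightarrow> real \<Rightarrow> ('i \<Rightarrow> real) \<Rightarrow> 'i \<Rightarrow> real" where
  "rotate_pairs \<tau> P c s \<omega> p =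
    (if p \<in> P then c * \<omega> p + s * \<omega> (\<tau> p)
     else if \<tau> p \<in> P then - s * \<omega> (\<tau> p) + c * \<omega> p else \<omega> p)"

lemma measurable_rotate_pairs [measurable]:
  assumes f: "f \<in> M \<rightarrow>\<^sub>M gauss"
  shows "(\<lambda>x. rotate_pairs \<tau> P c s (f x)) \<in> M \<rightarrow>\<^sub>M gauss"
proof (rule measurable_gaussI)
  have [measurable]: "(\<lambda>x. f x q) \<in> borel_measurable M" for q
    by (rule measurable_compose[OF f measurable_coordinate])
  show "(\<lambda>x. rotate_pairs \<tau> P c s (f x) p) \<in> borel_measurable M" for p
    unfolding rotate_pairs_def by measurable
qed

lemma distr_gauss_eqI:
  assumes T [measurable]: "T \<in> gauss \<rightarrow>\<^sub>M gauss"
    and eq: "\<And>f. f \<in> borel_measurable gauss \<Longrightarrow> (\<integral>\<^sup>+\<omega>. f (T \<omega>) \<partial>gauss) = (\<integral>\<^sup>+\<omega>. f \<omega> \<partial>gauss)"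
  shows "distr gauss gauss T = gauss"
proof (rule measure_eqI)
  fix A assume "A \<in> sets (distr gauss gauss T)"
  then have A [measurable]: "A \<in> sets gauss" by simp
  have "emeasure (distr gauss gauss T) A = (\<integral>\<^sup>+\<omega>. indicator A \<omega> \<partial>distr gauss gauss T)"
    by simp
  also have "\<dots> = (\<integral>\<^sup>+\<omega>. indicator A (T \<omega>) \<partial>gauss)"
    by (subst nn_integral_distr) auto
  also have "\<dots> = emeasure gauss A"
    by (subst eq) auto
  finally show "emeasure (distr gauss gauss T) A = emeasure gauss A" .
qed simp

text \<open>The joint density of two coordinates depends on $x^2+y^2$ only, so the invariance of
Lebesgue measure carries over.\<close>

lemma distr_rotate_pairs1_aux:
  assumes pq: "\<tau> p = q" "\<tau> q = p" "p \<noteq> q" "\<And>x. \<tau> (\<tau> x) = x" and cs: "c\<^sup>2 + s\<^sup>2 = 1" and c: "c \<noteq> -1"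
  shows "distr gauss gauss (rotate_pairs \<tau> {p} c s) = gauss"
proof (rule distr_gauss_eqI)
  show [measurable]: "rotate_pairs \<tau> {p} c s \<in> gauss \<rightarrow>\<^sub>M gauss"
    using measurable_rotate_pairs[of "\<lambda>x. x" gauss] by simp
  fix f :: "('a \<Rightarrow> real) \<Rightarrow> ennreal" assume [measurable]: "f \<in> borel_measurable gauss"
  let ?n = "\<lambda>x. ennreal (std_normal_density x)"
  have two: "(\<integral>\<^sup>+\<omega>. g \<omega> \<partial>gauss)
      = (\<integral>\<^sup>+\<omega>. \<integral>\<^sup>+y. \<integral>\<^sup>+x. ennreal (exp (- (x\<^sup>2 + y\<^sup>2) / 2) / (2 * pi)) * g (fun_upd (fun_upd \<omega> q y) p x) \<partial>lborel \<partial>lborel \<partial>gauss)"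
    if [measurable]: "g \<in> borel_measurable gauss" for g :: "('a \<Rightarrow> real) \<Rightarrow> ennreal"
  proof -
    have "(\<integral>\<^sup>+\<omega>. g \<omega> \<partial>gauss) = (\<integral>\<^sup>+\<omega>. \<integral>\<^sup>+x. ?n x * g (fun_upd \<omega> p x) \<partial>lborel \<partial>gauss)"
      by (rule nn_integral_upd) measurable
    also have "\<dots> = (\<integral>\<^sup>+\<omega>. \<integral>\<^sup>+y. ?n y * (\<integral>\<^sup>+x. ?n x * g (fun_upd (fun_upd \<omega> q y) p x) \<partial>lborel) \<partial>lborel \<partial>gauss)"
      by (rule nn_integral_upd) measurable
    also have "\<dots> = (\<integral>\<^sup>+\<omega>. \<integral>\<^sup>+y. \<integral>\<^sup>+x. ennreal (exp (- (x\<^sup>2 + y\<^sup>2) / 2) / (2 * pi)) * g (fun_upd (fun_upd \<omega> q y) p x) \<partial>lborel \<partial>lborel \<partial>gauss)"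
    proof (intro nn_integral_cong)
      fix \<omega> :: "'a \<Rightarrow> real" and y :: real
      have e: "?n y * ?n x = ennreal (exp (- (x\<^sup>2 + y\<^sup>2) / 2) / (2 * pi))" for x :: real
        by (simp add: std_normal_density_def ennreal_mult'[symmetric] exp_add[symmetric]
            real_sqrt_mult field_simps)
      have "?n y * (\<integral>\<^sup>+x. ?n x * g (fun_upd (fun_upd \<omega> q y) p x) \<partial>lborel)
          = (\<integral>\<^sup>+x. ?n y * (?n x * g (fun_upd (fun_upd \<omega> q y) p x)) \<partial>lborel)"
        by (intro nn_integral_cmult[symmetric] borel_measurable_times measurable_compose[OF _ that]
            measurable_gauss_upd) auto
      then show "?n y * (\<integral>\<^sup>+x. ?n x * g (fun_upd (fun_upd \<omega> q y) p x) \<partial>lborel)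
          = (\<integral>\<^sup>+x. ennreal (exp (- (x\<^sup>2 + y\<^sup>2) / 2) / (2 * pi)) * g (fun_upd (fun_upd \<omega> q y) p x) \<partial>lborel)"
        by (simp only: mult.assoc[symmetric] e)
    qed
    finally show ?thesis .
  qed
  have "(\<integral>\<^sup>+\<omega>. f (rotate_pairs \<tau> {p} c s \<omega>) \<partial>gauss)
      = (\<integral>\<^sup>+\<omega>. \<integral>\<^sup>+y. \<integral>\<^sup>+x. ennreal (exp (- (x\<^sup>2 + y\<^sup>2) / 2) / (2 * pi)) * f (rotate_pairs \<tau> {p} c s (fun_upd (fun_upd \<omega> q y) p x)) \<partial>lborel \<partial>lborel \<partial>gauss)"
    by (rule two) measurable
  also have "\<dots> = (\<integral>\<^sup>+\<omega>. \<integral>\<^sup>+y. \<integral>\<^sup>+x. ennreal (exp (- ((c * x + s * y)\<^sup>2 + (- s * x + c * y)\<^sup>2) / 2) / (2 * pi))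
      * f (fun_upd (fun_upd \<omega> q (- s * x + c * y)) p (c * x + s * y)) \<partial>lborel \<partial>lborel \<partial>gauss)"
  proof (intro nn_integral_cong arg_cong2[where f = "(*)"] arg_cong[where f = f])
    fix \<omega> :: "'a \<Rightarrow> real" and x y :: real
    have "(c * x + s * y)\<^sup>2 + (- s * x + c * y)\<^sup>2 = x\<^sup>2 + y\<^sup>2"
      using cs by algebra
    then show "ennreal (exp (- (x\<^sup>2 + y\<^sup>2) / 2) / (2 * pi))
      = ennreal (exp (- ((c * x + s * y)\<^sup>2 + (- s * x + c * y)\<^sup>2) / 2) / (2 * pi))" by simp
    show "rotate_pairs \<tau> {p} c s (fun_upd (fun_upd \<omega> q y) p x)
        = fun_upd (fun_upd \<omega> q (- s * x + c * y)) p (c * x + s * y)"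
    proof
      fix z
      have z: "\<tau> z = p \<longleftrightarrow> z = q" using pq(1,2,4) by metis
      show "rotate_pairs \<tau> {p} c s (fun_upd (fun_upd \<omega> q y) p x) z
          = fun_upd (fun_upd \<omega> q (- s * x + c * y)) p (c * x + s * y) z"
        using pq(1-3) by (cases "z = p"; cases "z = q") (simp_all add: rotate_pairs_def z)
    qed
  qed
  also have "\<dots> = (\<integral>\<^sup>+\<omega>. \<integral>\<^sup>+y. \<integral>\<^sup>+x. ennreal (exp (- (x\<^sup>2 + y\<^sup>2) / 2) / (2 * pi)) * f (fun_upd (fun_upd \<omega> q y) p x) \<partial>lborel \<partial>lborel \<partial>gauss)"
    by (intro nn_integral_cong
        nn_integral_rotation_lborel[where G = "\<lambda>x y. ennreal (exp (- (x\<^sup>2 + y\<^sup>2) / 2) / (2 * pi)) * f (fun_upd (fun_upd _ q y) p x)"] cs c)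
      measurable
  also have "\<dots> = (\<integral>\<^sup>+\<omega>. f \<omega> \<partial>gauss)"
    by (rule two[symmetric]) measurable
  finally show "(\<integral>\<^sup>+\<omega>. f (rotate_pairs \<tau> {p} c s \<omega>) \<partial>gauss) = (\<integral>\<^sup>+\<omega>. f \<omega> \<partial>gauss)" .
qed

lemma distr_gauss_comp:
  assumes [measurable]: "S \<in> gauss \<rightarrow>\<^sub>M gauss" "T \<in> gauss \<rightarrow>\<^sub>M gauss"
    and "distr gauss gauss S = gauss" "distr gauss gauss T = gauss"
  shows "distr gauss gauss (\<lambda>\<omega>. S (T \<omega>)) = gauss"
proof -
  have "distr gauss gauss (\<lambda>\<omega>. S (T \<omega>)) = distr (distr gauss gauss T) gauss S"
    by (subst distr_distr) (auto simp: comp_def)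
  then show ?thesis using assms by simp
qed

lemma distr_rotate_pairs1:
  assumes pq: "\<And>x. \<tau> (\<tau> x) = x" "\<tau> p \<noteq> p" and cs: "c\<^sup>2 + s\<^sup>2 = 1"
  shows "distr gauss gauss (rotate_pairs \<tau> {p} c s) = gauss"
proof (cases "c = -1")
  case False
  then show ?thesis using assms by (intro distr_rotate_pairs1_aux[where q = "\<tau> p"]) auto
next
  case True
  then have [simp]: "s = 0" using cs by simp
  \<comment> \<open>The half turn is the square of a quarter turn.\<close>
  have q: "distr gauss gauss (rotate_pairs \<tau> {p} 0 1) = gauss"
    using assms by (intro distr_rotate_pairs1_aux[where q = "\<tau> p"]) auto
  have m: "rotate_pairs \<tau> {p} 0 1 \<in> gauss \<rightarrow>\<^sub>M gauss"
    using measurable_rotate_pairs[of "\<lambda>x. x" gauss] by simp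
  have eq: "rotate_pairs \<tau> {p} c s = (\<lambda>\<omega>. rotate_pairs \<tau> {p} 0 1 (rotate_pairs \<tau> {p} 0 1 \<omega>))"
    using pq True by (fastforce simp: rotate_pairs_def fun_eq_iff)
  show ?thesis
    unfolding eq by (rule distr_gauss_comp[OF m m q q])
qed

text \<open>The pairs are disjoint, so the rotation is a composition of rotations of single
pairs.\<close>

lemma distr_rotate_pairs:
  assumes "finite P" and inv: "\<And>x. \<tau> (\<tau> x) = x" and P: "\<And>p. p \<in> P \<Longrightarrow> \<tau> p \<notin> P" and cs: "c\<^sup>2 + s\<^sup>2 = 1"
  shows "distr gauss gauss (rotate_pairs \<tau> P c s) = gauss"
  using assms(1) P
proof (induction P)
  case empty
  have "rotate_pairs \<tau> {} c s = (\<lambda>\<omega>. \<omega>)" by (simp add: rotate_pairs_def fun_eq_iff)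
  then show ?case by (simp add: distr_id2)
next
  case (insert p P)
  have m: "rotate_pairs \<tau> Q c s \<in> gauss \<rightarrow>\<^sub>M gauss" for Q
    using measurable_rotate_pairs[of "\<lambda>x. x" gauss] by simp
  have p: "\<tau> p \<noteq> p" "\<tau> p \<notin> P" using insert.prems[of p] by auto
  have px: "x = \<tau> p" if "\<tau> x = p" for x using inv[of x] that by simp
  have eq: "rotate_pairs \<tau> (insert p P) c s = (\<lambda>\<omega>. rotate_pairs \<tau> {p} c s (rotate_pairs \<tau> P c s \<omega>))"
  proof (intro ext)
    fix \<omega> :: "'a \<Rightarrow> real" and x
    consider "x = p" | "x = \<tau> p" "x \<noteq> p" | "x \<noteq> p" "\<tau> x \<noteq> p" using px by blast
    then show "rotate_pairs \<tau> (insert p P) c s \<omega> x = rotate_pairs \<tau> {p} c s (rotate_pairs \<tau> P c s \<omega>) x"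
    proof cases
      case 1 then show ?thesis using insert.hyps p by (simp add: rotate_pairs_def inv)
    next
      case 2
      then have "\<tau> x = p" by (simp add: inv)
      then show ?thesis using 2 insert.hyps p by (simp add: rotate_pairs_def)
    next
      case 3 then show ?thesis by (simp add: rotate_pairs_def)
    qed
  qed
  have "\<tau> q \<notin> P" if "q \<in> P" for q using insert.prems[of q] that by blast
  then have IH: "distr gauss gauss (rotate_pairs \<tau> P c s) = gauss" by (rule insert.IH)
  show ?case
    unfolding eq by (rule distr_gauss_comp[OF m m distr_rotate_pairs1[OF inv p(1) cs] IH])
qed

lemma integral_rotate_pairs:
  fixes f :: "_ \<Rightarrow> 'b::{banach, second_countable_topology}"
  assumes "finite P" "\<And>x. \<tau> (\<tau> x) = x" "\<And>p. p \<in> P \<Longrightarrow> \<tau> p \<notin> P" "c\<^sup>2 + s\<^sup>2 = 1"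
    and [measurable]: "f \<in> borel_measurable gauss"
  shows "(\<integral>\<omega>. f (rotate_pairs \<tau> P c s \<omega>) \<partial>gauss) = (\<integral>\<omega>. f \<omega> \<partial>gauss)"
proof -
  have [measurable]: "rotate_pairs \<tau> P c s \<in> gauss \<rightarrow>\<^sub>M gauss"
    using measurable_rotate_pairs[of "\<lambda>x. x" gauss] by simp
  have "(\<integral>\<omega>. f \<omega> \<partial>gauss) = (\<integral>\<omega>. f \<omega> \<partial>distr gauss gauss (rotate_pairs \<tau> P c s))"
    by (simp add: distr_rotate_pairs assms)
  also have "\<dots> = (\<integral>\<omega>. f (rotate_pairs \<tau> P c s \<omega>) \<partial>gauss)"
    by (rule integral_distr) measurable
  finally show ?thesis by simp
qed

section \<open>Hafnians of Gram matrices\<close>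

text \<open>The hafnian over an arbitrary vertex set, which is what remains after matched vertices are removed.\<close>

definition haf :: "nat set \<Rightarrow> (nat \<Rightarrow> nat \<Rightarrow> real) \<Rightarrow> real" where
  "haf V g = (\<Sum>m\<in>perfect_matchings V. \<Prod>e\<in>m. g (Min e) (Max e))"

lemma perfect_matchings_empty [simp]: "perfect_matchings {} = {{}}"
  by (auto simp: perfect_matchings_def partition_on_def disjoint_def)

lemma haf_empty [simp]: "haf {} g = 1"
  by (simp add: haf_def)

lemma finite_perfect_matchings: "finite V \<Longrightarrow> finite (perfect_matchings V)"
  by (rule finite_subset[of _ "Pow (Pow V)"]) (auto simp: perfect_matchings_def partition_on_def)

lemma perfect_matchings_insert:
  assumes "m \<in> perfect_matchings (V - {i, j})" "i \<in> V" "j \<in> V" "i \<noteq> j"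
  shows "insert {i, j} m \<in> perfect_matchings V" "i \<notin> \<Union>m" "{i, j} \<notin> m"
proof -
  have m: "\<Union>m = V - {i, j}" "disjoint m" "{} \<notin> m" "\<forall>e\<in>m. card e = 2"
    using assms(1) by (auto simp: perfect_matchings_def partition_on_def)
  show "i \<notin> \<Union>m" using m(1) by auto
  then show "{i, j} \<notin> m" by auto
  have "disjoint (insert {i, j} m)"
  proof -
    have "e \<inter> {i, j} = {}" if "e \<in> m" for e using m(1) that by blast
    then show ?thesis using m(2) by (auto simp: disjoint_def)
  qed
  then show "insert {i, j} m \<in> perfect_matchings V"
    using m assms(2-4) by (auto simp: perfect_matchings_def partition_on_def)
qed

lemma perfect_matchings_remove:
  assumes "m \<in> perfect_matchings V" "i \<in> V"
  obtains j where "j \<in> V - {i}" "{i, j} \<in> m" "m - {{i, j}} \<in> perfect_matchings (V - {i, j})"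
proof -
  have m: "\<Union>m = V" "disjoint m" "{} \<notin> m" "\<forall>e\<in>m. card e = 2"
    using assms(1) by (auto simp: perfect_matchings_def partition_on_def)
  then obtain e where e: "e \<in> m" "i \<in> e" using assms(2) by blast
  then obtain j where j: "e = {i, j}" "i \<noteq> j"
    using m(4) by (metis card_2_iff doubleton_eq_iff insertE singletonD)
  have "\<Union>(m - {e}) = V - e"
  proof -
    have "\<Union>(m - {e}) \<inter> e = {}" using m(2) e(1) by (auto simp: disjoint_def)
    then show ?thesis using m(1) e(1) by blast
  qed
  then have "m - {{i, j}} \<in> perfect_matchings (V - {i, j})"
    using m j by (auto simp: perfect_matchings_def partition_on_def disjoint_def)
  moreover have "j \<in> V - {i}" using m(1) e j by auto
  ultimately show ?thesis using that e j by blast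
qed

text \<open>A perfect matching consists of the edge at \<open>i\<close> and a perfect matching of the remaining
vertices.\<close>

lemma haf_expand:
  assumes "finite V" "i \<in> V" and sym: "\<And>x y. g x y = g y x"
  shows "haf V g = (\<Sum>j\<in>V - {i}. g i j * haf (V - {i, j}) g)"
proof -
  let ?S = "Sigma (V - {i}) (\<lambda>j. perfect_matchings (V - {i, j}))"
  let ?f = "\<lambda>(j, m). insert {i, j} m"
  let ?w = "\<lambda>e. g (Min e) (Max e)"
  have w: "?w {i, j} = g i j" for j
    using sym by (cases "i \<le> j") auto
  have "bij_betw ?f ?S (perfect_matchings V)"
  proof (rule bij_betwI')
    fix x y assume x: "x \<in> ?S" and y: "y \<in> ?S"
    obtain j m where jm: "x = (j, m)" by (cases x)
    obtain j' m' where jm': "y = (j', m')" by (cases y)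
    have 1: "i \<notin> \<Union>m" "{i, j} \<notin> m" "i \<noteq> j"
      using x jm perfect_matchings_insert[of m V i j] assms by auto
    have 2: "i \<notin> \<Union>m'" "{i, j'} \<notin> m'" "i \<noteq> j'"
      using y jm' perfect_matchings_insert[of m' V i j'] assms by auto
    show "(?f x = ?f y) = (x = y)"
    proof
      assume "?f x = ?f y"
      then have eq: "insert {i, j} m = insert {i, j'} m'" by (simp add: jm jm')
      then have "{i, j} \<in> insert {i, j'} m'" by blast
      then have j: "j = j'" using 2(1) by (auto simp: doubleton_eq_iff)
      then have "m = m'" using eq 1(2) 2(2) by (metis insert_ident)
      then show "x = y" using j jm jm' by simp
    qed simp
  next
    fix x assume "x \<in> ?S"
    then show "?f x \<in> perfect_matchings V"
      using perfect_matchings_insert(1)[of "snd x" V i "fst x"] assms(2) by (cases x) auto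
  next
    fix m assume "m \<in> perfect_matchings V"
    then obtain j where "j \<in> V - {i}" "{i, j} \<in> m" "m - {{i, j}} \<in> perfect_matchings (V - {i, j})"
      using assms(2) by (rule perfect_matchings_remove)
    then show "\<exists>x\<in>?S. m = ?f x"
      by (intro bexI[of _ "(j, m - {{i, j}})"]) auto
  qed
  then have "haf V g = (\<Sum>x\<in>?S. prod ?w (?f x))"
    unfolding haf_def by (rule sum.reindex_bij_betw[symmetric])
  also have "\<dots> = (\<Sum>(j, m)\<in>?S. g i j * prod ?w m)"
  proof (rule sum.cong[OF refl])
    fix x assume x: "x \<in> ?S"
    obtain j m where jm: "x = (j, m)" by (cases x)
    then have j: "j \<in> V" "j \<noteq> i" and m: "m \<in> perfect_matchings (V - {i, j})" using x by auto
    have "finite m"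
      using m assms(1) by (auto simp: perfect_matchings_def partition_on_def intro: finite_UnionD)
    moreover have "{i, j} \<notin> m"
      using perfect_matchings_insert(3)[OF m assms(2) j(1)] j(2) by simp
    ultimately show "prod ?w (?f x) = (case x of (j, m) \<Rightarrow> g i j * prod ?w m)"
      using w[of j] by (simp add: jm del: Min_insert Max_insert)
  qed
  also have "\<dots> = (\<Sum>j\<in>V - {i}. \<Sum>m\<in>perfect_matchings (V - {i, j}). g i j * prod ?w m)"
    using assms(1) by (subst sum.Sigma) (auto intro: finite_perfect_matchings)
  finally show ?thesis by (simp add: haf_def sum_distrib_left)
qed

definition gram_on :: "'r set \<Rightarrow> ('r \<times> nat \<Rightarrow> real) \<Rightarrow> nat \<Rightarrow> nat \<Rightarrow> real" where
  "gram_on A \<omega> i j = (\<Sum>a\<in>A. \<omega> (a, i) * \<omega> (a, j))"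

definition gram_haf :: "'r set \<Rightarrow> nat set \<Rightarrow> ('r \<times> nat \<Rightarrow> real) \<Rightarrow> real" where
  "gram_haf A V \<omega> = haf V (gram_on A \<omega>)"

lemma gram_on_commute: "gram_on A \<omega> i j = gram_on A \<omega> j i"
  by (simp add: gram_on_def mult.commute)

lemma gram_haf_empty [simp]: "gram_haf A {} \<omega> = 1"
  by (simp add: gram_haf_def)

lemma gram_haf_expand:
  assumes "finite V" "i \<in> V"
  shows "gram_haf A V \<omega> = (\<Sum>j\<in>V - {i}. gram_on A \<omega> i j * gram_haf A (V - {i, j}) \<omega>)"
  unfolding gram_haf_def by (rule haf_expand[OF assms]) (rule gram_on_commute)

lemma gram_haf_cong_gram_on:
  assumes "\<And>i j. i \<in> V \<Longrightarrow> j \<in> V \<Longrightarrow> gram_on A \<omega> i j = gram_on A' \<omega>' i j"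
  shows "gram_haf A V \<omega> = gram_haf A' V \<omega>'"
  unfolding gram_haf_def haf_def
proof (intro sum.cong prod.cong refl)
  fix m e assume "m \<in> perfect_matchings V" "e \<in> m"
  then have "e \<subseteq> V" "card e = 2" by (auto simp: perfect_matchings_def partition_on_def)
  then have "finite e" "e \<noteq> {}" "e \<subseteq> V" by (auto intro: card_ge_0_finite)
  then show "gram_on A \<omega> (Min e) (Max e) = gram_on A' \<omega>' (Min e) (Max e)"
    by (intro assms) (auto dest: Min_in Max_in)
qed

lemma gram_haf_cong:
  assumes "\<And>a i. a \<in> A \<Longrightarrow> i \<in> V \<Longrightarrow> \<omega> (a, i) = \<omega>' (a, i)"
  shows "gram_haf A V \<omega> = gram_haf A V \<omega>'"
  by (rule gram_haf_cong_gram_on) (simp add: gram_on_def assms cong: sum.cong)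

lemma measurable_gram_haf [measurable]:
  assumes [measurable]: "f \<in> M \<rightarrow>\<^sub>M gauss"
  shows "(\<lambda>x. gram_haf A V (f x)) \<in> borel_measurable M"
proof -
  have [measurable]: "(\<lambda>x. f x q) \<in> borel_measurable M" for q
    by (rule measurable_compose[OF assms measurable_coordinate])
  show ?thesis unfolding gram_haf_def haf_def gram_on_def by measurable
qed

text \<open>The vector \<open>W\<close> with which a further column has to be multiplied to give the hafnian of the enlarged set
of columns (see \<open>gram_haf_linear\<close>).\<close>

definition column_coeff :: "'r set \<Rightarrow> nat set \<Rightarrow> ('r \<times> nat \<Rightarrow> real) \<Rightarrow> 'r \<Rightarrow> real" where
  "column_coeff A V \<omega> a = (\<Sum>j\<in>V. \<omega> (a, j) * gram_haf A (V - {j}) \<omega>)"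

lemma gram_haf_linear:
  assumes "finite V" "i \<notin> V"
  shows "gram_haf A (insert i V) \<omega> = (\<Sum>a\<in>A. \<omega> (a, i) * column_coeff A V \<omega> a)"
proof -
  have "gram_haf A (insert i V) \<omega> = (\<Sum>j\<in>V. gram_on A \<omega> i j * gram_haf A (V - {j}) \<omega>)"
    using assms by (subst gram_haf_expand[of _ i]) (auto intro!: sum.cong simp: insert_Diff_if)
  also have "\<dots> = (\<Sum>a\<in>A. \<omega> (a, i) * column_coeff A V \<omega> a)"
    unfolding gram_on_def column_coeff_def sum_distrib_left sum_distrib_right
    by (subst sum.swap) (simp add: mult_ac)
  finally show ?thesis .
qed


lemma column_coeff_cong:
  assumes "\<And>b i. b \<in> insert a A \<Longrightarrow> i \<in> V \<Longrightarrow> \<omega> (b, i) = \<omega>' (b, i)"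
  shows "column_coeff A V \<omega> a = column_coeff A V \<omega>' a"
  unfolding column_coeff_def by (intro sum.cong arg_cong2[where f = "(*)"] gram_haf_cong assms) auto

lemma measurable_column_coeff [measurable]:
  assumes [measurable]: "f \<in> M \<rightarrow>\<^sub>M gauss"
  shows "(\<lambda>x. column_coeff A V (f x) a) \<in> borel_measurable M"
proof -
  have [measurable]: "(\<lambda>x. f x q) \<in> borel_measurable M" for q
    by (rule measurable_compose[OF assms measurable_coordinate])
  show ?thesis unfolding column_coeff_def by measurable
qed

text \<open>The coefficients of the hafnian as a bilinear form in two further columns. The two columns are either matched
to each other, which gives the diagonal, or to distinct columns \<open>p\<close> and \<open>q\<close>.\<close>

definition pair_form :: "'r set \<Rightarrow> nat set \<Rightarrow> ('r \<times> nat \<Rightarrow> real) \<Rightarrow> 'r \<Rightarrow> 'r \<Rightarrow> real" where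
  "pair_form A V \<omega> a b = (if a = b then gram_haf A V \<omega> else 0)
     + (\<Sum>p\<in>V. \<Sum>q\<in>V - {p}. \<omega> (a, p) * \<omega> (b, q) * gram_haf A (V - {p, q}) \<omega>)"

lemma pair_form_cong:
  assumes "\<And>c i. c \<in> {a, b} \<union> A \<Longrightarrow> i \<in> V \<Longrightarrow> \<omega> (c, i) = \<omega>' (c, i)"
  shows "pair_form A V \<omega> a b = pair_form A V \<omega>' a b"
proof -
  have "gram_haf A W \<omega> = gram_haf A W \<omega>'" if "W \<subseteq> V" for W
    using that by (intro gram_haf_cong assms) auto
  then show ?thesis
    unfolding pair_form_def by (intro arg_cong2[where f = "(+)"] sum.cong) (auto simp: assms)
qed

lemma pair_form_commute:
  assumes "finite V"
  shows "pair_form A V \<omega> a b = pair_form A V \<omega> b a"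
proof -
  have "(\<Sum>p\<in>V. \<Sum>q\<in>V - {p}. \<omega> (a, p) * \<omega> (b, q) * gram_haf A (V - {p, q}) \<omega>)
      = (\<Sum>p\<in>V. \<Sum>q\<in>V. if p = q then 0 else \<omega> (a, p) * \<omega> (b, q) * gram_haf A (V - {p, q}) \<omega>)" for a b
    using assms by (intro sum.cong refl sum.mono_neutral_cong_left) auto
  note * = this
  show ?thesis
    unfolding pair_form_def * by (subst (2) sum.swap) (auto simp: mult_ac insert_commute intro!: sum.cong)
qed

lemma gram_haf_bilinear:
  assumes V: "finite V" "i \<notin> V" "l \<notin> V" "i \<noteq> l" and A: "finite A"
  shows "gram_haf A (insert i (insert l V)) \<omega> = (\<Sum>a\<in>A. \<Sum>b\<in>A. \<omega> (a, i) * \<omega> (b, l) * pair_form A V \<omega> a b)"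
proof -
  have "gram_haf A (insert i (insert l V)) \<omega>
      = (\<Sum>a\<in>A. \<omega> (a, i) * column_coeff A (insert l V) \<omega> a)"
    using V by (intro gram_haf_linear) auto
  also have "\<dots> = (\<Sum>a\<in>A. \<omega> (a, i) * (\<Sum>b\<in>A. \<omega> (b, l) * pair_form A V \<omega> a b))"
  proof (intro sum.cong refl arg_cong2[where f = "(*)"])
    fix a assume a: "a \<in> A"
    have "column_coeff A (insert l V) \<omega> a
        = \<omega> (a, l) * gram_haf A V \<omega> + (\<Sum>p\<in>V. \<omega> (a, p) * gram_haf A (insert l (V - {p})) \<omega>)"
      using V unfolding column_coeff_def by (subst sum.insert) (auto intro!: sum.cong simp: insert_Diff_if)
    also have "(\<Sum>p\<in>V. \<omega> (a, p) * gram_haf A (insert l (V - {p})) \<omega>)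
        = (\<Sum>p\<in>V. \<Sum>b\<in>A. \<Sum>q\<in>V - {p}. \<omega> (b, l) * (\<omega> (a, p) * \<omega> (b, q) * gram_haf A (V - {p, q}) \<omega>))"
    proof (rule sum.cong[OF refl])
      fix p assume "p \<in> V"
      have "gram_haf A (insert l (V - {p})) \<omega> = (\<Sum>b\<in>A. \<omega> (b, l) * column_coeff A (V - {p}) \<omega> b)"
        using V by (intro gram_haf_linear) auto
      then show "\<omega> (a, p) * gram_haf A (insert l (V - {p})) \<omega>
          = (\<Sum>b\<in>A. \<Sum>q\<in>V - {p}. \<omega> (b, l) * (\<omega> (a, p) * \<omega> (b, q) * gram_haf A (V - {p, q}) \<omega>))"
        by (simp add: column_coeff_def sum_distrib_left mult_ac Diff_insert2[symmetric] insert_commute)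
    qed
    also have "\<dots> = (\<Sum>b\<in>A. \<omega> (b, l) * (\<Sum>p\<in>V. \<Sum>q\<in>V - {p}. \<omega> (a, p) * \<omega> (b, q) * gram_haf A (V - {p, q}) \<omega>))"
      by (subst sum.swap) (simp add: sum_distrib_left)
    also have "\<omega> (a, l) * gram_haf A V \<omega> = (\<Sum>b\<in>A. \<omega> (b, l) * (if a = b then gram_haf A V \<omega> else 0))"
      using A a by (simp add: if_distrib[of "(*) _"] cong: if_cong)
    finally show "column_coeff A (insert l V) \<omega> a = (\<Sum>b\<in>A. \<omega> (b, l) * pair_form A V \<omega> a b)"
      by (simp add: pair_form_def distrib_left sum.distrib)
  qed
  finally show ?thesis by (simp add: sum_distrib_left mult_ac)
qed

section \<open>The second moment\<close>

text \<open>An algebra of functions that contains the coordinates; membership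
settles integrability of every polynomial of matrix entries.\<close>

definition all_moments :: "(('i \<Rightarrow> real) \<Rightarrow> real) \<Rightarrow> bool" where
  "all_moments f \<longleftrightarrow> f \<in> borel_measurable gauss \<and> (\<forall>p::nat. integrable gauss (\<lambda>\<omega>. \<bar>f \<omega>\<bar> ^ p))"

lemma all_moments_integrable:
  assumes "all_moments f"
  shows "integrable gauss f"
  using assms[unfolded all_moments_def] by (auto dest!: spec[of _ 1] simp: integrable_abs_iff)

lemma all_moments_const [simp, intro]: "all_moments (\<lambda>_. c)"
  by (simp add: all_moments_def)

lemma all_moments_coordinate [simp, intro]: "all_moments (\<lambda>\<omega>. \<omega> p)"
proof -
  have "integrable gauss (\<lambda>\<omega>. \<bar>\<omega> p\<bar> ^ n)" for n :: nat
  proof -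
    have "integrable (distr gauss std_normal_distribution (\<lambda>\<omega>. \<omega> p)) (\<lambda>x. \<bar>x\<bar> ^ n)"
      unfolding distr_coordinate
      by (subst integrable_density) (auto simp: integrable_std_normal_moment_abs)
    then show ?thesis by (subst (asm) integrable_distr_eq) auto
  qed
  then show ?thesis by (simp add: all_moments_def)
qed

lemma all_moments_mult [intro]:
  assumes "all_moments f" "all_moments g"
  shows "all_moments (\<lambda>\<omega>. f \<omega> * g \<omega>)"
proof -
  have [measurable]: "f \<in> borel_measurable gauss" "g \<in> borel_measurable gauss"
    using assms by (auto simp: all_moments_def)
  have "integrable gauss (\<lambda>\<omega>. \<bar>f \<omega> * g \<omega>\<bar> ^ n)" for n
  proof (rule Bochner_Integration.integrable_bound)
    show "integrable gauss (\<lambda>\<omega>. \<bar>f \<omega>\<bar> ^ (2 * n) + \<bar>g \<omega>\<bar> ^ (2 * n))"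
      using assms by (auto simp: all_moments_def)
    have "\<bar>x * y\<bar> ^ n \<le> \<bar>x\<bar> ^ (2 * n) + \<bar>y\<bar> ^ (2 * n)" for x y :: real
    proof -
      have "2 * (\<bar>x\<bar> ^ n * \<bar>y\<bar> ^ n) \<le> (\<bar>x\<bar> ^ n)\<^sup>2 + (\<bar>y\<bar> ^ n)\<^sup>2"
        using sum_squares_bound[of "\<bar>x\<bar> ^ n" "\<bar>y\<bar> ^ n"] by simp
      moreover have "0 \<le> \<bar>x\<bar> ^ n * \<bar>y\<bar> ^ n" by simp
      ultimately have "\<bar>x\<bar> ^ n * \<bar>y\<bar> ^ n \<le> (\<bar>x\<bar> ^ n)\<^sup>2 + (\<bar>y\<bar> ^ n)\<^sup>2" by linarith
      then show ?thesis
        by (simp add: abs_mult power_mult_distrib power_mult[symmetric] mult.commute)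
    qed
    then show "AE \<omega> in gauss. norm (\<bar>f \<omega> * g \<omega>\<bar> ^ n) \<le> norm (\<bar>f \<omega>\<bar> ^ (2 * n) + \<bar>g \<omega>\<bar> ^ (2 * n))"
      by (intro AE_I2) simp
  qed measurable
  then show ?thesis by (simp add: all_moments_def)
qed

lemma all_moments_add [intro]:
  assumes "all_moments f" "all_moments g"
  shows "all_moments (\<lambda>\<omega>. f \<omega> + g \<omega>)"
proof -
  have [measurable]: "f \<in> borel_measurable gauss" "g \<in> borel_measurable gauss"
    using assms by (auto simp: all_moments_def)
  have "integrable gauss (\<lambda>\<omega>. \<bar>f \<omega> + g \<omega>\<bar> ^ n)" for n
  proof (rule Bochner_Integration.integrable_bound)
    show "integrable gauss (\<lambda>\<omega>. 2 ^ n * (\<bar>f \<omega>\<bar> ^ n + \<bar>g \<omega>\<bar> ^ n))"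
      using assms by (auto simp: all_moments_def)
    have "\<bar>x + y\<bar> ^ n \<le> 2 ^ n * (\<bar>x\<bar> ^ n + \<bar>y\<bar> ^ n)" for x y :: real
    proof -
      have "\<bar>x + y\<bar> ^ n \<le> (2 * max \<bar>x\<bar> \<bar>y\<bar>) ^ n" by (intro power_mono) auto
      also have "\<dots> \<le> 2 ^ n * (\<bar>x\<bar> ^ n + \<bar>y\<bar> ^ n)"
        by (auto simp: power_mult_distrib max_def)
      finally show ?thesis .
    qed
    then show "AE \<omega> in gauss. norm (\<bar>f \<omega> + g \<omega>\<bar> ^ n) \<le> norm (2 ^ n * (\<bar>f \<omega>\<bar> ^ n + \<bar>g \<omega>\<bar> ^ n))"
      by (intro AE_I2) simp
  qed measurable
  then show ?thesis by (simp add: all_moments_def)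
qed

lemma all_moments_sum [intro]:
  "(\<And>i. i \<in> I \<Longrightarrow> all_moments (f i)) \<Longrightarrow> all_moments (\<lambda>\<omega>. \<Sum>i\<in>I. f i \<omega>)"
  by (induction I rule: infinite_finite_induct) auto

lemma all_moments_prod [intro]:
  "(\<And>i. i \<in> I \<Longrightarrow> all_moments (f i)) \<Longrightarrow> all_moments (\<lambda>\<omega>. \<Prod>i\<in>I. f i \<omega>)"
  by (induction I rule: infinite_finite_induct) auto

lemma all_moments_gram_haf [intro]: "all_moments (gram_haf A V)"
  unfolding gram_haf_def haf_def gram_on_def by (intro all_moments_sum all_moments_prod all_moments_mult all_moments_coordinate)

lemma all_moments_column_coeff [intro]: "all_moments (\<lambda>\<omega>. column_coeff A V \<omega> a)"
  unfolding column_coeff_def by (intro all_moments_sum all_moments_mult all_moments_coordinate all_moments_gram_haf)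

lemma expectation_coordinate:
  fixes f :: "real \<Rightarrow> 'b::{banach, second_countable_topology}"
  assumes [measurable]: "f \<in> borel_measurable borel"
  shows "(\<integral>\<omega>. f (\<omega> p) \<partial>gauss) = (\<integral>x. f x \<partial>std_normal_distribution)"
proof -
  have "(\<integral>x. f x \<partial>distr gauss std_normal_distribution (\<lambda>\<omega>. \<omega> p)) = (\<integral>\<omega>. f (\<omega> p) \<partial>gauss)"
    by (rule integral_distr) auto
  then show ?thesis by (simp add: distr_coordinate)
qed

text \<open>Independence in the form in which it is used: \<open>f\<close> reads only coordinates in \<open>J\<close> and \<open>g\<close> reads none of them.\<close>

lemma integral_mult_resample:
  fixes f g :: "('i \<Rightarrow> real) \<Rightarrow> 'b::{real_normed_field, banach, second_countable_topology}"
  assumes int: "integrable gauss (\<lambda>\<omega>. f \<omega> * g \<omega>)"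
    and f: "\<And>\<omega>' \<omega>. f (resample J \<omega>' \<omega>) = f \<omega>'" and g: "\<And>\<omega>' \<omega>. g (resample J \<omega>' \<omega>) = g \<omega>"
  shows "(\<integral>\<omega>. f \<omega> * g \<omega> \<partial>gauss) = (\<integral>\<omega>. f \<omega> \<partial>gauss) * (\<integral>\<omega>. g \<omega> \<partial>gauss)"
  by (subst integral_resample[OF int, of J]) (simp add: f g)

lemma expectation_two_coordinates:
  "(\<integral>\<omega>. \<omega> p * \<omega> q \<partial>gauss) = (if p = q then 1 else 0 :: real)"
proof (cases "p = q")
  case True
  have "(\<integral>\<omega>. (\<omega> p)\<^sup>2 \<partial>gauss) = (\<integral>x. x ^ (2 * 1) \<partial>std_normal_distribution)"
    using expectation_coordinate[of "\<lambda>x. x\<^sup>2" p] by simp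
  then show ?thesis
    using True std_normal_distribution_even_moments(1)[of 1] by (simp add: power2_eq_square)
next
  case False
  have "(\<integral>\<omega>. \<omega> p * \<omega> q \<partial>gauss) = (\<integral>\<omega>. \<omega> p \<partial>gauss) * (\<integral>\<omega>. \<omega> q \<partial>gauss)"
    using False by (intro integral_mult_resample[where J = "{p}"] all_moments_integrable) (auto simp: resample_def)
  also have "(\<integral>\<omega>. \<omega> p \<partial>gauss) = (\<integral>x. x ^ 1 \<partial>std_normal_distribution)"
    using expectation_coordinate[of "\<lambda>x. x" p] by simp
  also have "\<dots> = 0" by (rule integral_std_normal_distribution_moment_odd) simp
  finally show ?thesis using False by simp
qed

text \<open>Averaging over a column that occurs linearly in both factors contracts the coefficients,
because its entries are orthonormal.\<close>

lemma expectation_linear_forms: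
  fixes P Q :: "'r \<Rightarrow> ('r \<times> nat \<Rightarrow> real) \<Rightarrow> real"
  assumes A: "finite A"
    and P: "\<And>a. a \<in> A \<Longrightarrow> all_moments (P a)" and Q: "\<And>a. a \<in> A \<Longrightarrow> all_moments (Q a)"
    and PJ: "\<And>a \<omega>' \<omega>. a \<in> A \<Longrightarrow> P a (resample (A \<times> {l}) \<omega>' \<omega>) = P a \<omega>"
    and QJ: "\<And>a \<omega>' \<omega>. a \<in> A \<Longrightarrow> Q a (resample (A \<times> {l}) \<omega>' \<omega>) = Q a \<omega>"
  shows "(\<integral>\<omega>. (\<Sum>a\<in>A. \<omega> (a, l) * P a \<omega>) * (\<Sum>a\<in>A. \<omega> (a, l) * Q a \<omega>) \<partial>gauss)
    = (\<integral>\<omega>. (\<Sum>a\<in>A. P a \<omega> * Q a \<omega>) \<partial>gauss)"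
proof -
  have int: "integrable gauss (\<lambda>\<omega>. (\<omega> (a, l) * \<omega> (b, l)) * (P a \<omega> * Q b \<omega>))"
    if "a \<in> A" "b \<in> A" for a b
    using that by (intro all_moments_integrable all_moments_mult P Q all_moments_coordinate)
  have "(\<integral>\<omega>. (\<Sum>a\<in>A. \<omega> (a, l) * P a \<omega>) * (\<Sum>a\<in>A. \<omega> (a, l) * Q a \<omega>) \<partial>gauss)
      = (\<integral>\<omega>. (\<Sum>a\<in>A. \<Sum>b\<in>A. (\<omega> (a, l) * \<omega> (b, l)) * (P a \<omega> * Q b \<omega>)) \<partial>gauss)"
    by (simp add: sum_product mult_ac)
  also have "\<dots> = (\<Sum>a\<in>A. \<Sum>b\<in>A. \<integral>\<omega>. (\<omega> (a, l) * \<omega> (b, l)) * (P a \<omega> * Q b \<omega>) \<partial>gauss)"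
    using int by (simp add: Bochner_Integration.integral_sum)
  also have "\<dots> = (\<Sum>a\<in>A. \<Sum>b\<in>A. (if a = b then \<integral>\<omega>. P a \<omega> * Q a \<omega> \<partial>gauss else 0))"
  proof (intro sum.cong refl)
    fix a b assume ab: "a \<in> A" "b \<in> A"
    have "(\<integral>\<omega>. (\<omega> (a, l) * \<omega> (b, l)) * (P a \<omega> * Q b \<omega>) \<partial>gauss)
        = (\<integral>\<omega>. \<omega> (a, l) * \<omega> (b, l) \<partial>gauss) * (\<integral>\<omega>. P a \<omega> * Q b \<omega> \<partial>gauss)"
      using ab by (intro integral_mult_resample[where J = "A \<times> {l}"] int) (auto simp: PJ QJ resample_def)
    then show "(\<integral>\<omega>. (\<omega> (a, l) * \<omega> (b, l)) * (P a \<omega> * Q b \<omega>) \<partial>gauss)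
        = (if a = b then \<integral>\<omega>. P a \<omega> * Q a \<omega> \<partial>gauss else 0)"
      by (simp add: expectation_two_coordinates)
  qed
  also have "\<dots> = (\<Sum>a\<in>A. \<integral>\<omega>. P a \<omega> * Q a \<omega> \<partial>gauss)"
    using A by simp
  also have "\<dots> = (\<integral>\<omega>. (\<Sum>a\<in>A. P a \<omega> * Q a \<omega>) \<partial>gauss)"
    by (subst Bochner_Integration.integral_sum) (auto intro!: all_moments_integrable P Q)
  finally show ?thesis .
qed

text \<open>Averaging over one column leaves $E|W|^2 = \sum_{j,l} E\,\langle x_j,x_l\rangle h_j h_l$, where $h_j$ is
the hafnian without column \<open>j\<close>. A diagonal term is \<open>k\<close> times the smaller second moment. In an
off-diagonal one column \<open>l\<close> occurs in the inner product and in $h_j$; averaging over it turns the product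
$\langle x_j,x_l\rangle h_j$ into $h_l$, so the term equals the smaller second moment. With $2n+1$
columns left this gives the factor $(2n+1)(k+2n)$.\<close>

theorem second_moment_gram_haf:
  assumes A: "finite A"
  shows "finite V \<Longrightarrow> card V = 2 * n \<Longrightarrow>
    (\<integral>\<omega>. (gram_haf A V \<omega>)\<^sup>2 \<partial>gauss) = (\<Prod>q<n. (2 * real q + 1) * (real (card A) + 2 * real q))"
proof (induction n arbitrary: V)
  case 0
  then show ?case by (simp add: gauss.prob_space[simplified])
next
  case (Suc n)
  define c where "c = (\<Prod>q<n. (2 * real q + 1) * (real (card A) + 2 * real q))"
  obtain i U where V: "V = insert i U" "i \<notin> U" "card U = 2 * n + 1" "finite U"
    using Suc.prems by (metis Suc_eq_plus1 add_2_eq_Suc' card_Suc_eq finite_insert mult_Suc_right add.commute)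
  let ?h = "\<lambda>j. gram_haf A (U - {j})"
  have IH: "(\<integral>\<omega>. ?h j \<omega> * ?h j \<omega> \<partial>gauss) = c" if "j \<in> U" for j
    using Suc.IH[of "U - {j}"] V that by (simp add: c_def power2_eq_square)
  have mom: "all_moments (\<lambda>\<omega>. gram_on A \<omega> j l * (?h j \<omega> * ?h l \<omega>))" for j l
    unfolding gram_on_def by (intro all_moments_mult all_moments_sum all_moments_coordinate all_moments_gram_haf)
  have pair: "(\<integral>\<omega>. gram_on A \<omega> j l * (?h j \<omega> * ?h l \<omega>) \<partial>gauss) = (if j = l then real (card A) * c else c)"
    if jl: "j \<in> U" "l \<in> U" for j l
  proof (cases "j = l")
    case True
    have "(\<integral>\<omega>. gram_on A \<omega> j j * (?h j \<omega> * ?h j \<omega>) \<partial>gauss)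
        = (\<Sum>a\<in>A. \<integral>\<omega>. (\<omega> (a, j) * \<omega> (a, j)) * (?h j \<omega> * ?h j \<omega>) \<partial>gauss)"
      unfolding gram_on_def sum_distrib_right
      by (intro Bochner_Integration.integral_sum all_moments_integrable all_moments_mult
          all_moments_coordinate all_moments_gram_haf)
    also have "\<dots> = (\<Sum>a\<in>A. (\<integral>\<omega>. \<omega> (a, j) * \<omega> (a, j) \<partial>gauss) * (\<integral>\<omega>. ?h j \<omega> * ?h j \<omega> \<partial>gauss))"
    proof (intro sum.cong refl integral_mult_resample[where J = "A \<times> {j}"]
        all_moments_integrable all_moments_mult all_moments_coordinate all_moments_gram_haf)
      fix a \<omega>' \<omega> assume "a \<in> A"
      then show "resample (A \<times> {j}) \<omega>' \<omega> (a, j) * resample (A \<times> {j}) \<omega>' \<omega> (a, j) = \<omega>' (a, j) * \<omega>' (a, j)"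
        by (simp add: resample_def)
      have "?h j (resample (A \<times> {j}) \<omega>' \<omega>) = ?h j \<omega>"
        by (intro gram_haf_cong) (auto simp: resample_def)
      then show "?h j (resample (A \<times> {j}) \<omega>' \<omega>) * ?h j (resample (A \<times> {j}) \<omega>' \<omega>) = ?h j \<omega> * ?h j \<omega>"
        by simp
    qed
    finally show ?thesis
      using True jl by (simp add: expectation_two_coordinates IH)
  next
    case False
    let ?W = "U - {j} - {l}"
    have ins: "U - {j} = insert l ?W" "U - {l} = insert j ?W" using jl False by auto
    have hj: "?h j \<omega> = (\<Sum>b\<in>A. \<omega> (b, l) * column_coeff A ?W \<omega> b)" for \<omega>
      using gram_haf_linear[of ?W l A \<omega>] V unfolding ins(1)[symmetric] by simp
    have hl: "?h l \<omega> = (\<Sum>b\<in>A. \<omega> (b, j) * column_coeff A ?W \<omega> b)" for \<omega>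
      using gram_haf_linear[of ?W j A \<omega>] V unfolding ins(2)[symmetric] by simp
    have "(\<integral>\<omega>. gram_on A \<omega> j l * (?h j \<omega> * ?h l \<omega>) \<partial>gauss)
        = (\<integral>\<omega>. (\<Sum>a\<in>A. \<omega> (a, l) * \<omega> (a, j)) * (\<Sum>a\<in>A. \<omega> (a, l) * (column_coeff A ?W \<omega> a * ?h l \<omega>)) \<partial>gauss)"
    proof (intro Bochner_Integration.integral_cong refl)
      fix \<omega> :: "'a \<times> nat \<Rightarrow> real"
      have "(\<Sum>a\<in>A. \<omega> (a, l) * (column_coeff A ?W \<omega> a * ?h l \<omega>)) = ?h j \<omega> * ?h l \<omega>"
        unfolding hj by (simp add: sum_distrib_right mult.assoc)
      then show "gram_on A \<omega> j l * (?h j \<omega> * ?h l \<omega>)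
          = (\<Sum>a\<in>A. \<omega> (a, l) * \<omega> (a, j)) * (\<Sum>a\<in>A. \<omega> (a, l) * (column_coeff A ?W \<omega> a * ?h l \<omega>))"
        by (simp add: gram_on_def mult.commute)
    qed
    also have "\<dots> = (\<integral>\<omega>. (\<Sum>a\<in>A. \<omega> (a, j) * (column_coeff A ?W \<omega> a * ?h l \<omega>)) \<partial>gauss)"
    proof (rule expectation_linear_forms[OF A])
      fix a \<omega>' \<omega> assume a: "a \<in> A"
      show "resample (A \<times> {l}) \<omega>' \<omega> (a, j) = \<omega> (a, j)" using False by (simp add: resample_def)
      have "?h l (resample (A \<times> {l}) \<omega>' \<omega>) = ?h l \<omega>" by (intro gram_haf_cong) (auto simp: resample_def)
      moreover have "column_coeff A ?W (resample (A \<times> {l}) \<omega>' \<omega>) a = column_coeff A ?W \<omega> a"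
        by (intro column_coeff_cong) (auto simp: resample_def)
      ultimately show "column_coeff A ?W (resample (A \<times> {l}) \<omega>' \<omega>) a * ?h l (resample (A \<times> {l}) \<omega>' \<omega>) = column_coeff A ?W \<omega> a * ?h l \<omega>"
        by simp
    qed (intro all_moments_coordinate all_moments_mult all_moments_column_coeff all_moments_gram_haf)+
    also have "\<dots> = (\<integral>\<omega>. ?h l \<omega> * ?h l \<omega> \<partial>gauss)"
      unfolding hl by (simp add: sum_distrib_right mult_ac)
    finally show ?thesis using False IH[OF jl(2)] by simp
  qed
  have "(\<integral>\<omega>. (gram_haf A V \<omega>)\<^sup>2 \<partial>gauss)
      = (\<integral>\<omega>. (\<Sum>a\<in>A. \<omega> (a, i) * column_coeff A U \<omega> a) * (\<Sum>a\<in>A. \<omega> (a, i) * column_coeff A U \<omega> a) \<partial>gauss)"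
    using V by (simp add: gram_haf_linear power2_eq_square)
  also have "\<dots> = (\<integral>\<omega>. (\<Sum>a\<in>A. column_coeff A U \<omega> a * column_coeff A U \<omega> a) \<partial>gauss)"
    using V by (intro expectation_linear_forms A all_moments_column_coeff column_coeff_cong) (auto simp: resample_def)
  also have "\<dots> = (\<integral>\<omega>. (\<Sum>j\<in>U. \<Sum>l\<in>U. gram_on A \<omega> j l * (?h j \<omega> * ?h l \<omega>)) \<partial>gauss)"
  proof (intro Bochner_Integration.integral_cong refl)
    fix \<omega> :: "'a \<times> nat \<Rightarrow> real"
    have "(\<Sum>a\<in>A. column_coeff A U \<omega> a * column_coeff A U \<omega> a)
        = (\<Sum>a\<in>A. \<Sum>j\<in>U. \<Sum>l\<in>U. \<omega> (a, j) * \<omega> (a, l) * (?h j \<omega> * ?h l \<omega>))"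
      by (simp add: column_coeff_def sum_product mult_ac)
    also have "\<dots> = (\<Sum>j\<in>U. \<Sum>l\<in>U. \<Sum>a\<in>A. \<omega> (a, j) * \<omega> (a, l) * (?h j \<omega> * ?h l \<omega>))"
      by (subst sum.swap, intro sum.cong refl, subst sum.swap, rule refl)
    finally show "(\<Sum>a\<in>A. column_coeff A U \<omega> a * column_coeff A U \<omega> a) = (\<Sum>j\<in>U. \<Sum>l\<in>U. gram_on A \<omega> j l * (?h j \<omega> * ?h l \<omega>))"
      by (simp add: gram_on_def sum_distrib_right)
  qed
  also have "\<dots> = (\<Sum>j\<in>U. \<Sum>l\<in>U. \<integral>\<omega>. gram_on A \<omega> j l * (?h j \<omega> * ?h l \<omega>) \<partial>gauss)"
    using all_moments_integrable[OF mom] by (simp add: Bochner_Integration.integral_sum)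
  also have "\<dots> = (\<Sum>j\<in>U. \<Sum>l\<in>U. c + (if j = l then real (card A) * c - c else 0))"
    by (intro sum.cong refl) (simp add: pair)
  also have "\<dots> = real (card U) * (real (card U) * c + (real (card A) * c - c))"
    using V by (simp add: sum.distrib)
  also have "\<dots> = c * ((2 * real n + 1) * (real (card A) + 2 * real n))"
    using V by (simp add: algebra_simps)
  finally show ?case by (simp add: c_def)
qed

section \<open>Domination of characteristic functions\<close>

lemma measurable_cis [measurable]: "cis \<in> borel_measurable borel"
  by (rule borel_measurable_continuous_onI) (intro continuous_intros)

lemma measurable_cnj [measurable]: "cnj \<in> borel_measurable borel"
  by (rule borel_measurable_continuous_onI) (intro continuous_intros)

lemma integrable_cis:
  assumes [measurable]: "f \<in> borel_measurable gauss"
  shows "integrable gauss (\<lambda>\<omega>. cis (f \<omega>))"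
  by (rule gauss.integrable_const_bound[where B = 1]) auto

definition bilinear :: "'r set \<Rightarrow> ('r \<Rightarrow> 'r \<Rightarrow> real) \<Rightarrow> ('r \<Rightarrow> real) \<Rightarrow> ('r \<Rightarrow> real) \<Rightarrow> real" where
  "bilinear A S x y = (\<Sum>b\<in>A. \<Sum>c\<in>A. x b * y c * S b c)"

lemma bilinear_cong:
  "(\<And>b. b \<in> A \<Longrightarrow> x b = x' b) \<Longrightarrow> (\<And>b. b \<in> A \<Longrightarrow> y b = y' b) \<Longrightarrow> bilinear A S x y = bilinear A S x' y'"
  unfolding bilinear_def by (intro sum.cong) auto

lemma bilinear_commute:
  assumes "\<And>b c. S b c = S c b"
  shows "bilinear A S x y = bilinear A S y x"
  unfolding bilinear_def by (subst sum.swap) (simp add: assms mult_ac)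

lemma bilinear_combination:
  "bilinear A S (\<lambda>b. p * x b + q * y b) (\<lambda>b. r * x b + u * y b)
    = p * r * bilinear A S x x + p * u * bilinear A S x y + q * r * bilinear A S y x + q * u * bilinear A S y y"
  unfolding bilinear_def sum_distrib_left sum.distrib[symmetric]
  by (intro sum.cong refl) (simp add: algebra_simps)

definition pinned_column :: "'r \<Rightarrow> real \<Rightarrow> nat \<Rightarrow> ('r \<times> nat \<Rightarrow> real) \<Rightarrow> 'r \<Rightarrow> real" where
  "pinned_column a t j \<omega> b = (if b = a then t else \<omega> (b, j))"

lemma measurable_bilinear_pinned_column [measurable]:
  "(\<lambda>\<omega>. bilinear A S (pinned_column a t j \<omega>) (pinned_column a u l \<omega>)) \<in> borel_measurable gauss"
proof -
  have [measurable]: "(\<lambda>\<omega>. pinned_column a t j \<omega> b) \<in> borel_measurable gauss" for t j and b :: 'a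
    unfolding pinned_column_def by measurable
  show ?thesis unfolding bilinear_def by measurable
qed

definition rotate_columns :: "'r set \<Rightarrow> nat \<Rightarrow> nat \<Rightarrow> real \<Rightarrow> real \<Rightarrow> ('r \<times> nat \<Rightarrow> real) \<Rightarrow> 'r \<times> nat \<Rightarrow> real" where
  "rotate_columns A j l = rotate_pairs (\<lambda>(b, i). (b, Transposition.transpose j l i)) (A \<times> {j})"

lemma integral_rotate_columns:
  fixes f :: "_ \<Rightarrow> 'b::{banach, second_countable_topology}"
  assumes "finite A" "j \<noteq> l" "c\<^sup>2 + s\<^sup>2 = 1" "f \<in> borel_measurable gauss"
  shows "(\<integral>\<omega>. f (rotate_columns A j l c s \<omega>) \<partial>gauss) = (\<integral>\<omega>. f \<omega> \<partial>gauss)"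
  unfolding rotate_columns_def by (rule integral_rotate_pairs) (use assms in auto)

text \<open>Rotating the free entries of two columns and, separately, the pinned
values by the same angle rotates the two pinned columns.\<close>

lemma pinned_column_rotate_columns:
  assumes "j \<noteq> l" "b \<in> A"
  shows "pinned_column a (c * t + s * u) j (rotate_columns (A - {a}) j l c s \<omega>) b
          = c * pinned_column a t j \<omega> b + s * pinned_column a u l \<omega> b"
    and "pinned_column a (- s * t + c * u) l (rotate_columns (A - {a}) j l c s \<omega>) b
          = - s * pinned_column a t j \<omega> b + c * pinned_column a u l \<omega> b"
  using assms by (auto simp: pinned_column_def rotate_columns_def rotate_pairs_def)

text \<open>The function $F(t)$ of the introduction.\<close>

definition char_quadratic :: "'r set \<Rightarrow> ('r \<Rightarrow> 'r \<Rightarrow> real) \<Rightarrow> 'r \<Rightarrow> nat \<Rightarrow> real \<Rightarrow> complex" where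
  "char_quadratic A S a j t = (\<integral>\<omega>. cis (bilinear A S (pinned_column a t j \<omega>) (pinned_column a t j \<omega>) / 2) \<partial>gauss)"

definition char_bilinear :: "'r set \<Rightarrow> ('r \<Rightarrow> 'r \<Rightarrow> real) \<Rightarrow> 'r \<Rightarrow> nat \<Rightarrow> nat \<Rightarrow> real \<Rightarrow> real \<Rightarrow> complex" where
  "char_bilinear A S a j l t u = (\<integral>\<omega>. cis (bilinear A S (pinned_column a t j \<omega>) (pinned_column a u l \<omega>)) \<partial>gauss)"

context
  fixes A :: "'r set" and S :: "'r \<Rightarrow> 'r \<Rightarrow> real" and a :: 'r and j l :: nat
  assumes A: "finite A" and S: "\<And>b c. S b c = S c b" and jl: "j \<noteq> l"
begin

lemma char_quadratic_column: "char_quadratic A S a j t = char_quadratic A S a l t"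
proof -
  have "char_quadratic A S a j t
      = (\<integral>\<omega>. cis (bilinear A S (pinned_column a t j (rotate_columns (A - {a}) j l 0 1 \<omega>))
                            (pinned_column a t j (rotate_columns (A - {a}) j l 0 1 \<omega>)) / 2) \<partial>gauss)"
    unfolding char_quadratic_def by (rule integral_rotate_columns[symmetric]) (use A jl in auto)
  also have "\<dots> = char_quadratic A S a l t"
    unfolding char_quadratic_def
  proof (intro Bochner_Integration.integral_cong refl arg_cong[where f = "\<lambda>x. cis (x / 2)"] bilinear_cong)
    fix \<omega> b assume "b \<in> A"
    then show "pinned_column a t j (rotate_columns (A - {a}) j l 0 1 \<omega>) b = pinned_column a t l \<omega> b"
      using pinned_column_rotate_columns(1)[OF jl, of b A a 0 t 1 t \<omega>] by simp
    then show "pinned_column a t j (rotate_columns (A - {a}) j l 0 1 \<omega>) b = pinned_column a t l \<omega> b" .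
  qed
  finally show ?thesis .
qed

text \<open>Two different columns are independent. The functions \<open>\<alpha>\<close> and \<open>\<beta>\<close> allow a complex conjugate on
either factor.\<close>

lemma char_quadratic_mult_resample:
  fixes \<alpha> \<beta> :: "complex \<Rightarrow> complex"
  assumes [measurable]: "\<alpha> \<in> borel_measurable borel" "\<beta> \<in> borel_measurable borel"
    and "\<And>z. norm z = 1 \<Longrightarrow> norm (\<alpha> z) = 1" "\<And>z. norm z = 1 \<Longrightarrow> norm (\<beta> z) = 1"
  shows "(\<integral>\<omega>. \<alpha> (cis (bilinear A S (pinned_column a t j \<omega>) (pinned_column a t j \<omega>) / 2))
             * \<beta> (cis (bilinear A S (pinned_column a u l \<omega>) (pinned_column a u l \<omega>) / 2)) \<partial>gauss)
    = (\<integral>\<omega>. \<alpha> (cis (bilinear A S (pinned_column a t j \<omega>) (pinned_column a t j \<omega>) / 2)) \<partial>gauss)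
      * (\<integral>\<omega>. \<beta> (cis (bilinear A S (pinned_column a u l \<omega>) (pinned_column a u l \<omega>) / 2)) \<partial>gauss)"
proof (rule integral_mult_resample[where J = "UNIV \<times> {j}"])
  show "integrable gauss (\<lambda>\<omega>. \<alpha> (cis (bilinear A S (pinned_column a t j \<omega>) (pinned_column a t j \<omega>) / 2))
             * \<beta> (cis (bilinear A S (pinned_column a u l \<omega>) (pinned_column a u l \<omega>) / 2)))"
    by (rule gauss.integrable_const_bound[where B = 1]) (auto simp: norm_mult assms)
  fix \<omega>' \<omega>
  have "pinned_column a t j (resample (UNIV \<times> {j}) \<omega>' \<omega>) = pinned_column a t j \<omega>'"
    and "pinned_column a u l (resample (UNIV \<times> {j}) \<omega>' \<omega>) = pinned_column a u l \<omega>"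
    using jl by (auto simp: pinned_column_def resample_def)
  then show "\<alpha> (cis (bilinear A S (pinned_column a t j (resample (UNIV \<times> {j}) \<omega>' \<omega>)) (pinned_column a t j (resample (UNIV \<times> {j}) \<omega>' \<omega>)) / 2))
      = \<alpha> (cis (bilinear A S (pinned_column a t j \<omega>') (pinned_column a t j \<omega>') / 2))"
    and "\<beta> (cis (bilinear A S (pinned_column a u l (resample (UNIV \<times> {j}) \<omega>' \<omega>)) (pinned_column a u l (resample (UNIV \<times> {j}) \<omega>' \<omega>)) / 2))
      = \<beta> (cis (bilinear A S (pinned_column a u l \<omega>) (pinned_column a u l \<omega>) / 2))"
    by simp_all
qed

lemma char_quadratic_mult:
  "char_quadratic A S a j t * char_quadratic A S a l u
    = (\<integral>\<omega>. cis ((bilinear A S (pinned_column a t j \<omega>) (pinned_column a t j \<omega>) + bilinear A S (pinned_column a u l \<omega>) (pinned_column a u l \<omega>)) / 2) \<partial>gauss)"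
  unfolding char_quadratic_def add_divide_distrib cis_mult[symmetric]
  by (rule char_quadratic_mult_resample[of "\<lambda>z. z" "\<lambda>z. z", symmetric]) auto

text \<open>The sum of the quadratic form at the two columns is unchanged when the columns are
rotated, and some rotation takes the pinned values $(\nu,\nu)$ to $(t,u)$.\<close>

lemma char_quadratic_parallelogram:
  assumes \<nu>: "2 * \<nu>\<^sup>2 = t\<^sup>2 + u\<^sup>2"
  shows "char_quadratic A S a j t * char_quadratic A S a l u = char_quadratic A S a j \<nu> * char_quadratic A S a l \<nu>"
proof -
  obtain c s where cs: "c\<^sup>2 + s\<^sup>2 = 1" "t = c * \<nu> + s * \<nu>" "u = - s * \<nu> + c * \<nu>"
  proof (cases "\<nu> = 0")
    case True
    then have "t\<^sup>2 + u\<^sup>2 = 0" using \<nu> by simp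
    then have "t = 0" "u = 0" by (simp_all add: sum_power2_eq_zero_iff)
    then show ?thesis using that[of 1 0] True by simp
  next
    case False
    have "((t + u) / (2 * \<nu>))\<^sup>2 + ((t - u) / (2 * \<nu>))\<^sup>2 = 1"
      using False \<nu> by (simp add: power_divide power_mult_distrib add_divide_distrib[symmetric] power2_sum power2_diff)
    then show ?thesis
      by (rule that) (use False in \<open>simp_all add: field_simps\<close>)
  qed
  let ?R = "rotate_columns (A - {a}) j l c s"
  let ?q = "\<lambda>t j \<omega>. bilinear A S (pinned_column a t j \<omega>) (pinned_column a t j \<omega>)"
  have "char_quadratic A S a j t * char_quadratic A S a l u = (\<integral>\<omega>. cis ((?q t j \<omega> + ?q u l \<omega>) / 2) \<partial>gauss)"
    by (rule char_quadratic_mult)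
  also have "\<dots> = (\<integral>\<omega>. cis ((?q t j (?R \<omega>) + ?q u l (?R \<omega>)) / 2) \<partial>gauss)"
    by (rule integral_rotate_columns[symmetric]) (use A jl cs in auto)
  also have "\<dots> = (\<integral>\<omega>. cis ((?q \<nu> j \<omega> + ?q \<nu> l \<omega>) / 2) \<partial>gauss)"
  proof (intro Bochner_Integration.integral_cong refl arg_cong[where f = "\<lambda>x. cis (x / 2)"])
    fix \<omega> :: "'r \<times> nat \<Rightarrow> real"
    let ?x = "pinned_column a \<nu> j \<omega>" and ?y = "pinned_column a \<nu> l \<omega>"
    have "?q t j (?R \<omega>) = bilinear A S (\<lambda>b. c * ?x b + s * ?y b) (\<lambda>b. c * ?x b + s * ?y b)"
      unfolding cs(2) by (intro bilinear_cong pinned_column_rotate_columns jl)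
    moreover have "?q u l (?R \<omega>) = bilinear A S (\<lambda>b. - s * ?x b + c * ?y b) (\<lambda>b. - s * ?x b + c * ?y b)"
      unfolding cs(3) by (intro bilinear_cong pinned_column_rotate_columns jl)
    ultimately have "?q t j (?R \<omega>) + ?q u l (?R \<omega>) = (c\<^sup>2 + s\<^sup>2) * (?q \<nu> j \<omega> + ?q \<nu> l \<omega>)"
      unfolding bilinear_combination by (simp add: algebra_simps power2_eq_square)
    then show "?q t j (?R \<omega>) + ?q u l (?R \<omega>) = ?q \<nu> j \<omega> + ?q \<nu> l \<omega>"
      using cs(1) by simp
  qed
  also have "\<dots> = char_quadratic A S a j \<nu> * char_quadratic A S a l \<nu>"
    by (rule char_quadratic_mult[symmetric])
  finally show ?thesis .
qed

text \<open>Polarization: after a rotation by 45 degrees the bilinear form is half the difference of its quadratic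
form at two independent columns.\<close>

lemma char_bilinear_factor:
  "char_bilinear A S a j l t u
    = cnj (char_quadratic A S a j ((t - u) / sqrt 2)) * char_quadratic A S a l ((t + u) / sqrt 2)"
proof -
  let ?r = "1 / sqrt 2"
  let ?R = "rotate_columns (A - {a}) j l ?r ?r"
  let ?x = "\<lambda>\<omega>. pinned_column a ((t - u) / sqrt 2) j \<omega>" and ?y = "\<lambda>\<omega>. pinned_column a ((t + u) / sqrt 2) l \<omega>"
  have tu: "t = ?r * ((t - u) / sqrt 2) + ?r * ((t + u) / sqrt 2)"
    "u = - ?r * ((t - u) / sqrt 2) + ?r * ((t + u) / sqrt 2)"
    by (simp_all add: field_simps)
  have "char_bilinear A S a j l t u = (\<integral>\<omega>. cis (bilinear A S (pinned_column a t j (?R \<omega>)) (pinned_column a u l (?R \<omega>))) \<partial>gauss)"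
    unfolding char_bilinear_def
    by (rule integral_rotate_columns[symmetric]) (use A jl in \<open>auto simp: power_divide\<close>)
  also have "\<dots> = (\<integral>\<omega>. cnj (cis (bilinear A S (?x \<omega>) (?x \<omega>) / 2)) * cis (bilinear A S (?y \<omega>) (?y \<omega>) / 2) \<partial>gauss)"
  proof (intro Bochner_Integration.integral_cong refl)
    fix \<omega> :: "'r \<times> nat \<Rightarrow> real"
    have "bilinear A S (pinned_column a t j (?R \<omega>)) (pinned_column a u l (?R \<omega>))
        = bilinear A S (\<lambda>b. ?r * ?x \<omega> b + ?r * ?y \<omega> b) (\<lambda>b. - ?r * ?x \<omega> b + ?r * ?y \<omega> b)"
      by (subst (1) tu(1), subst (2) tu(2)) (intro bilinear_cong pinned_column_rotate_columns jl)
    also have "\<dots> = - (bilinear A S (?x \<omega>) (?x \<omega>) / 2) + bilinear A S (?y \<omega>) (?y \<omega>) / 2"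
      unfolding bilinear_combination bilinear_commute[of S A "?y \<omega>" "?x \<omega>", OF S] by simp
    finally show "cis (bilinear A S (pinned_column a t j (?R \<omega>)) (pinned_column a u l (?R \<omega>)))
        = cnj (cis (bilinear A S (?x \<omega>) (?x \<omega>) / 2)) * cis (bilinear A S (?y \<omega>) (?y \<omega>) / 2)"
      by (simp add: cis_cnj cis_mult)
  qed
  also have "\<dots> = (\<integral>\<omega>. cnj (cis (bilinear A S (?x \<omega>) (?x \<omega>) / 2)) \<partial>gauss)
      * char_quadratic A S a l ((t + u) / sqrt 2)"
    unfolding char_quadratic_def by (rule char_quadratic_mult_resample[of cnj "\<lambda>z. z"]) auto
  finally show ?thesis by (simp add: char_quadratic_def)
qed

text \<open>The modulus depends on $t^2+u^2$ only; when the second pinned value is $0$ both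
factors are evaluated at the same point and the product is nonnegative.\<close>

lemma char_bilinear_collapse:
  "char_bilinear A S a j l (sqrt (t\<^sup>2 + u\<^sup>2)) 0 = complex_of_real (norm (char_bilinear A S a j l t u))"
proof -
  \<comment> \<open>The common value of both pinned entries when \<open>(t, u)\<close> is replaced by $(\sqrt{t^2+u^2}, 0)$.\<close>
  define \<nu> where "\<nu> = sqrt (t\<^sup>2 + u\<^sup>2) / sqrt 2"
  have \<nu>2: "2 * \<nu>\<^sup>2 = ((t - u) / sqrt 2)\<^sup>2 + ((t + u) / sqrt 2)\<^sup>2"
    by (simp add: \<nu>_def power_divide power2_sum power2_diff field_simps)
  have "norm (char_bilinear A S a j l t u)
      = norm (char_quadratic A S a j ((t - u) / sqrt 2) * char_quadratic A S a l ((t + u) / sqrt 2))"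
    by (simp add: char_bilinear_factor norm_mult)
  also have "\<dots> = (norm (char_quadratic A S a l \<nu>))\<^sup>2"
    unfolding char_quadratic_parallelogram[OF \<nu>2]
    by (simp add: norm_mult power2_eq_square char_quadratic_column)
  finally have "complex_of_real (norm (char_bilinear A S a j l t u)) = cnj (char_quadratic A S a l \<nu>) * char_quadratic A S a l \<nu>"
    by (simp only: complex_norm_square mult.commute)
  then show ?thesis by (simp add: char_bilinear_factor \<nu>_def char_quadratic_column)
qed

end

text \<open>A quantity that does not decrease when two entries of a vector are merged into one, in the Euclidean sense,
is at most its value at a multiple of a basis vector. At least two entries are
needed: with a single one the sign could not be removed.\<close>

lemma collapse_to_axis:
  fixes g :: "('i \<Rightarrow> real) \<Rightarrow> real"
  assumes A: "finite A" "a \<in> A" "card A \<ge> 2"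
    and cong: "\<And>u u'. (\<And>x. x \<in> A \<Longrightarrow> u x = u' x) \<Longrightarrow> g u = g u'"
    and step: "\<And>u b. b \<in> A \<Longrightarrow> b \<noteq> a \<Longrightarrow> g u \<le> g (u(a := sqrt ((u a)\<^sup>2 + (u b)\<^sup>2), b := 0))"
  shows "g u \<le> g (\<lambda>x. if x = a then sqrt (\<Sum>x\<in>A. (u x)\<^sup>2) else 0)"
proof -
  have main: "g u \<le> g (\<lambda>x. if x = a then sqrt ((u a)\<^sup>2 + (\<Sum>x\<in>B. (u x)\<^sup>2)) else if x \<in> B then 0 else u x)"
    if "finite B" "B \<noteq> {}" "B \<subseteq> A - {a}" for B
    using that
  proof (induction B rule: finite_ne_induct)
    case (singleton b)
    have "u(a := sqrt ((u a)\<^sup>2 + (u b)\<^sup>2), b := 0)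
        = (\<lambda>x. if x = a then sqrt ((u a)\<^sup>2 + (\<Sum>x\<in>{b}. (u x)\<^sup>2)) else if x \<in> {b} then 0 else u x)"
      using singleton by auto
    then show ?case using step[of b u] singleton by simp
  next
    case (insert b B)
    let ?v = "\<lambda>x. if x = a then sqrt ((u a)\<^sup>2 + (\<Sum>x\<in>B. (u x)\<^sup>2)) else if x \<in> B then 0 else u x"
    have "g u \<le> g ?v" using insert by blast
    also have "\<dots> \<le> g (?v(a := sqrt ((?v a)\<^sup>2 + (?v b)\<^sup>2), b := 0))"
      using insert by (intro step) auto
    also have "?v(a := sqrt ((?v a)\<^sup>2 + (?v b)\<^sup>2), b := 0)
        = (\<lambda>x. if x = a then sqrt ((u a)\<^sup>2 + (\<Sum>x\<in>insert b B. (u x)\<^sup>2)) else if x \<in> insert b B then 0 else u x)"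
      using insert by (auto simp: fun_eq_iff sum_nonneg algebra_simps)
    finally show ?case .
  qed
  have "A - {a} \<noteq> {}"
  proof
    assume "A - {a} = {}"
    then have "A = {a}" using A by blast
    then show False using A(3) by simp
  qed
  then have "g u \<le> g (\<lambda>x. if x = a then sqrt ((u a)\<^sup>2 + (\<Sum>x\<in>A - {a}. (u x)\<^sup>2)) else if x \<in> A - {a} then 0 else u x)"
    using A by (intro main) auto
  also have "\<dots> = g (\<lambda>x. if x = a then sqrt (\<Sum>x\<in>A. (u x)\<^sup>2) else 0)"
    using A by (intro cong) (auto simp: sum.remove)
  finally show ?thesis .
qed


text \<open>A rotation of two rows preserves all inner products of columns, so it acts on
$\langle u, W\rangle$ as the inverse rotation of \<open>u\<close>.\<close>

lemma gram_haf_row_rotation: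
  assumes A: "finite A" "a \<in> A" "b \<in> A" "a \<noteq> b" and U: "finite U" and cs: "c\<^sup>2 + s\<^sup>2 = 1"
    and c: "c * u a - s * u b = v a" "s * u a + c * u b = v b"
    and uv: "\<And>x. x \<in> A - {a, b} \<Longrightarrow> u x = v x"
  shows "(\<Sum>x\<in>A. u x * column_coeff A U (rotate_pairs (\<lambda>(r, j). (Transposition.transpose a b r, j)) ({a} \<times> U) c s \<omega>) x)
    = (\<Sum>x\<in>A. v x * column_coeff A U \<omega> x)"
proof -
  let ?R = "rotate_pairs (\<lambda>(r, j). (Transposition.transpose a b r, j)) ({a} \<times> U) c s \<omega>"
  have Ra: "?R (a, j) = c * \<omega> (a, j) + s * \<omega> (b, j)"
    and Rb: "?R (b, j) = - s * \<omega> (a, j) + c * \<omega> (b, j)"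
    and Rx: "\<And>x. x \<in> A - {a, b} \<Longrightarrow> ?R (x, j) = \<omega> (x, j)" if "j \<in> U" for j
    using that A by (auto simp: rotate_pairs_def Transposition.transpose_def)
  have split: "(\<Sum>x\<in>A. f x) = f a + f b + (\<Sum>x\<in>A - {a, b}. f x)" for f :: "'a \<Rightarrow> real"
  proof -
    have "A = insert a (insert b (A - {a, b}))" using A by auto
    then have "sum f A = sum f (insert a (insert b (A - {a, b})))" by simp
    then show ?thesis using A by simp
  qed
  have gram_on: "gram_on A ?R i j = gram_on A \<omega> i j" if "i \<in> U" "j \<in> U" for i j
  proof -
    have "?R (a, i) * ?R (a, j) + ?R (b, i) * ?R (b, j)
        = (c\<^sup>2 + s\<^sup>2) * (\<omega> (a, i) * \<omega> (a, j) + \<omega> (b, i) * \<omega> (b, j))"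
      unfolding Ra[OF that(1)] Ra[OF that(2)] Rb[OF that(1)] Rb[OF that(2)]
      by (simp add: algebra_simps power2_eq_square)
    then show ?thesis using cs Rx that by (simp add: gram_on_def split)
  qed
  have gram_haf: "gram_haf A (U - {j}) ?R = gram_haf A (U - {j}) \<omega>" for j
    by (rule gram_haf_cong_gram_on) (auto intro: gram_on)
  have "(\<Sum>x\<in>A. u x * column_coeff A U ?R x) = (\<Sum>j\<in>U. (\<Sum>x\<in>A. u x * ?R (x, j)) * gram_haf A (U - {j}) \<omega>)"
    unfolding column_coeff_def gram_haf sum_distrib_left sum_distrib_right by (subst sum.swap) (simp add: mult_ac)
  also have "\<dots> = (\<Sum>j\<in>U. (\<Sum>x\<in>A. v x * \<omega> (x, j)) * gram_haf A (U - {j}) \<omega>)"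
  proof (rule sum.cong[OF refl])
    fix j assume j: "j \<in> U"
    have "u a * ?R (a, j) + u b * ?R (b, j)
        = (c * u a - s * u b) * \<omega> (a, j) + (s * u a + c * u b) * \<omega> (b, j)"
      unfolding Ra[OF j] Rb[OF j] by (simp add: algebra_simps)
    then have "(\<Sum>x\<in>A. u x * ?R (x, j)) = (\<Sum>x\<in>A. v x * \<omega> (x, j))"
      using Rx[OF j] uv by (simp add: split c)
    then show "(\<Sum>x\<in>A. u x * ?R (x, j)) * gram_haf A (U - {j}) \<omega>
        = (\<Sum>x\<in>A. v x * \<omega> (x, j)) * gram_haf A (U - {j}) \<omega>" by simp
  qed
  also have "\<dots> = (\<Sum>x\<in>A. v x * column_coeff A U \<omega> x)"
    unfolding column_coeff_def sum_distrib_left sum_distrib_right by (subst sum.swap) (simp add: mult_ac)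
  finally show ?thesis .
qed

text \<open>The characteristic function of the hafnian given that the column adjoined to \<open>U\<close> equals \<open>u\<close>.\<close>

definition char_given_column :: "'r set \<Rightarrow> nat set \<Rightarrow> real \<Rightarrow> ('r \<Rightarrow> real) \<Rightarrow> complex" where
  "char_given_column A U s u = (\<integral>\<omega>. cis (s * (\<Sum>b\<in>A. u b * column_coeff A U \<omega> b)) \<partial>gauss)"

lemma char_given_column_collapse:
  assumes A: "finite A" "a \<in> A" "card A \<ge> 2" and U: "finite U"
  shows "norm (char_given_column A U s u)
    \<le> norm (char_given_column A U s (\<lambda>x. if x = a then sqrt (\<Sum>x\<in>A. (u x)\<^sup>2) else 0))"
proof (rule collapse_to_axis[OF A])
  show "norm (char_given_column A U s u) = norm (char_given_column A U s u')"
    if "\<And>x. x \<in> A \<Longrightarrow> u x = u' x" for u u'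
    using that by (simp add: char_given_column_def)
  fix u b assume b: "b \<in> A" "b \<noteq> a"
  define r where "r = sqrt ((u a)\<^sup>2 + (u b)\<^sup>2)"
  define v where "v = u(a := r, b := 0)"
  show "norm (char_given_column A U s u) \<le> norm (char_given_column A U s (u(a := sqrt ((u a)\<^sup>2 + (u b)\<^sup>2), b := 0)))"
  proof (cases "r = 0")
    case True
    then have "u a = 0" "u b = 0" by (simp_all add: r_def sum_power2_eq_zero_iff)
    then have "u(a := sqrt ((u a)\<^sup>2 + (u b)\<^sup>2), b := 0) = u" by (auto simp: fun_eq_iff)
    then show ?thesis by simp
  next
    case False
    have r2: "r * r = u a * u a + u b * u b" by (simp add: r_def power2_eq_square)
    \<comment> \<open>The sign of the sine is that of the inverse rotation, since rotating the matrix by \<open>R\<close> acts on \<open>u\<close> by $R^{-1}$.\<close>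
    let ?c = "u a / r" and ?s = "- u b / r"
    let ?R = "rotate_pairs (\<lambda>(r, j). (Transposition.transpose a b r, j)) ({a} \<times> U) ?c ?s"
    have cs: "?c\<^sup>2 + ?s\<^sup>2 = 1"
      using False by (simp add: power_divide power2_eq_square add_divide_distrib[symmetric] r2[symmetric])
    have "char_given_column A U s u = (\<integral>\<omega>. cis (s * (\<Sum>x\<in>A. u x * column_coeff A U (?R \<omega>) x)) \<partial>gauss)"
      unfolding char_given_column_def
      by (rule integral_rotate_pairs[OF _ _ _ cs, symmetric]) (use U b in \<open>auto simp: Transposition.transpose_def\<close>)
    also have "\<dots> = char_given_column A U s v"
      unfolding char_given_column_def
    proof (intro Bochner_Integration.integral_cong refl arg_cong[where f = "\<lambda>x. cis (s * x)"] gram_haf_row_rotation)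
      show "?c\<^sup>2 + ?s\<^sup>2 = 1" by (rule cs)
      show "?c * u a - ?s * u b = v a"
        using False r2 b by (simp add: v_def add_divide_distrib[symmetric] r2[symmetric])
      show "?s * u a + ?c * u b = v b" by (simp add: v_def)
    qed (use A b U in \<open>auto simp: v_def\<close>)
    finally show ?thesis by (simp add: v_def r_def)
  qed
qed

text \<open>The situation after the column \<open>i\<close> has been rotated to the axis \<open>a\<close> and normalized: the row \<open>a\<close> is then
separated from the other, still random entries.\<close>

definition pinned_matrix :: "'r \<Rightarrow> nat \<Rightarrow> (nat \<Rightarrow> real) \<Rightarrow> ('r \<times> nat \<Rightarrow> real) \<Rightarrow> 'r \<times> nat \<Rightarrow> real" where
  "pinned_matrix a i t \<omega> = (\<lambda>(b, j). if j = i then (if b = a then 1 else 0) else if b = a then t j else \<omega> (b, j))"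

lemma measurable_pinned_matrix [measurable]: "pinned_matrix a i t \<in> gauss \<rightarrow>\<^sub>M gauss"
proof (rule measurable_gaussI)
  fix p show "(\<lambda>\<omega>. pinned_matrix a i t \<omega> p) \<in> borel_measurable gauss"
    unfolding pinned_matrix_def by (cases p) simp
qed

lemma gram_haf_pinned_matrix:
  assumes A: "finite A" "a \<in> A" and U: "finite U" "i \<notin> U"
  shows "gram_haf A (insert i U) (pinned_matrix a i t \<omega>) = (\<Sum>j\<in>U. t j * gram_haf A (U - {j}) (pinned_matrix a i t \<omega>))"
proof -
  have "gram_haf A (insert i U) (pinned_matrix a i t \<omega>) = (\<Sum>b\<in>A. (if b = a then 1 else 0) * column_coeff A U (pinned_matrix a i t \<omega>) b)"
    using U by (simp add: gram_haf_linear pinned_matrix_def)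
  also have "\<dots> = column_coeff A U (pinned_matrix a i t \<omega>) a"
    using A by (simp add: if_distrib[of "\<lambda>x. x * _"] cong: if_cong)
  also have "\<dots> = (\<Sum>j\<in>U. t j * gram_haf A (U - {j}) (pinned_matrix a i t \<omega>))"
    using U unfolding column_coeff_def by (intro sum.cong) (auto simp: pinned_matrix_def)
  finally show ?thesis .
qed

definition char_given_row :: "'r set \<Rightarrow> nat set \<Rightarrow> 'r \<Rightarrow> nat \<Rightarrow> real \<Rightarrow> (nat \<Rightarrow> real) \<Rightarrow> complex" where
  "char_given_row A U a i s t = (\<integral>\<omega>. cis (s * gram_haf A (insert i U) (pinned_matrix a i t \<omega>)) \<partial>gauss)"

text \<open>Conditioning on all columns except \<open>j\<close> and \<open>l\<close> leaves a bilinear form in these two, whose entries in row \<open>a\<close>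
are pinned.\<close>

lemma char_given_row_pair:
  fixes A :: "'r set" and s :: real
  assumes A: "finite A" "a \<in> A" and W: "finite W" "j \<notin> W" "l \<notin> W" "j \<noteq> l" "i \<notin> insert j (insert l W)"
  defines "S \<equiv> \<lambda>t \<omega> b c. s * pair_form A (insert i W) (pinned_matrix a i t \<omega>) b c"
  shows "char_given_row A (insert j (insert l W)) a i s t
      = (\<integral>\<omega>. char_bilinear A (S t \<omega>) a j l (t j) (t l) \<partial>gauss)" (is ?eq)
    and "integrable gauss (\<lambda>\<omega>. char_bilinear A (S t \<omega>) a j l (t j) (t l))" (is ?int)
proof -
  let ?J = "- (UNIV \<times> {j, l})"
  let ?f = "\<lambda>\<omega>. cis (s * gram_haf A (insert i (insert j (insert l W))) (pinned_matrix a i t \<omega>))"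
  have int: "integrable gauss ?f"
    by (rule integrable_cis) measurable
  have eq: "(\<integral>\<omega>. ?f (resample ?J \<omega>' \<omega>) \<partial>gauss) = char_bilinear A (S t \<omega>') a j l (t j) (t l)" for \<omega>'
    unfolding char_bilinear_def
  proof (intro Bochner_Integration.integral_cong refl arg_cong[where f = cis])
    fix \<omega> :: "'r \<times> nat \<Rightarrow> real"
    let ?\<eta> = "pinned_matrix a i t (resample ?J \<omega>' \<omega>)"
    have ins: "insert i (insert j (insert l W)) = insert j (insert l (insert i W))" by auto
    have "gram_haf A (insert i (insert j (insert l W))) ?\<eta>
        = (\<Sum>b\<in>A. \<Sum>c\<in>A. ?\<eta> (b, j) * ?\<eta> (c, l) * pair_form A (insert i W) ?\<eta> b c)"
      unfolding ins by (rule gram_haf_bilinear) (use W A in auto)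
    also have "\<dots> = (\<Sum>b\<in>A. \<Sum>c\<in>A. pinned_column a (t j) j \<omega> b * pinned_column a (t l) l \<omega> c
        * pair_form A (insert i W) (pinned_matrix a i t \<omega>') b c)"
    proof (intro sum.cong refl arg_cong2[where f = "(*)"])
      show "?\<eta> (b, j) = pinned_column a (t j) j \<omega> b" "?\<eta> (b, l) = pinned_column a (t l) l \<omega> b" for b
        using W by (auto simp: pinned_matrix_def resample_def pinned_column_def)
      show "pair_form A (insert i W) ?\<eta> b c = pair_form A (insert i W) (pinned_matrix a i t \<omega>') b c" for b c
        by (rule pair_form_cong) (use W in \<open>auto simp: pinned_matrix_def resample_def\<close>)
    qed
    finally show "s * gram_haf A (insert i (insert j (insert l W))) ?\<eta>
        = bilinear A (S t \<omega>') (pinned_column a (t j) j \<omega>) (pinned_column a (t l) l \<omega>)"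
      by (simp add: bilinear_def S_def sum_distrib_left mult_ac)
  qed
  show ?eq unfolding char_given_row_def integral_resample[OF int, of ?J] eq ..
  show ?int using integrable_resample[OF int, of ?J] unfolding eq .
qed

text \<open>The coefficients of the bilinear form do not involve $t_j$ and $t_l$. For each choice of the other columns
the merged values give the modulus of the original conditional expectation, so averaging can only lose
on the left.\<close>

lemma char_given_row_collapse:
  assumes A: "finite A" "a \<in> A" and U: "finite U" "j \<in> U" "card U \<ge> 2" "i \<notin> U"
  shows "norm (char_given_row A U a i s t)
    \<le> norm (char_given_row A U a i s (\<lambda>x. if x = j then sqrt (\<Sum>x\<in>U. (t x)\<^sup>2) else 0))"
proof (rule collapse_to_axis[OF U(1-3)])
  show "norm (char_given_row A U a i s t) = norm (char_given_row A U a i s t')"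
    if "\<And>x. x \<in> U \<Longrightarrow> t x = t' x" for t t'
  proof -
    have "gram_haf A (insert i U) (pinned_matrix a i t \<omega>) = gram_haf A (insert i U) (pinned_matrix a i t' \<omega>)" for \<omega> :: "'a \<times> nat \<Rightarrow> real"
      by (rule gram_haf_cong) (use that in \<open>auto simp: pinned_matrix_def\<close>)
    then show ?thesis by (simp add: char_given_row_def)
  qed
  fix t l assume l: "l \<in> U" "l \<noteq> j"
  define W where "W = U - {j, l}"
  have UW: "U = insert j (insert l W)" and W: "finite W" "j \<notin> W" "l \<notin> W" "j \<noteq> l" "i \<notin> insert j (insert l W)"
    using U l by (auto simp: W_def)
  define t' where "t' = t(j := sqrt ((t j)\<^sup>2 + (t l)\<^sup>2), l := 0)"
  let ?S = "\<lambda>t \<omega> b c. s * pair_form A (insert i W) (pinned_matrix a i t \<omega>) b c"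
  have S: "?S t' \<omega> = ?S t \<omega>" for \<omega>
  proof (intro ext arg_cong[where f = "\<lambda>x. s * x"] pair_form_cong)
    fix b c d :: 'a and k assume "k \<in> insert i W"
    then have "k \<noteq> j" "k \<noteq> l" using W by auto
    then show "pinned_matrix a i t' \<omega> (d, k) = pinned_matrix a i t \<omega> (d, k)" by (simp add: pinned_matrix_def t'_def)
  qed
  have col: "char_bilinear A (?S t \<omega>) a j l (sqrt ((t j)\<^sup>2 + (t l)\<^sup>2)) 0
      = complex_of_real (norm (char_bilinear A (?S t \<omega>) a j l (t j) (t l)))" for \<omega>
    by (rule char_bilinear_collapse) (use A W in \<open>auto intro: pair_form_commute\<close>)
  have "norm (char_given_row A U a i s t) = norm (\<integral>\<omega>. char_bilinear A (?S t \<omega>) a j l (t j) (t l) \<partial>gauss)"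
    unfolding UW by (subst char_given_row_pair(1)[OF A W]) simp
  also have "\<dots> \<le> (\<integral>\<omega>. norm (char_bilinear A (?S t \<omega>) a j l (t j) (t l)) \<partial>gauss)"
    by (rule integral_norm_bound)
  also have "\<dots> \<le> norm (complex_of_real (\<integral>\<omega>. norm (char_bilinear A (?S t \<omega>) a j l (t j) (t l)) \<partial>gauss))"
    by simp
  also have "complex_of_real (\<integral>\<omega>. norm (char_bilinear A (?S t \<omega>) a j l (t j) (t l)) \<partial>gauss)
      = (\<integral>\<omega>. char_bilinear A (?S t' \<omega>) a j l (t' j) (t' l) \<partial>gauss)"
    unfolding S using W by (simp add: t'_def col)
  also have "\<dots> = char_given_row A U a i s t'"
    unfolding UW by (subst char_given_row_pair(1)[OF A W]) simp
  finally show "norm (char_given_row A U a i s t)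
      \<le> norm (char_given_row A U a i s (t(j := sqrt ((t j)\<^sup>2 + (t l)\<^sup>2), l := 0)))"
    by (simp add: t'_def)
qed

definition char_gram_haf :: "'r set \<Rightarrow> nat set \<Rightarrow> real \<Rightarrow> complex" where
  "char_gram_haf A V s = (\<integral>\<omega>. cis (s * gram_haf A V \<omega>) \<partial>gauss)"

text \<open>If $t$ is a multiple of a basis vector, column \<open>i\<close> must be matched with \<open>j\<close>, and the other columns have zero
entry in row \<open>a\<close>: one row and two columns disappear.\<close>

lemma char_given_row_axis:
  assumes A: "finite A" "a \<in> A" and U: "finite U" "j \<in> U" "i \<notin> U"
  shows "char_given_row A U a i s (\<lambda>x. if x = j then \<tau> else 0) = char_gram_haf (A - {a}) (U - {j}) (s * \<tau>)"
proof -
  let ?t = "\<lambda>x. if x = j then \<tau> else 0"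
  have "gram_haf A (insert i U) (pinned_matrix a i ?t \<omega>) = \<tau> * gram_haf (A - {a}) (U - {j}) \<omega>" for \<omega>
  proof -
    have "gram_haf A (insert i U) (pinned_matrix a i ?t \<omega>) = (\<Sum>l\<in>U. ?t l * gram_haf A (U - {l}) (pinned_matrix a i ?t \<omega>))"
      by (rule gram_haf_pinned_matrix) fact+
    also have "\<dots> = \<tau> * gram_haf A (U - {j}) (pinned_matrix a i ?t \<omega>)"
      using U by (simp add: if_distrib[of "\<lambda>x. x * _"] cong: if_cong)
    also have "gram_haf A (U - {j}) (pinned_matrix a i ?t \<omega>) = gram_haf (A - {a}) (U - {j}) \<omega>"
    proof (rule gram_haf_cong_gram_on)
      fix x y assume xy: "x \<in> U - {j}" "y \<in> U - {j}"
      have "gram_on A (pinned_matrix a i ?t \<omega>) x y = (\<Sum>b\<in>A - {a}. pinned_matrix a i ?t \<omega> (b, x) * pinned_matrix a i ?t \<omega> (b, y))"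
        unfolding gram_on_def using A xy U by (subst sum.remove[of _ a]) (auto simp: pinned_matrix_def)
      also have "\<dots> = gram_on (A - {a}) \<omega> x y"
        unfolding gram_on_def using xy U by (intro sum.cong) (auto simp: pinned_matrix_def)
      finally show "gram_on A (pinned_matrix a i ?t \<omega>) x y = gram_on (A - {a}) \<omega> x y" .
    qed
    finally show ?thesis .
  qed
  then show ?thesis by (simp add: char_given_row_def char_gram_haf_def mult.assoc)
qed

lemma char_gram_haf_given_column:
  assumes U: "finite U" "i \<notin> U"
  shows "char_gram_haf A (insert i U) s = (\<integral>\<omega>. char_given_column A U s (\<lambda>b. \<omega> (b, i)) \<partial>gauss)" (is ?eq)
    and "integrable gauss (\<lambda>\<omega>. char_given_column A U s (\<lambda>b. \<omega> (b, i)))" (is ?int)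
proof -
  let ?J = "UNIV \<times> {i}"
  let ?f = "\<lambda>\<omega>. cis (s * gram_haf A (insert i U) \<omega>)"
  have int: "integrable gauss ?f" by (rule integrable_cis) measurable
  have eq: "(\<integral>\<omega>. ?f (resample ?J \<omega>' \<omega>) \<partial>gauss) = char_given_column A U s (\<lambda>b. \<omega>' (b, i))" for \<omega>'
    unfolding char_given_column_def
  proof (intro Bochner_Integration.integral_cong refl arg_cong[where f = "\<lambda>x. cis (s * x)"])
    fix \<omega> :: "'a \<times> nat \<Rightarrow> real"
    have "column_coeff A U (resample ?J \<omega>' \<omega>) b = column_coeff A U \<omega> b" for b
      by (rule column_coeff_cong) (use U in \<open>auto simp: resample_def\<close>)
    then show "gram_haf A (insert i U) (resample ?J \<omega>' \<omega>) = (\<Sum>b\<in>A. \<omega>' (b, i) * column_coeff A U \<omega> b)"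
      unfolding gram_haf_linear[OF U] by (simp add: resample_def)
  qed
  show ?eq unfolding char_gram_haf_def integral_resample[OF int, of ?J] eq ..
  show ?int using integrable_resample[OF int, of ?J] unfolding eq .
qed

lemma char_given_column_given_row:
  assumes A: "finite A" "a \<in> A" and U: "finite U" "i \<notin> U"
  shows "char_given_column A U s (\<lambda>x. if x = a then \<rho> else 0)
      = (\<integral>\<omega>. char_given_row A U a i (s * \<rho>) (\<lambda>j. \<omega> (a, j)) \<partial>gauss)" (is ?eq)
    and "integrable gauss (\<lambda>\<omega>. char_given_row A U a i s (\<lambda>j. \<omega> (a, j)))" (is ?int)
proof -
  let ?J = "{a} \<times> UNIV"
  let ?f = "\<lambda>s \<omega>. cis (s * column_coeff A U \<omega> a)"
  have int: "integrable gauss (?f s)" for s by (rule integrable_cis) measurable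
  have eq: "(\<integral>\<omega>. ?f s (resample ?J \<omega>' \<omega>) \<partial>gauss) = char_given_row A U a i s (\<lambda>j. \<omega>' (a, j))" for \<omega>' s
    unfolding char_given_row_def
  proof (intro Bochner_Integration.integral_cong refl arg_cong[where f = "\<lambda>x. cis (s * x)"])
    fix \<omega> :: "'a \<times> nat \<Rightarrow> real"
    have "column_coeff A U (resample ?J \<omega>' \<omega>) a = (\<Sum>j\<in>U. \<omega>' (a, j) * gram_haf A (U - {j}) (pinned_matrix a i (\<lambda>j. \<omega>' (a, j)) \<omega>))"
      unfolding column_coeff_def
    proof (intro sum.cong refl arg_cong2[where f = "(*)"] gram_haf_cong)
      show "resample ?J \<omega>' \<omega> (b, l) = pinned_matrix a i (\<lambda>j. \<omega>' (a, j)) \<omega> (b, l)" if "l \<in> U - {j}" for b l j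
        using that U by (auto simp: resample_def pinned_matrix_def)
    qed (simp add: resample_def)
    then show "column_coeff A U (resample ?J \<omega>' \<omega>) a = gram_haf A (insert i U) (pinned_matrix a i (\<lambda>j. \<omega>' (a, j)) \<omega>)"
      by (simp add: gram_haf_pinned_matrix[OF A U])
  qed
  have "char_given_column A U s (\<lambda>x. if x = a then \<rho> else 0) = (\<integral>\<omega>. ?f (s * \<rho>) \<omega> \<partial>gauss)"
    using A by (simp add: char_given_column_def if_distrib[of "\<lambda>x. x * _"] mult.assoc cong: if_cong)
  then show ?eq by (simp add: integral_resample[OF int, of _ ?J] eq)
  show ?int using integrable_resample[OF int[of s], of ?J] unfolding eq .
qed

text \<open>Given the column \<open>i\<close>, rotate it to the axis \<open>a\<close>; given the row \<open>a\<close> of the other columns, merge its entries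
into the entry \<open>j\<close>. What remains is a hafnian of the smaller matrix, scaled by the two
Euclidean lengths.\<close>

theorem char_gram_haf_reduction:
  assumes A: "finite A" "a \<in> A" "card A \<ge> 2" and U: "finite U" "j \<in> U" "card U \<ge> 2" "i \<notin> U"
  shows "ennreal (norm (char_gram_haf A (insert i U) s))
    \<le> (\<integral>\<^sup>+\<omega>. \<integral>\<^sup>+\<omega>'. ennreal (norm (char_gram_haf (A - {a}) (U - {j})
          (s * sqrt (\<Sum>b\<in>A. (\<omega> (b, i))\<^sup>2) * sqrt (\<Sum>l\<in>U. (\<omega>' (a, l))\<^sup>2)))) \<partial>gauss \<partial>gauss)"
proof -
  have inner: "ennreal (norm (char_given_column A U s u))
      \<le> (\<integral>\<^sup>+\<omega>'. ennreal (norm (char_gram_haf (A - {a}) (U - {j})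
          (s * sqrt (\<Sum>b\<in>A. (u b)\<^sup>2) * sqrt (\<Sum>l\<in>U. (\<omega>' (a, l))\<^sup>2)))) \<partial>gauss)" for u
  proof -
    let ?\<rho> = "sqrt (\<Sum>b\<in>A. (u b)\<^sup>2)"
    have "ennreal (norm (char_given_column A U s u))
        \<le> ennreal (norm (\<integral>\<omega>. char_given_row A U a i (s * ?\<rho>) (\<lambda>j. \<omega> (a, j)) \<partial>gauss))"
      using char_given_column_collapse[OF A U(1), of s u]
      by (simp add: char_given_column_given_row(1)[OF A(1,2) U(1,4)])
    also have "\<dots> \<le> (\<integral>\<^sup>+\<omega>. ennreal (norm (char_given_row A U a i (s * ?\<rho>) (\<lambda>j. \<omega> (a, j)))) \<partial>gauss)"
      by (rule integral_norm_bound_ennreal) (rule char_given_column_given_row(2)[OF A(1,2) U(1,4)])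
    also have "\<dots> \<le> (\<integral>\<^sup>+\<omega>'. ennreal (norm (char_gram_haf (A - {a}) (U - {j})
          (s * ?\<rho> * sqrt (\<Sum>l\<in>U. (\<omega>' (a, l))\<^sup>2)))) \<partial>gauss)"
      using char_given_row_collapse[OF A(1,2) U]
      by (intro nn_integral_mono ennreal_leI)
        (simp add: char_given_row_axis[OF A(1,2) U(1,2,4), symmetric])
    finally show ?thesis .
  qed
  have "ennreal (norm (char_gram_haf A (insert i U) s))
      \<le> (\<integral>\<^sup>+\<omega>. ennreal (norm (char_given_column A U s (\<lambda>b. \<omega> (b, i)))) \<partial>gauss)"
    unfolding char_gram_haf_given_column(1)[OF U(1,4)]
    by (rule integral_norm_bound_ennreal) (rule char_gram_haf_given_column(2)[OF U(1,4)])
  also have "\<dots> \<le> (\<integral>\<^sup>+\<omega>. \<integral>\<^sup>+\<omega>'. ennreal (norm (char_gram_haf (A - {a}) (U - {j})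
          (s * sqrt (\<Sum>b\<in>A. (\<omega> (b, i))\<^sup>2) * sqrt (\<Sum>l\<in>U. (\<omega>' (a, l))\<^sup>2)))) \<partial>gauss \<partial>gauss)"
    by (intro nn_integral_mono inner)
  finally show ?thesis .
qed

section \<open>Integrating the characteristic function\<close>

lemma nn_integral_gaussian:
  assumes "r > 0"
  shows "(\<integral>\<^sup>+s. ennreal (exp (- ((s * r)\<^sup>2 / 2))) \<partial>lborel) = ennreal (sqrt (2 * pi) / r)"
proof -
  have eq: "exp (- ((s * r)\<^sup>2 / 2)) = sqrt (2 * pi) / r * normal_density 0 (1 / r) s" for s
    using assms by (simp add: normal_density_def real_sqrt_mult real_sqrt_divide power_divide power_mult_distrib field_simps)
  have "(\<integral>\<^sup>+s. ennreal (exp (- ((s * r)\<^sup>2 / 2))) \<partial>lborel)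
      = (\<integral>\<^sup>+s. ennreal (sqrt (2 * pi) / r) * ennreal (normal_density 0 (1 / r) s) \<partial>lborel)"
    unfolding eq using assms by (intro nn_integral_cong ennreal_mult') simp
  also have "\<dots> = ennreal (sqrt (2 * pi) / r) * (\<integral>\<^sup>+s. ennreal (normal_density 0 (1 / r) s) \<partial>lborel)"
    by (rule nn_integral_cmult) measurable
  also have "(\<integral>\<^sup>+s. ennreal (normal_density 0 (1 / r) s) \<partial>lborel) = 1"
    using assms by (subst nn_integral_eq_integral) auto
  finally show ?thesis by simp
qed

lemma nn_integral_scale:
  assumes [measurable]: "f \<in> borel_measurable borel" and "c > 0"
  shows "(\<integral>\<^sup>+s. f (s * c) \<partial>lborel) = ennreal (1 / c) * (\<integral>\<^sup>+s. f s \<partial>lborel)"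
proof -
  have "(\<integral>\<^sup>+s. f s \<partial>lborel) = ennreal c * (\<integral>\<^sup>+s. f (s * c) \<partial>lborel)"
    using nn_integral_real_affine[of f c 0] assms by (simp add: mult.commute)
  then have "ennreal (1 / c) * (\<integral>\<^sup>+s. f s \<partial>lborel) = ennreal (1 / c) * ennreal c * (\<integral>\<^sup>+s. f (s * c) \<partial>lborel)"
    by (simp add: mult.assoc)
  also have "ennreal (1 / c) * ennreal c = 1"
    using assms by (simp add: ennreal_mult'[symmetric])
  finally show ?thesis by simp
qed

text \<open>Write $(1+s^2)^{-d/2}$ as a Gamma integral over $x$ with kernel $e^{-(1+s^2)x/2}$ and integrate over
\<open>s\<close> first; this lowers the exponent by one half.\<close>

lemma nn_integral_inverse_power_quadratic:
  fixes d :: real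
  assumes d: "d > 1"
  shows "(\<integral>\<^sup>+s. ennreal ((1 + s\<^sup>2) powr (- d / 2)) \<partial>lborel) = ennreal (sqrt (2 * pi) * chi_square_gamma d)"
proof -
  define p where "p = d / 2"
  have p: "p > 1 / 2" using d by (simp add: p_def)
  define C where "C = 2 powr p * Gamma p"
  have C: "C > 0" using p unfolding C_def by (intro mult_pos_pos Gamma_real_pos) auto
  let ?F = "\<lambda>p x::real. if x \<le> 0 then 0 else x powr (p - 1) * exp (- x / 2)"
  have inner: "ennreal C * ennreal (m powr (- p))
      = (\<integral>\<^sup>+x. ennreal (if x \<le> 0 then 0 else x powr (p - 1) * exp (- (m * x) / 2)) \<partial>lborel)"
    if m: "m > 0" for m :: real
  proof -
    have "(\<integral>\<^sup>+x. ennreal (?F p (x * m)) \<partial>lborel) = ennreal (1 / m) * ennreal C"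
      using p m by (subst nn_integral_scale) (auto simp: nn_integral_powr_exp_half C_def)
    moreover have "(\<integral>\<^sup>+x. ennreal (?F p (x * m)) \<partial>lborel)
        = (\<integral>\<^sup>+x. ennreal (m powr (p - 1)) * ennreal (if x \<le> 0 then 0 else x powr (p - 1) * exp (- (m * x) / 2)) \<partial>lborel)"
      using m by (intro nn_integral_cong)
        (auto simp: powr_mult mult_le_0_iff mult_ac simp flip: ennreal_mult')
    moreover have "\<dots> = ennreal (m powr (p - 1))
        * (\<integral>\<^sup>+x. ennreal (if x \<le> 0 then 0 else x powr (p - 1) * exp (- (m * x) / 2)) \<partial>lborel)"
      by (rule nn_integral_cmult) measurable
    ultimately have *: "ennreal (m powr (p - 1))
        * (\<integral>\<^sup>+x. ennreal (if x \<le> 0 then 0 else x powr (p - 1) * exp (- (m * x) / 2)) \<partial>lborel) = ennreal (1 / m) * ennreal C"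
      by simp
    have "ennreal (m powr (1 - p)) * ennreal (m powr (p - 1)) = 1"
      using m by (simp add: ennreal_mult'[symmetric] powr_add[symmetric])
    then have "(\<integral>\<^sup>+x. ennreal (if x \<le> 0 then 0 else x powr (p - 1) * exp (- (m * x) / 2)) \<partial>lborel)
        = ennreal (m powr (1 - p)) * (ennreal (1 / m) * ennreal C)"
      unfolding *[symmetric] mult.assoc[symmetric] by simp
    also have "\<dots> = ennreal (m powr (1 - p) * (1 / m) * C)"
      using m C by (simp add: ennreal_mult'[symmetric] mult.assoc)
    also have "m powr (1 - p) * (1 / m) = m powr (- p)"
      using m by (simp add: powr_diff powr_minus field_simps)
    finally show ?thesis using C by (simp add: ennreal_mult'[symmetric] mult.commute)
  qed
  have "ennreal C * (\<integral>\<^sup>+s. ennreal ((1 + s\<^sup>2) powr (- p)) \<partial>lborel)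
      = (\<integral>\<^sup>+s. ennreal C * ennreal ((1 + s\<^sup>2) powr (- p)) \<partial>lborel)"
    by (rule nn_integral_cmult[symmetric]) measurable
  also have "\<dots> = (\<integral>\<^sup>+s. \<integral>\<^sup>+x. ennreal (if x \<le> 0 then 0 else x powr (p - 1) * exp (- ((1 + s\<^sup>2) * x) / 2)) \<partial>lborel \<partial>lborel)"
    by (intro nn_integral_cong inner) (simp add: add_pos_nonneg)
  also have "\<dots> = (\<integral>\<^sup>+x. \<integral>\<^sup>+s. ennreal (if x \<le> 0 then 0 else x powr (p - 1) * exp (- ((1 + s\<^sup>2) * x) / 2)) \<partial>lborel \<partial>lborel)"
    by (rule lborel_pair.Fubini') measurable
  also have "\<dots> = (\<integral>\<^sup>+x. ennreal (sqrt (2 * pi)) * ennreal (?F (p - 1 / 2) x) \<partial>lborel)"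
  proof (rule nn_integral_cong)
    fix x :: real
    show "(\<integral>\<^sup>+s. ennreal (if x \<le> 0 then 0 else x powr (p - 1) * exp (- ((1 + s\<^sup>2) * x) / 2)) \<partial>lborel)
        = ennreal (sqrt (2 * pi)) * ennreal (?F (p - 1 / 2) x)"
    proof (cases "x \<le> 0")
      case False
      have "(\<integral>\<^sup>+s. ennreal (if x \<le> 0 then 0 else x powr (p - 1) * exp (- ((1 + s\<^sup>2) * x) / 2)) \<partial>lborel)
          = (\<integral>\<^sup>+s. ennreal (?F p x) * ennreal (exp (- ((s * sqrt x)\<^sup>2 / 2))) \<partial>lborel)"
        using False by (intro nn_integral_cong)
          (simp add: ennreal_mult'[symmetric] power_mult_distrib exp_add[symmetric] field_simps)
      also have "\<dots> = ennreal (?F p x) * ennreal (sqrt (2 * pi) / sqrt x)"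
        using False by (subst nn_integral_cmult) (auto simp: nn_integral_gaussian)
      also have "\<dots> = ennreal (?F p x * (sqrt (2 * pi) / sqrt x))"
        using False by (subst ennreal_mult'[symmetric]) auto
      also have "?F p x * (sqrt (2 * pi) / sqrt x) = sqrt (2 * pi) * ?F (p - 1 / 2) x"
      proof -
        have "x powr (p - 1) / sqrt x = x powr (p - 1 - 1 / 2)"
          using False powr_diff[of x "p - 1" "1 / 2"] by (simp add: powr_half_sqrt)
        then show ?thesis using False by (simp add: field_simps)
      qed
      finally show ?thesis by (simp add: ennreal_mult')
    qed simp
  qed
  also have "\<dots> = ennreal (sqrt (2 * pi)) * ennreal (2 powr (p - 1 / 2) * Gamma (p - 1 / 2))"
    using p by (subst nn_integral_cmult) (auto simp: nn_integral_powr_exp_half)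
  also have "\<dots> = ennreal (C * (sqrt (2 * pi) * chi_square_gamma d))"
  proof -
    have "2 powr (p - 1 / 2) * Gamma (p - 1 / 2) = C * chi_square_gamma d"
    proof -
      have "2 powr (p - 1 / 2) = 2 powr p * (2::real) powr (- 1 / 2)"
        by (simp add: powr_add[symmetric])
      moreover have e: "(d - 1) / 2 = p - 1 / 2" by (simp add: p_def diff_divide_distrib)
      moreover have "Gamma p > 0" using p by (intro Gamma_real_pos) simp
      ultimately show ?thesis
        unfolding C_def chi_square_gamma_eq(2)[OF d] e p_def[symmetric] by simp
    qed
    then show ?thesis
      by (simp only:) (simp add: ennreal_mult''[symmetric] mult_ac)
  qed
  finally have *: "ennreal C * (\<integral>\<^sup>+s. ennreal ((1 + s\<^sup>2) powr (- p)) \<partial>lborel)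
      = ennreal (C * (sqrt (2 * pi) * chi_square_gamma d))" .
  have "(\<integral>\<^sup>+s. ennreal ((1 + s\<^sup>2) powr (- p)) \<partial>lborel)
      = ennreal (1 / C) * (ennreal C * (\<integral>\<^sup>+s. ennreal ((1 + s\<^sup>2) powr (- p)) \<partial>lborel))"
    using C by (simp add: mult.assoc[symmetric] ennreal_mult'[symmetric])
  also have "\<dots> = ennreal (sqrt (2 * pi) * chi_square_gamma d)"
    unfolding * using C by (simp add: ennreal_mult'[symmetric])
  finally show ?thesis by (simp add: p_def)
qed

lemma chi_square_gamma_pos: "d > 1 \<Longrightarrow> chi_square_gamma d > 0"
  by (subst chi_square_gamma_eq) (auto intro!: divide_pos_pos mult_pos_pos Gamma_real_pos)

lemma nn_integral_prod_coordinates: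
  assumes [measurable]: "h \<in> borel_measurable borel" and "finite P" "inj_on f P"
  shows "(\<integral>\<^sup>+\<omega>. (\<Prod>x\<in>P. h (\<omega> (f x))) \<partial>gauss)
    = (\<integral>\<^sup>+x. ennreal (std_normal_density x) * h x \<partial>lborel) ^ card P"
  using assms(2,3)
proof (induction P)
  case empty
  then show ?case by (simp add: gauss.emeasure_space_1[simplified])
next
  case (insert x P)
  have "(\<integral>\<^sup>+\<omega>. (\<Prod>x\<in>insert x P. h (\<omega> (f x))) \<partial>gauss)
      = (\<integral>\<^sup>+\<omega>'. \<integral>\<^sup>+\<omega>. (\<Prod>y\<in>insert x P. h (resample {f x} \<omega>' \<omega> (f y))) \<partial>gauss \<partial>gauss)"
    by (rule nn_integral_resample[where f = "\<lambda>\<omega>. \<Prod>y\<in>insert x P. h (\<omega> (f y))"]) measurable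
  also have "\<dots> = (\<integral>\<^sup>+\<omega>'. \<integral>\<^sup>+\<omega>. h (\<omega>' (f x)) * (\<Prod>x\<in>P. h (\<omega> (f x))) \<partial>gauss \<partial>gauss)"
  proof (intro nn_integral_cong)
    fix \<omega>' \<omega> :: "'b \<Rightarrow> real"
    have "f y \<noteq> f x" if "y \<in> P" for y using insert that by (auto simp: inj_on_def)
    then show "(\<Prod>y\<in>insert x P. h (resample {f x} \<omega>' \<omega> (f y))) = h (\<omega>' (f x)) * (\<Prod>x\<in>P. h (\<omega> (f x)))"
      using insert by (simp add: resample_def cong: prod.cong)
  qed
  also have "\<dots> = (\<integral>\<^sup>+\<omega>'. h (\<omega>' (f x)) \<partial>gauss) * (\<integral>\<^sup>+\<omega>. (\<Prod>x\<in>P. h (\<omega> (f x))) \<partial>gauss)"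
    by (simp add: nn_integral_cmult nn_integral_multc)
  finally show ?case using insert by (simp add: nn_integral_coordinate)
qed

lemma AE_coordinate_nonzero: "AE \<omega> in gauss. \<omega> p \<noteq> 0"
proof -
  have "AE x in std_normal_distribution. x \<noteq> 0"
    by (subst AE_density) (auto intro!: AE_I2 eventually_mono[OF AE_lborel_singleton[of 0]])
  then have "AE x in distr gauss std_normal_distribution (\<lambda>\<omega>. \<omega> p). x \<noteq> 0"
    unfolding distr_coordinate .
  then show ?thesis by (subst (asm) AE_distr_iff) auto
qed

lemma AE_sum_squares_pos:
  assumes "finite P" "P \<noteq> {}"
  shows "AE \<omega> in gauss. (\<Sum>x\<in>P. (\<omega> (f x))\<^sup>2) > 0"
proof -
  obtain x where x: "x \<in> P" using assms by auto
  from AE_coordinate_nonzero[of "f x"] show ?thesis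
  proof eventually_elim
    case (elim \<omega>)
    then show ?case using assms x by (intro sum_pos2[where i = x]) auto
  qed
qed

text \<open>$1/r$ is the integral of $e^{-s^2r^2/2}$ over \<open>s\<close> up to the factor $\sqrt{2\pi}$, and the expectation
of this kernel factors over the coordinates. So the inverse chi moment is found without
the chi-square law.\<close>

lemma expectation_inverse_norm:
  assumes P: "finite P" "inj_on f P" "card P \<ge> 2"
  shows "(\<integral>\<^sup>+\<omega>. ennreal (1 / sqrt (\<Sum>x\<in>P. (\<omega> (f x))\<^sup>2)) \<partial>gauss) = ennreal (chi_square_gamma (real (card P)))"
proof -
  let ?q = "\<lambda>\<omega>. \<Sum>x\<in>P. (\<omega> (f x))\<^sup>2"
  have "P \<noteq> {}" using P by auto
  note pos = AE_sum_squares_pos[OF P(1) this, of f]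
  have one: "(\<integral>\<^sup>+x. ennreal (std_normal_density x) * ennreal (exp (- ((s * x)\<^sup>2 / 2))) \<partial>lborel)
      = ennreal ((1 + s\<^sup>2) powr (- 1 / 2))" for s :: real
  proof -
    have s: "1 + s\<^sup>2 > 0" by (simp add: add_pos_nonneg)
    have "(\<integral>\<^sup>+x. ennreal (std_normal_density x) * ennreal (exp (- ((s * x)\<^sup>2 / 2))) \<partial>lborel)
        = (\<integral>\<^sup>+x. ennreal (1 / sqrt (2 * pi)) * ennreal (exp (- ((x * sqrt (1 + s\<^sup>2))\<^sup>2 / 2))) \<partial>lborel)"
      using s by (intro nn_integral_cong)
        (simp add: std_normal_density_def ennreal_mult'[symmetric] power_mult_distrib exp_add[symmetric] field_simps)
    also have "\<dots> = ennreal (1 / sqrt (2 * pi)) * ennreal (sqrt (2 * pi) / sqrt (1 + s\<^sup>2))"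
      using s by (subst nn_integral_cmult) (auto simp: nn_integral_gaussian)
    also have "\<dots> = ennreal ((1 + s\<^sup>2) powr (- 1 / 2))"
      using s by (simp add: ennreal_mult'[symmetric] powr_minus_divide powr_half_sqrt)
    finally show ?thesis .
  qed
  have "ennreal (sqrt (2 * pi)) * (\<integral>\<^sup>+\<omega>. ennreal (1 / sqrt (?q \<omega>)) \<partial>gauss)
      = (\<integral>\<^sup>+\<omega>. ennreal (sqrt (2 * pi)) * ennreal (1 / sqrt (?q \<omega>)) \<partial>gauss)"
    by (rule nn_integral_cmult[symmetric]) measurable
  also have "\<dots> = (\<integral>\<^sup>+\<omega>. \<integral>\<^sup>+s. ennreal (exp (- ((s * sqrt (?q \<omega>))\<^sup>2 / 2))) \<partial>lborel \<partial>gauss)"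
  proof (rule nn_integral_cong_AE)
    show "AE \<omega> in gauss. ennreal (sqrt (2 * pi)) * ennreal (1 / sqrt (?q \<omega>))
        = (\<integral>\<^sup>+s. ennreal (exp (- ((s * sqrt (?q \<omega>))\<^sup>2 / 2))) \<partial>lborel)"
      using pos by eventually_elim (simp add: nn_integral_gaussian ennreal_mult'[symmetric])
  qed
  also have "\<dots> = (\<integral>\<^sup>+s. \<integral>\<^sup>+\<omega>. ennreal (exp (- ((s * sqrt (?q \<omega>))\<^sup>2 / 2))) \<partial>gauss \<partial>lborel)"
    by (rule pair_sigma_finite.Fubini'[symmetric]) (unfold_locales, measurable)
  also have "\<dots> = (\<integral>\<^sup>+s. \<integral>\<^sup>+\<omega>. (\<Prod>x\<in>P. ennreal (exp (- ((s * \<omega> (f x))\<^sup>2 / 2)))) \<partial>gauss \<partial>lborel)"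
  proof (intro nn_integral_cong)
    fix s :: real and \<omega> :: "'b \<Rightarrow> real"
    have "- (s * sqrt (?q \<omega>))\<^sup>2 / 2 = (\<Sum>x\<in>P. - (s * \<omega> (f x))\<^sup>2 / 2)"
      by (simp add: power_mult_distrib sum_nonneg sum_distrib_left sum_negf sum_divide_distrib)
    then show "ennreal (exp (- ((s * sqrt (?q \<omega>))\<^sup>2 / 2))) = (\<Prod>x\<in>P. ennreal (exp (- ((s * \<omega> (f x))\<^sup>2 / 2))))"
      using P(1) by (simp add: exp_sum prod_ennreal)
  qed
  also have "\<dots> = (\<integral>\<^sup>+s. ennreal ((1 + s\<^sup>2) powr (- 1 / 2)) ^ card P \<partial>lborel)"
    by (intro nn_integral_cong, subst nn_integral_prod_coordinates) (auto simp: P one)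
  also have "\<dots> = (\<integral>\<^sup>+s. ennreal ((1 + s\<^sup>2) powr (- real (card P) / 2)) \<partial>lborel)"
  proof (intro nn_integral_cong)
    fix s :: real
    have "1 + s\<^sup>2 > 0" by (simp add: add_pos_nonneg)
    then show "ennreal ((1 + s\<^sup>2) powr (- 1 / 2)) ^ card P = ennreal ((1 + s\<^sup>2) powr (- real (card P) / 2))"
      by (simp add: ennreal_power powr_realpow[symmetric] powr_powr)
  qed
  also have "\<dots> = ennreal (sqrt (2 * pi)) * ennreal (chi_square_gamma (real (card P)))"
    using P by (subst nn_integral_inverse_power_quadratic) (auto simp: ennreal_mult')
  finally show ?thesis
    by (subst (asm) ennreal_mult_cancel_left) auto
qed

lemma integral_cis_coordinate:
  "(\<integral>\<omega>. cis (s * \<omega> p) \<partial>gauss) = complex_of_real (exp (- (s\<^sup>2) / 2))"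
proof -
  have "(\<integral>\<omega>. cis (s * \<omega> p) \<partial>gauss) = char std_normal_distribution s"
    by (subst expectation_coordinate[where f = "\<lambda>x. cis (s * x)"]) (auto simp: char_def cis_conv_exp)
  then show ?thesis by (simp add: char_std_normal_distribution)
qed

lemma integral_cis_linear:
  assumes "finite P" "inj_on f P"
  shows "(\<integral>\<omega>. cis (\<Sum>x\<in>P. w x * \<omega> (f x)) \<partial>gauss) = complex_of_real (exp (- (\<Sum>x\<in>P. (w x)\<^sup>2) / 2))"
  using assms
proof (induction P)
  case empty
  then show ?case by (simp add: gauss.prob_space[simplified])
next
  case (insert x P)
  have "(\<integral>\<omega>. cis (\<Sum>x\<in>insert x P. w x * \<omega> (f x)) \<partial>gauss)
      = (\<integral>\<omega>. cis (w x * \<omega> (f x)) * cis (\<Sum>x\<in>P. w x * \<omega> (f x)) \<partial>gauss)"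
    using insert by (simp add: cis_mult)
  also have "\<dots> = (\<integral>\<omega>. cis (w x * \<omega> (f x)) \<partial>gauss) * (\<integral>\<omega>. cis (\<Sum>x\<in>P. w x * \<omega> (f x)) \<partial>gauss)"
  proof (rule integral_mult_resample[where J = "{f x}"])
    show "integrable gauss (\<lambda>\<omega>. cis (w x * \<omega> (f x)) * cis (\<Sum>x\<in>P. w x * \<omega> (f x)))"
      unfolding cis_mult by (rule integrable_cis) measurable
    show "cis (\<Sum>y\<in>P. w y * resample {f x} \<omega>' \<omega> (f y)) = cis (\<Sum>y\<in>P. w y * \<omega> (f y))" for \<omega>' \<omega>
    proof -
      have "f y \<noteq> f x" if "y \<in> P" for y using insert that by (auto simp: inj_on_def)
      then show ?thesis by (simp add: resample_def cong: sum.cong)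
    qed
  qed (simp add: resample_def)
  also have "\<dots> = complex_of_real (exp (- ((w x)\<^sup>2) / 2) * exp (- (\<Sum>x\<in>P. (w x)\<^sup>2) / 2))"
    using insert by (simp add: integral_cis_coordinate)
  finally show ?case
    using insert by (simp add: exp_add[symmetric] add_divide_distrib diff_divide_distrib)
qed

lemma measurable_char_gram_haf [measurable]: "char_gram_haf A V \<in> borel_measurable borel"
  unfolding char_gram_haf_def by measurable

text \<open>Each reduction step removes one row and two columns and, after the substitution $s \mapsto s/(|u||t|)$, contributes two
inverse chi moments. For two columns the Gram hafnian is an inner product, which contributes one.\<close>

theorem nn_integral_char_gram_haf:
  assumes "n \<ge> 1" "finite A" "card A \<ge> n + 1" "finite V" "card V = 2 * n"
  shows "(\<integral>\<^sup>+s. ennreal (norm (char_gram_haf A V s)) \<partial>lborel)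
    \<le> ennreal (sqrt (2 * pi) * (\<Prod>j<n. chi_square_gamma (real (card A) - real j))
        * (\<Prod>r=2..n. chi_square_gamma (2 * real r - 1)))"
  using assms
proof (induction n arbitrary: A V rule: nat_induct_at_least)
  case base
  obtain i j where V: "V = insert i {j}" "i \<noteq> j"
    using base.prems by (auto simp: card_2_iff)
  obtain a where a: "a \<in> A" using base.prems by fastforce
  have A: "finite A" "a \<in> A" "card A \<ge> 2" using base.prems a by auto
  let ?\<rho> = "\<lambda>\<omega>. sqrt (\<Sum>b\<in>A. (\<omega> (b, i))\<^sup>2)"
  have g: "norm (char_given_column A {j} s u) \<le> exp (- ((s * sqrt (\<Sum>b\<in>A. (u b)\<^sup>2))\<^sup>2 / 2))" for s u
  proof -
    let ?\<rho> = "sqrt (\<Sum>b\<in>A. (u b)\<^sup>2)"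
    have "char_given_column A {j} s (\<lambda>x. if x = a then ?\<rho> else 0) = (\<integral>\<omega>. cis ((s * ?\<rho>) * \<omega> (a, j)) \<partial>gauss)"
      using A by (simp add: char_given_column_def if_distrib[of "\<lambda>x. x * _"] column_coeff_def mult.assoc cong: if_cong)
    then have "norm (char_given_column A {j} s (\<lambda>x. if x = a then ?\<rho> else 0)) = exp (- ((s * ?\<rho>)\<^sup>2 / 2))"
      by (simp add: integral_cis_coordinate)
    then show ?thesis using char_given_column_collapse[OF A, of "{j}" s u] by simp
  qed
  have pos: "AE \<omega> in gauss. (\<Sum>b\<in>A. (\<omega> (b, i))\<^sup>2) > 0"
    by (rule AE_sum_squares_pos) (use A in auto)
  have "(\<integral>\<^sup>+s. ennreal (norm (char_gram_haf A V s)) \<partial>lborel)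
      \<le> (\<integral>\<^sup>+s. \<integral>\<^sup>+\<omega>. ennreal (exp (- ((s * ?\<rho> \<omega>)\<^sup>2 / 2))) \<partial>gauss \<partial>lborel)"
  proof (intro nn_integral_mono)
    fix s :: real
    have "ennreal (norm (char_gram_haf A V s))
        \<le> (\<integral>\<^sup>+\<omega>. ennreal (norm (char_given_column A {j} s (\<lambda>b. \<omega> (b, i)))) \<partial>gauss)"
      unfolding V(1) using V(2) by (subst char_gram_haf_given_column(1))
        (auto intro!: integral_norm_bound_ennreal char_gram_haf_given_column(2))
    also have "\<dots> \<le> (\<integral>\<^sup>+\<omega>. ennreal (exp (- ((s * ?\<rho> \<omega>)\<^sup>2 / 2))) \<partial>gauss)"
      by (intro nn_integral_mono ennreal_leI g)
    finally show "ennreal (norm (char_gram_haf A V s)) \<le> (\<integral>\<^sup>+\<omega>. ennreal (exp (- ((s * ?\<rho> \<omega>)\<^sup>2 / 2))) \<partial>gauss)" .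
  qed
  also have "\<dots> = (\<integral>\<^sup>+\<omega>. \<integral>\<^sup>+s. ennreal (exp (- ((s * ?\<rho> \<omega>)\<^sup>2 / 2))) \<partial>lborel \<partial>gauss)"
    by (rule pair_sigma_finite.Fubini') (unfold_locales, measurable)
  also have "\<dots> = (\<integral>\<^sup>+\<omega>. ennreal (sqrt (2 * pi)) * ennreal (1 / ?\<rho> \<omega>) \<partial>gauss)"
  proof (rule nn_integral_cong_AE)
    show "AE \<omega> in gauss. (\<integral>\<^sup>+s. ennreal (exp (- ((s * ?\<rho> \<omega>)\<^sup>2 / 2))) \<partial>lborel)
        = ennreal (sqrt (2 * pi)) * ennreal (1 / ?\<rho> \<omega>)"
      using pos by eventually_elim (simp add: nn_integral_gaussian ennreal_mult'[symmetric])
  qed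
  also have "\<dots> = ennreal (sqrt (2 * pi)) * ennreal (chi_square_gamma (real (card A)))"
    using A by (subst nn_integral_cmult) (auto simp: expectation_inverse_norm inj_on_def)
  finally show ?case by (simp add: ennreal_mult'[symmetric])
next
  case (Suc n)
  obtain i U where V: "V = insert i U" "i \<notin> U" "card U = 2 * n + 1" "finite U"
    using Suc.prems by (metis Suc_eq_plus1 add_2_eq_Suc' card_Suc_eq finite_insert mult_Suc_right add.commute)
  obtain a where a: "a \<in> A" using Suc.prems by fastforce
  obtain j where j: "j \<in> U" using V by fastforce
  have A: "finite A" "a \<in> A" "card A \<ge> 2" and U: "finite U" "j \<in> U" "card U \<ge> 2" "i \<notin> U"
    using Suc.prems Suc.hyps a j V by auto
  let ?G = "\<lambda>s. ennreal (norm (char_gram_haf (A - {a}) (U - {j}) s))"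
  let ?\<rho> = "\<lambda>\<omega>. sqrt (\<Sum>b\<in>A. (\<omega> (b, i))\<^sup>2)" and ?\<tau> = "\<lambda>\<omega>. sqrt (\<Sum>l\<in>U. (\<omega> (a, l))\<^sup>2)"
  define I where "I = (\<integral>\<^sup>+s. ?G s \<partial>lborel)"
  have pos: "AE \<omega> in gauss. (\<Sum>b\<in>A. (\<omega> (b, i))\<^sup>2) > 0" "AE \<omega> in gauss. (\<Sum>l\<in>U. (\<omega> (a, l))\<^sup>2) > 0"
    by (rule AE_sum_squares_pos; use A U in auto)+
  have "(\<integral>\<^sup>+s. ennreal (norm (char_gram_haf A V s)) \<partial>lborel)
      \<le> (\<integral>\<^sup>+s. \<integral>\<^sup>+\<omega>. \<integral>\<^sup>+\<omega>'. ?G (s * ?\<rho> \<omega> * ?\<tau> \<omega>') \<partial>gauss \<partial>gauss \<partial>lborel)"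
    unfolding V(1) by (intro nn_integral_mono char_gram_haf_reduction A U)
  also have "\<dots> = (\<integral>\<^sup>+\<omega>. \<integral>\<^sup>+s. \<integral>\<^sup>+\<omega>'. ?G (s * ?\<rho> \<omega> * ?\<tau> \<omega>') \<partial>gauss \<partial>lborel \<partial>gauss)"
    by (rule pair_sigma_finite.Fubini') (unfold_locales, measurable)
  also have "\<dots> = (\<integral>\<^sup>+\<omega>. \<integral>\<^sup>+\<omega>'. \<integral>\<^sup>+s. ?G (s * ?\<rho> \<omega> * ?\<tau> \<omega>') \<partial>lborel \<partial>gauss \<partial>gauss)"
    by (intro nn_integral_cong pair_sigma_finite.Fubini') (unfold_locales, measurable)
  also have "\<dots> = (\<integral>\<^sup>+\<omega>. \<integral>\<^sup>+\<omega>'. ennreal (1 / ?\<rho> \<omega>) * (ennreal (1 / ?\<tau> \<omega>') * I) \<partial>gauss \<partial>gauss)"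
  proof (rule nn_integral_cong_AE, use pos(1) in eventually_elim)
    fix \<omega> :: "'a \<times> nat \<Rightarrow> real" assume \<omega>: "(\<Sum>b\<in>A. (\<omega> (b, i))\<^sup>2) > 0"
    show "(\<integral>\<^sup>+\<omega>'. \<integral>\<^sup>+s. ?G (s * ?\<rho> \<omega> * ?\<tau> \<omega>') \<partial>lborel \<partial>gauss)
        = (\<integral>\<^sup>+\<omega>'. ennreal (1 / ?\<rho> \<omega>) * (ennreal (1 / ?\<tau> \<omega>') * I) \<partial>gauss)"
    proof (rule nn_integral_cong_AE, use pos(2) in eventually_elim)
      fix \<omega>' :: "'a \<times> nat \<Rightarrow> real" assume \<omega>': "(\<Sum>l\<in>U. (\<omega>' (a, l))\<^sup>2) > 0"
      have "(\<integral>\<^sup>+s. ?G (s * ?\<rho> \<omega> * ?\<tau> \<omega>') \<partial>lborel) = ennreal (1 / ?\<rho> \<omega>) * (\<integral>\<^sup>+s. ?G (s * ?\<tau> \<omega>') \<partial>lborel)"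
        using \<omega> by (intro nn_integral_scale[where f = "\<lambda>s. ?G (s * ?\<tau> \<omega>')"]) auto
      also have "(\<integral>\<^sup>+s. ?G (s * ?\<tau> \<omega>') \<partial>lborel) = ennreal (1 / ?\<tau> \<omega>') * I"
        unfolding I_def using \<omega>' by (intro nn_integral_scale[where f = ?G]) auto
      finally show "(\<integral>\<^sup>+s. ?G (s * ?\<rho> \<omega> * ?\<tau> \<omega>') \<partial>lborel) = ennreal (1 / ?\<rho> \<omega>) * (ennreal (1 / ?\<tau> \<omega>') * I)" .
    qed
  qed
  also have "\<dots> = (\<integral>\<^sup>+\<omega>. ennreal (1 / ?\<rho> \<omega>) \<partial>gauss) * ((\<integral>\<^sup>+\<omega>. ennreal (1 / ?\<tau> \<omega>) \<partial>gauss) * I)"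
    by (simp add: nn_integral_cmult nn_integral_multc)
  also have "(\<integral>\<^sup>+\<omega>. ennreal (1 / ?\<rho> \<omega>) \<partial>gauss) = ennreal (chi_square_gamma (real (card A)))"
    using A by (intro expectation_inverse_norm) (auto simp: inj_on_def)
  also have "(\<integral>\<^sup>+\<omega>. ennreal (1 / ?\<tau> \<omega>) \<partial>gauss) = ennreal (chi_square_gamma (real (card U)))"
    using U by (intro expectation_inverse_norm) (auto simp: inj_on_def)
  also have "ennreal (chi_square_gamma (real (card A))) * (ennreal (chi_square_gamma (real (card U))) * I)
      \<le> ennreal (chi_square_gamma (real (card A))) * (ennreal (chi_square_gamma (real (card U)))
        * ennreal (sqrt (2 * pi) * (\<Prod>j<n. chi_square_gamma (real (card (A - {a})) - real j))
          * (\<Prod>r=2..n. chi_square_gamma (2 * real r - 1))))"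
    unfolding I_def by (intro mult_left_mono Suc.IH) (use Suc.prems A U V in auto)
  also have "\<dots> = ennreal (chi_square_gamma (real (card A)) * (chi_square_gamma (real (card U))
        * (sqrt (2 * pi) * (\<Prod>j<n. chi_square_gamma (real (card (A - {a})) - real j))
          * (\<Prod>r=2..n. chi_square_gamma (2 * real r - 1)))))"
    using A U by (simp add: ennreal_mult' less_imp_le[OF chi_square_gamma_pos])
  also have "\<dots> = ennreal (sqrt (2 * pi) * (\<Prod>j<Suc n. chi_square_gamma (real (card A) - real j))
        * (\<Prod>r=2..Suc n. chi_square_gamma (2 * real r - 1)))"
  proof -
    have "(\<Prod>j<Suc n. chi_square_gamma (real (card A) - real j))
        = chi_square_gamma (real (card A)) * (\<Prod>j<n. chi_square_gamma (real (card (A - {a})) - real j))"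
      unfolding prod.lessThan_Suc_shift using A Suc.prems
      by (auto intro!: prod.cong simp: algebra_simps of_nat_diff)
    moreover have "(\<Prod>r=2..Suc n. chi_square_gamma (2 * real r - 1))
        = chi_square_gamma (real (card U)) * (\<Prod>r=2..n. chi_square_gamma (2 * real r - 1))"
      using Suc.hyps V by (subst prod.cl_ivl_Suc) (auto simp: algebra_simps)
    ultimately show ?thesis by (simp add: mult_ac)
  qed
  finally show ?case .
qed

section \<open>The density\<close>

text \<open>A linear form of Gaussian coordinates has the characteristic function of a multiple of a
single coordinate.\<close>

lemma linear_form_distributed:
  assumes P: "finite P" "inj_on f P" and w: "(\<Sum>x\<in>P. (w x)\<^sup>2) > 0"
  shows "distributed gauss lborel (\<lambda>\<omega>. \<Sum>x\<in>P. w x * \<omega> (f x))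
    (\<lambda>z. ennreal (normal_density 0 (sqrt (\<Sum>x\<in>P. (w x)\<^sup>2)) z))"
proof -
  let ?\<sigma> = "sqrt (\<Sum>x\<in>P. (w x)\<^sup>2)"
  obtain p where "p \<in> f ` P" using w by fastforce
  have char: "char (distr gauss borel F) t = (\<integral>\<omega>. cis (t * F \<omega>) \<partial>gauss)"
    if [measurable]: "F \<in> borel_measurable gauss" for F :: "('b \<Rightarrow> real) \<Rightarrow> real" and t
    unfolding char_def by (subst integral_distr) (auto simp: cis_conv_exp)
  have "distr gauss borel (\<lambda>\<omega>. \<Sum>x\<in>P. w x * \<omega> (f x)) = distr gauss borel (\<lambda>\<omega>. ?\<sigma> * \<omega> p)"
  proof (rule Levy_uniqueness)
    show "char (distr gauss borel (\<lambda>\<omega>. \<Sum>x\<in>P. w x * \<omega> (f x))) = char (distr gauss borel (\<lambda>\<omega>. ?\<sigma> * \<omega> p))"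
    proof
      fix t
      have "char (distr gauss borel (\<lambda>\<omega>. \<Sum>x\<in>P. w x * \<omega> (f x))) t
          = (\<integral>\<omega>. cis (\<Sum>x\<in>P. (t * w x) * \<omega> (f x)) \<partial>gauss)"
        by (subst char) (auto simp: sum_distrib_left mult.assoc)
      also have "\<dots> = complex_of_real (exp (- ((t * ?\<sigma>)\<^sup>2) / 2))"
        by (subst integral_cis_linear[OF P]) (simp add: power_mult_distrib sum_distrib_left sum_nonneg)
      also have "\<dots> = (\<integral>\<omega>. cis ((t * ?\<sigma>) * \<omega> p) \<partial>gauss)"
        by (rule integral_cis_coordinate[symmetric])
      also have "\<dots> = char (distr gauss borel (\<lambda>\<omega>. ?\<sigma> * \<omega> p)) t"
        by (subst char) (auto simp: mult.assoc)
      finally show "char (distr gauss borel (\<lambda>\<omega>. \<Sum>x\<in>P. w x * \<omega> (f x))) t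
          = char (distr gauss borel (\<lambda>\<omega>. ?\<sigma> * \<omega> p)) t" .
    qed
  qed (intro gauss.real_distribution_distr; measurable)+
  then have "distr gauss lborel (\<lambda>\<omega>. \<Sum>x\<in>P. w x * \<omega> (f x)) = distr gauss lborel (\<lambda>\<omega>. ?\<sigma> * \<omega> p)"
    by (simp cong: distr_cong)
  moreover have "distributed gauss lborel (\<lambda>\<omega>. \<omega> p) std_normal_density"
  proof -
    have "distr gauss lborel (\<lambda>\<omega>. \<omega> p) = distr gauss std_normal_distribution (\<lambda>\<omega>. \<omega> p)"
      by (rule distr_cong) auto
    then show ?thesis by (simp add: distributed_def distr_coordinate)
  qed
  then have "distributed gauss lborel (\<lambda>\<omega>. 0 + ?\<sigma> * \<omega> p) (normal_density (0 + ?\<sigma> * 0) (\<bar>?\<sigma>\<bar> * 1))"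
    using w by (intro gauss.normal_density_affine) auto
  ultimately show ?thesis
    by (simp add: distributed_def sum_nonneg)
qed

text \<open>The conditional standard deviation $|W|$ of the hafnian.\<close>

definition coeff_norm :: "'r set \<Rightarrow> nat set \<Rightarrow> ('r \<times> nat \<Rightarrow> real) \<Rightarrow> real" where
  "coeff_norm A U \<omega> = sqrt (\<Sum>a\<in>A. (column_coeff A U \<omega> a)\<^sup>2)"

lemma coeff_norm_nonneg: "coeff_norm A U \<omega> \<ge> 0"
  by (simp add: coeff_norm_def sum_nonneg)

lemma measurable_coeff_norm [measurable]:
  assumes [measurable]: "f \<in> M \<rightarrow>\<^sub>M gauss"
  shows "(\<lambda>x. coeff_norm A U (f x)) \<in> borel_measurable M"
  unfolding coeff_norm_def by measurable

lemma gram_haf_resample_column: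
  assumes "finite U" "i \<notin> U"
  shows "gram_haf A (insert i U) (resample (- (UNIV \<times> {i})) \<omega>' \<omega>) = (\<Sum>a\<in>A. column_coeff A U \<omega>' a * \<omega> (a, i))"
proof -
  have "column_coeff A U (resample (- (UNIV \<times> {i})) \<omega>' \<omega>) a = column_coeff A U \<omega>' a" for a
    by (rule column_coeff_cong) (use assms in \<open>auto simp: resample_def\<close>)
  then show ?thesis unfolding gram_haf_linear[OF assms] by (simp add: resample_def mult.commute)
qed

text \<open>The characteristic function is an average of centred normal ones, hence nonnegative, so its modulus may be
replaced by this average.\<close>

lemma char_gram_haf_coeff_norm:
  assumes U: "finite U" "i \<notin> U" and A: "finite A"
  shows "ennreal (norm (char_gram_haf A (insert i U) s)) = (\<integral>\<^sup>+\<omega>. ennreal (exp (- ((s * coeff_norm A U \<omega>)\<^sup>2 / 2))) \<partial>gauss)"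
proof -
  have int: "integrable gauss (\<lambda>\<omega>. cis (s * gram_haf A (insert i U) \<omega>))"
    by (rule integrable_cis) measurable
  have "char_gram_haf A (insert i U) s
      = (\<integral>\<omega>'. \<integral>\<omega>. cis (s * gram_haf A (insert i U) (resample (- (UNIV \<times> {i})) \<omega>' \<omega>)) \<partial>gauss \<partial>gauss)"
    unfolding char_gram_haf_def by (rule integral_resample[OF int])
  also have "\<dots> = (\<integral>\<omega>'. \<integral>\<omega>. cis (\<Sum>a\<in>A. (s * column_coeff A U \<omega>' a) * \<omega> (a, i)) \<partial>gauss \<partial>gauss)"
    unfolding gram_haf_resample_column[OF U] sum_distrib_left mult.assoc ..
  also have "\<dots> = (\<integral>\<omega>'. complex_of_real (exp (- ((s * coeff_norm A U \<omega>')\<^sup>2 / 2))) \<partial>gauss)"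
    using A by (subst integral_cis_linear)
      (auto simp: inj_on_def coeff_norm_def power_mult_distrib sum_distrib_left sum_nonneg)
  finally have "char_gram_haf A (insert i U) s = complex_of_real (\<integral>\<omega>. exp (- ((s * coeff_norm A U \<omega>)\<^sup>2 / 2)) \<partial>gauss)"
    by simp
  moreover have "(\<integral>\<omega>. exp (- ((s * coeff_norm A U \<omega>)\<^sup>2 / 2)) \<partial>gauss) \<ge> 0" by simp
  ultimately have "norm (char_gram_haf A (insert i U) s) = (\<integral>\<omega>. exp (- ((s * coeff_norm A U \<omega>)\<^sup>2 / 2)) \<partial>gauss)"
    by simp
  then show ?thesis
    by (subst nn_integral_eq_integral) (auto intro!: gauss.integrable_const_bound[where B = 1])
qed

text \<open>Where $|W| = 0$ the Gaussian kernel integrates to $\infty$; finiteness of the integral of the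
characteristic function therefore excludes this case almost surely.\<close>

lemma
  assumes U: "finite U" "i \<notin> U" and A: "finite A"
    and fin: "(\<integral>\<^sup>+s. ennreal (norm (char_gram_haf A (insert i U) s)) \<partial>lborel) \<noteq> \<infinity>"
  shows AE_coeff_norm_pos: "AE \<omega> in gauss. coeff_norm A U \<omega> > 0"
    and inverse_coeff_norm: "ennreal (sqrt (2 * pi)) * (\<integral>\<^sup>+\<omega>. ennreal (1 / coeff_norm A U \<omega>) \<partial>gauss)
      = (\<integral>\<^sup>+s. ennreal (norm (char_gram_haf A (insert i U) s)) \<partial>lborel)"
proof -
  let ?E = "\<lambda>s \<omega>. ennreal (exp (- ((s * coeff_norm A U \<omega>)\<^sup>2 / 2)))"
  have eq: "(\<integral>\<^sup>+s. ennreal (norm (char_gram_haf A (insert i U) s)) \<partial>lborel)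
      = (\<integral>\<^sup>+\<omega>. \<integral>\<^sup>+s. ?E s \<omega> \<partial>lborel \<partial>gauss)"
    unfolding char_gram_haf_coeff_norm[OF U A]
    by (rule pair_sigma_finite.Fubini') (unfold_locales, measurable)
  have "AE \<omega> in gauss. (\<integral>\<^sup>+s. ?E s \<omega> \<partial>lborel) \<noteq> \<infinity>"
    using fin unfolding eq by (intro nn_integral_noteq_infinite) auto
  then show pos: "AE \<omega> in gauss. coeff_norm A U \<omega> > 0"
  proof eventually_elim
    case (elim \<omega>)
    then have "coeff_norm A U \<omega> \<noteq> 0" by auto
    then show ?case using coeff_norm_nonneg[of A U \<omega>] by linarith
  qed
  have "ennreal (sqrt (2 * pi)) * (\<integral>\<^sup>+\<omega>. ennreal (1 / coeff_norm A U \<omega>) \<partial>gauss)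
      = (\<integral>\<^sup>+\<omega>. ennreal (sqrt (2 * pi)) * ennreal (1 / coeff_norm A U \<omega>) \<partial>gauss)"
    by (rule nn_integral_cmult[symmetric]) measurable
  also have "\<dots> = (\<integral>\<^sup>+\<omega>. \<integral>\<^sup>+s. ?E s \<omega> \<partial>lborel \<partial>gauss)"
  proof (rule nn_integral_cong_AE)
    show "AE \<omega> in gauss. ennreal (sqrt (2 * pi)) * ennreal (1 / coeff_norm A U \<omega>) = (\<integral>\<^sup>+s. ?E s \<omega> \<partial>lborel)"
      using pos by eventually_elim (simp add: nn_integral_gaussian ennreal_mult'[symmetric])
  qed
  finally show "ennreal (sqrt (2 * pi)) * (\<integral>\<^sup>+\<omega>. ennreal (1 / coeff_norm A U \<omega>) \<partial>gauss)
      = (\<integral>\<^sup>+s. ennreal (norm (char_gram_haf A (insert i U) s)) \<partial>lborel)" by (simp add: eq)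
qed

lemma normal_density_le_mode: "normal_density 0 \<sigma> z \<le> normal_density 0 \<sigma> 0"
  by (simp add: normal_density_def divide_right_mono)

lemma normal_density_mode: "\<sigma> \<ge> 0 \<Longrightarrow> normal_density 0 \<sigma> 0 = 1 / sqrt (2 * pi) * (1 / \<sigma>)"
  by (simp add: normal_density_def real_sqrt_mult)

text \<open>The density is the average over $W$ of centred normal densities. All of them have their mode at $0$ and are
dominated by their value there, which is integrable; this gives continuity and the maximum.\<close>

theorem gram_haf_density:
  assumes n: "n \<ge> 1" and A: "finite A" "card A \<ge> n + 1" and V: "finite V" "card V = 2 * n"
  obtains f :: "real \<Rightarrow> real" where
    "distributed gauss lborel (gram_haf A V) (\<lambda>z. ennreal (f z))" "\<And>z. 0 \<le> f z" "continuous_on UNIV f"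
    "\<And>z. f z \<le> f 0"
    "f 0 \<le> 1 / sqrt (2 * pi) * ((\<Prod>j<n. chi_square_gamma (real (card A) - real j))
        * (\<Prod>r=2..n. chi_square_gamma (2 * real r - 1)))"
proof -
  obtain i where "i \<in> V" using V n by fastforce
  then obtain U where VU: "V = insert i U" and U: "finite U" "i \<notin> U"
    using V(1) by (metis Set.set_insert finite_insert)
  let ?W = "coeff_norm A U"
  let ?\<Pi> = "(\<Prod>j<n. chi_square_gamma (real (card A) - real j)) * (\<Prod>r=2..n. chi_square_gamma (2 * real r - 1))"
  have bound: "(\<integral>\<^sup>+s. ennreal (norm (char_gram_haf A (insert i U) s)) \<partial>lborel) \<le> ennreal (sqrt (2 * pi) * ?\<Pi>)"
    using nn_integral_char_gram_haf[OF n A V] by (simp add: VU mult.assoc)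
  then have fin: "(\<integral>\<^sup>+s. ennreal (norm (char_gram_haf A (insert i U) s)) \<partial>lborel) \<noteq> \<infinity>"
    using ennreal_less_top by (metis infinity_ennreal_def not_le top.not_eq_extremum)
  note pos = AE_coeff_norm_pos[OF U A(1) fin]
  have inv: "(\<integral>\<^sup>+\<omega>. ennreal (1 / ?W \<omega>) \<partial>gauss) \<le> ennreal ?\<Pi>"
  proof -
    have "ennreal (sqrt (2 * pi)) * (\<integral>\<^sup>+\<omega>. ennreal (1 / ?W \<omega>) \<partial>gauss) \<le> ennreal (sqrt (2 * pi)) * ennreal ?\<Pi>"
      unfolding inverse_coeff_norm[OF U A(1) fin] using bound by (simp add: ennreal_mult')
    then show ?thesis by (subst (asm) ennreal_mult_le_mult_iff) auto
  qed
  have int1: "integrable gauss (\<lambda>\<omega>. 1 / ?W \<omega>)"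
    using inv by (intro integrableI_bounded)
      (auto simp: coeff_norm_nonneg intro: le_less_trans[OF _ ennreal_less_top])
  have int0: "integrable gauss (\<lambda>\<omega>. normal_density 0 (?W \<omega>) 0)"
    unfolding normal_density_mode[OF coeff_norm_nonneg] by (intro integrable_mult_right int1)
  have [measurable]: "(\<lambda>(\<omega>, z). normal_density 0 (?W \<omega>) z) \<in> borel_measurable (gauss \<Otimes>\<^sub>M borel)"
    unfolding normal_density_def by measurable
  have int: "integrable gauss (\<lambda>\<omega>. normal_density 0 (?W \<omega>) z)" for z
    by (rule Bochner_Integration.integrable_bound[OF int0]) (auto simp: normal_density_le_mode)
  define f where "f = (\<lambda>z. \<integral>\<omega>. normal_density 0 (?W \<omega>) z \<partial>gauss)"
  have f_nonneg: "0 \<le> f z" for z by (simp add: f_def)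
  have f_nn: "ennreal (f z) = (\<integral>\<^sup>+\<omega>. ennreal (normal_density 0 (?W \<omega>) z) \<partial>gauss)" for z
    unfolding f_def using int by (subst nn_integral_eq_integral) auto
  have [measurable]: "f \<in> borel_measurable borel"
    unfolding f_def by measurable
  have law: "(\<integral>\<^sup>+\<omega>. h (gram_haf A V \<omega>) \<partial>gauss) = (\<integral>\<^sup>+z. ennreal (f z) * h z \<partial>lborel)"
    if [measurable]: "h \<in> borel_measurable borel" for h :: "real \<Rightarrow> ennreal"
  proof -
    have "(\<integral>\<^sup>+\<omega>. h (gram_haf A V \<omega>) \<partial>gauss)
        = (\<integral>\<^sup>+\<omega>'. \<integral>\<^sup>+\<omega>. h (gram_haf A V (resample (- (UNIV \<times> {i})) \<omega>' \<omega>)) \<partial>gauss \<partial>gauss)"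
      by (rule nn_integral_resample[where f = "\<lambda>\<omega>. h (gram_haf A V \<omega>)"]) measurable
    also have "\<dots> = (\<integral>\<^sup>+\<omega>'. \<integral>\<^sup>+\<omega>. h (\<Sum>a\<in>A. column_coeff A U \<omega>' a * \<omega> (a, i)) \<partial>gauss \<partial>gauss)"
      unfolding VU gram_haf_resample_column[OF U] ..
    also have "\<dots> = (\<integral>\<^sup>+\<omega>'. \<integral>\<^sup>+z. ennreal (normal_density 0 (?W \<omega>') z) * h z \<partial>lborel \<partial>gauss)"
    proof (rule nn_integral_cong_AE, use pos in eventually_elim)
      fix \<omega>' :: "'a \<times> nat \<Rightarrow> real" assume "0 < ?W \<omega>'"
      then have "distributed gauss lborel (\<lambda>\<omega>. \<Sum>a\<in>A. column_coeff A U \<omega>' a * \<omega> (a, i))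
          (\<lambda>z. ennreal (normal_density 0 (?W \<omega>') z))"
        unfolding coeff_norm_def using A by (intro linear_form_distributed) (auto simp: inj_on_def)
      then show "(\<integral>\<^sup>+\<omega>. h (\<Sum>a\<in>A. column_coeff A U \<omega>' a * \<omega> (a, i)) \<partial>gauss)
          = (\<integral>\<^sup>+z. ennreal (normal_density 0 (?W \<omega>') z) * h z \<partial>lborel)"
        by (subst distributed_nn_integral[symmetric]) auto
    qed
    also have "\<dots> = (\<integral>\<^sup>+z. \<integral>\<^sup>+\<omega>'. ennreal (normal_density 0 (?W \<omega>') z) * h z \<partial>gauss \<partial>lborel)"
      by (rule pair_sigma_finite.Fubini'[symmetric]) (unfold_locales, measurable)
    also have "\<dots> = (\<integral>\<^sup>+z. ennreal (f z) * h z \<partial>lborel)"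
      unfolding f_nn by (intro nn_integral_cong nn_integral_multc) measurable
    finally show ?thesis .
  qed
  have "distributed gauss lborel (gram_haf A V) (\<lambda>z. ennreal (f z))"
    unfolding distributed_def
  proof (intro conjI measure_eqI)
    have [measurable]: "gram_haf A V \<in> borel_measurable gauss"
      using measurable_gram_haf[of "\<lambda>x. x" gauss A V] by simp
    fix B assume "B \<in> sets (distr gauss lborel (gram_haf A V))"
    then have [measurable]: "B \<in> sets borel" by simp
    have "emeasure (distr gauss lborel (gram_haf A V)) B = (\<integral>\<^sup>+x. indicator B x \<partial>distr gauss lborel (gram_haf A V))"
      by simp
    also have "\<dots> = (\<integral>\<^sup>+\<omega>. indicator B (gram_haf A V \<omega>) \<partial>gauss)"
      by (subst nn_integral_distr) auto
    also have "\<dots> = emeasure (density lborel (\<lambda>z. ennreal (f z))) B"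
      by (simp add: law emeasure_density)
    finally show "emeasure (distr gauss lborel (gram_haf A V)) B = emeasure (density lborel (\<lambda>z. ennreal (f z))) B" .
  next
    show "gram_haf A V \<in> gauss \<rightarrow>\<^sub>M lborel"
      using measurable_gram_haf[of "\<lambda>x. x" gauss A V] by simp
  qed auto
  moreover have "continuous_on UNIV f"
    unfolding continuous_on_sequentially
  proof (intro allI ballI impI)
    fix u :: "nat \<Rightarrow> real" and z assume "(\<forall>n. u n \<in> UNIV) \<and> u \<longlonglongrightarrow> z"
    then have u: "u \<longlonglongrightarrow> z" by simp
    have "(\<lambda>n. f (u n)) \<longlonglongrightarrow> f z"
      unfolding f_def
    proof (rule integral_dominated_convergence[where w = "\<lambda>\<omega>. normal_density 0 (?W \<omega>) 0"])
      show "AE \<omega> in gauss. (\<lambda>n. normal_density 0 (?W \<omega>) (u n)) \<longlonglongrightarrow> normal_density 0 (?W \<omega>) z"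
        unfolding normal_density_def divide_inverse by (intro AE_I2 tendsto_intros u)
    qed (auto simp: int0 normal_density_le_mode)
    then show "(f \<circ> u) \<longlonglongrightarrow> f z" by (simp add: o_def)
  qed
  moreover have "f z \<le> f 0" for z
    unfolding f_def by (intro integral_mono int normal_density_le_mode)
  moreover have "f 0 \<le> 1 / sqrt (2 * pi) * ?\<Pi>"
  proof -
    have \<Pi>: "?\<Pi> \<ge> 0"
      using A by (intro mult_nonneg_nonneg prod_nonneg) (auto intro!: less_imp_le[OF chi_square_gamma_pos])
    have "ennreal (f 0) = (\<integral>\<^sup>+\<omega>. ennreal (1 / sqrt (2 * pi)) * ennreal (1 / ?W \<omega>) \<partial>gauss)"
      unfolding f_nn normal_density_mode[OF coeff_norm_nonneg]
      by (intro nn_integral_cong ennreal_mult') simp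
    also have "\<dots> = ennreal (1 / sqrt (2 * pi)) * (\<integral>\<^sup>+\<omega>. ennreal (1 / ?W \<omega>) \<partial>gauss)"
      by (rule nn_integral_cmult) measurable
    also have "\<dots> \<le> ennreal (1 / sqrt (2 * pi)) * ennreal ?\<Pi>"
      by (intro mult_left_mono inv) auto
    also have "\<dots> = ennreal (1 / sqrt (2 * pi) * ?\<Pi>)" by (rule ennreal_mult'[symmetric]) simp
    finally show ?thesis using \<Pi> by (subst (asm) ennreal_le_iff) auto
  qed
  ultimately show ?thesis using f_nonneg by (intro that[of f]) auto
qed

section \<open>The law of the Gram hafnian\<close>

lemma gram_hafnian_eq_gram_haf: "gram_hafnian k n X \<omega> = gram_haf {1..k} {1..2 * n} (\<lambda>(a, i). X a i \<omega>)"
  by (simp add: gram_hafnian_def hafnian_def gram_haf_def haf_def gram_on_def gram_def)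

text \<open>The hafnian reads only finitely many entries, and their joint law is the product of standard
normal laws on both spaces.\<close>

lemma
  assumes M: "prob_space M" and X: "gaussian_matrix M k (2 * n) X" and n: "n \<ge> 1" and k: "k \<ge> 1"
  shows gram_hafnian_measurable: "gram_hafnian k n X \<in> borel_measurable M"
    and distr_gram_hafnian: "distr M borel (gram_hafnian k n X) = distr gauss borel (gram_haf {1..k} {1..2 * n})"
proof -
  interpret prob_space M by fact
  let ?I = "{1..k} \<times> {1..2 * n}"
  let ?X = "\<lambda>p \<omega>. X (fst p) (snd p) \<omega>"
  have indep: "indep_vars (\<lambda>_. borel) ?X ?I"
    using X by (simp add: gaussian_matrix_def case_prod_unfold)
  have law: "distr M borel (?X p) = std_normal_distribution" if "p \<in> ?I" for p
  proof -
    have "distributed M lborel (X (fst p) (snd p)) std_normal_density"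
      using X that by (auto simp: gaussian_matrix_def)
    then show ?thesis by (simp add: distributed_def cong: distr_cong)
  qed
  have rv: "random_variable borel (?X p)" if "p \<in> ?I" for p
    using indep that by (auto simp: indep_vars_def)
  have I: "?I \<noteq> {}" using n k by auto
  define g where "g = (\<lambda>x. gram_haf {1..k} {1..2 * n} (\<lambda>p. if p \<in> ?I then x p else 0))"
  have g [measurable]: "g \<in> borel_measurable (PiM ?I (\<lambda>_. borel))"
    unfolding g_def
  proof (rule measurable_gram_haf, rule measurable_gaussI)
    fix p show "(\<lambda>x. if p \<in> ?I then x p else 0) \<in> borel_measurable (PiM ?I (\<lambda>_. borel))"
      by (cases "p \<in> ?I") auto
  qed
  have gX: "gram_hafnian k n X = (\<lambda>\<omega>. g (\<lambda>p\<in>?I. ?X p \<omega>))"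
    unfolding g_def gram_hafnian_eq_gram_haf by (intro ext gram_haf_cong) auto
  have gW: "gram_haf {1..k} {1..2 * n} = (\<lambda>\<omega>. g (restrict \<omega> ?I))"
    unfolding g_def by (intro ext gram_haf_cong) auto
  have rX [measurable]: "(\<lambda>\<omega>. \<lambda>p\<in>?I. ?X p \<omega>) \<in> M \<rightarrow>\<^sub>M PiM ?I (\<lambda>_. borel)"
    by (intro measurable_restrict rv)
  have rW [measurable]: "(\<lambda>\<omega>. restrict \<omega> ?I) \<in> gauss \<rightarrow>\<^sub>M PiM ?I (\<lambda>_. borel)"
    by (intro measurable_restrict measurable_coordinate)
  show "gram_hafnian k n X \<in> borel_measurable M"
    unfolding gX by measurable
  have "distr M (PiM ?I (\<lambda>_. borel)) (\<lambda>\<omega>. \<lambda>p\<in>?I. ?X p \<omega>) = PiM ?I (\<lambda>p. distr M borel (?X p))"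
    using indep by (subst (asm) indep_vars_iff_distr_eq_PiM'[OF I rv]) auto
  also have "\<dots> = PiM ?I (\<lambda>_. std_normal_distribution)"
    by (intro PiM_cong law) auto
  also have "\<dots> = distr gauss (PiM ?I (\<lambda>_. std_normal_distribution)) (\<lambda>\<omega>. restrict \<omega> ?I)"
    unfolding gauss_def by (rule gauss_product.distr_PiM_restrict_finite[symmetric]) auto
  also have "\<dots> = distr gauss (PiM ?I (\<lambda>_. borel)) (\<lambda>\<omega>. restrict \<omega> ?I)"
    by (rule distr_cong) (auto intro!: sets_PiM_cong)
  finally have eq: "distr M (PiM ?I (\<lambda>_. borel)) (\<lambda>\<omega>. \<lambda>p\<in>?I. ?X p \<omega>)
      = distr gauss (PiM ?I (\<lambda>_. borel)) (\<lambda>\<omega>. restrict \<omega> ?I)" .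
  have "distr M borel (gram_hafnian k n X) = distr (distr M (PiM ?I (\<lambda>_. borel)) (\<lambda>\<omega>. \<lambda>p\<in>?I. ?X p \<omega>)) borel g"
    unfolding gX by (simp only: distr_distr[OF g rX] comp_def)
  also have "\<dots> = distr gauss borel (gram_haf {1..k} {1..2 * n})"
    unfolding eq gW by (simp only: distr_distr[OF g rW] comp_def)
  finally show "distr M borel (gram_hafnian k n X) = distr gauss borel (gram_haf {1..k} {1..2 * n})" .
qed

lemma (in prob_space) prob_interval_le:
  assumes X: "distributed M lborel X (\<lambda>z. ennreal (f z))" and f: "\<And>z. f z \<le> c" and c: "c \<ge> 0" and r: "r \<ge> 0"
  shows "prob {\<omega> \<in> space M. \<bar>X \<omega> - z\<bar> \<le> r} \<le> 2 * c * r"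
proof -
  have "{\<omega> \<in> space M. \<bar>X \<omega> - z\<bar> \<le> r} = X -` {z - r..z + r} \<inter> space M"
    by auto
  then have "emeasure M {\<omega> \<in> space M. \<bar>X \<omega> - z\<bar> \<le> r} = (\<integral>\<^sup>+x. ennreal (f x) * indicator {z - r..z + r} x \<partial>lborel)"
    by (simp add: distributed_emeasure[OF X])
  also have "\<dots> \<le> (\<integral>\<^sup>+x. ennreal c * indicator {z - r..z + r} x \<partial>lborel)"
    by (intro nn_integral_mono mult_right_mono ennreal_leI f) auto
  also have "\<dots> = ennreal c * ennreal (2 * r)"
    using r by (subst nn_integral_cmult_indicator) auto
  also have "\<dots> = ennreal (2 * c * r)"
    using c r by (simp add: ennreal_mult'[symmetric] mult_ac)
  finally have "ennreal (prob {\<omega> \<in> space M. \<bar>X \<omega> - z\<bar> \<le> r}) \<le> ennreal (2 * c * r)"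
    by (simp add: emeasure_eq_measure)
  then show ?thesis using c r by (subst (asm) ennreal_le_iff) auto
qed

section \<open>Estimating the constant\<close>

text \<open>Log-convexity of the Gamma function at the midpoint of \<open>x\<close> and \<open>x + 1\<close>.\<close>

lemma Gamma_half_shift_le:
  fixes x :: real
  assumes x: "x > 0"
  shows "(Gamma (x + 1 / 2))\<^sup>2 \<le> x * (Gamma x)\<^sup>2"
proof -
  have pos: "Gamma x > 0" "Gamma (x + 1 / 2) > 0"
    using x by (auto intro!: Gamma_real_pos)
  have G1: "Gamma (x + 1) = x * Gamma x"
    using x by (intro Gamma_plus1) (auto elim!: nonpos_Ints_cases)
  have "(ln \<circ> Gamma) ((1 - 1 / 2) *\<^sub>R x + (1 / 2) *\<^sub>R (x + 1))
      \<le> (1 - 1 / 2) * (ln \<circ> Gamma) x + 1 / 2 * (ln \<circ> Gamma) (x + 1)"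
    using x by (intro convex_onD[OF log_convex_Gamma_real]) auto
  also have "(1 - 1 / 2) *\<^sub>R x + (1 / 2) *\<^sub>R (x + 1) = x + 1 / 2" by (simp add: field_simps)
  finally have "2 * ln (Gamma (x + 1 / 2)) \<le> ln (Gamma x) + ln (x * Gamma x)"
    by (simp add: G1)
  moreover have "b\<^sup>2 \<le> x * a\<^sup>2" if "2 * ln b \<le> ln a + ln (x * a)" "a > 0" "b > 0" for a b :: real
  proof -
    have "ln (b\<^sup>2) \<le> ln (x * a\<^sup>2)"
      using that x by (simp add: ln_mult power2_eq_square)
    then show ?thesis using that x by (subst (asm) ln_le_cancel_iff) auto
  qed
  ultimately show ?thesis using pos by blast
qed

lemma chi_square_gamma_square_le:
  assumes d: "d > 2"
  shows "(chi_square_gamma d)\<^sup>2 \<le> 1 / (d - 2)"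
proof -
  define x where "x = d / 2 - 1"
  have x: "x > 0" "(d - 1) / 2 = x + 1 / 2" "d / 2 = x + 1" using d by (auto simp: x_def field_simps)
  have pos: "Gamma x \<noteq> 0" using Gamma_real_pos[of x] x(1) by linarith
  have G1: "Gamma (x + 1) = x * Gamma x"
    using x by (intro Gamma_plus1) (auto elim!: nonpos_Ints_cases)
  have half: "(2 powr - (1 / 2) :: real)\<^sup>2 = 1 / 2"
    by (simp add: powr_minus_divide powr_half_sqrt power_divide)
  have "(chi_square_gamma d)\<^sup>2 = 1 / 2 * ((Gamma (x + 1 / 2))\<^sup>2 / (x * Gamma x)\<^sup>2)"
    using d by (simp add: chi_square_gamma_eq x(2,3) G1 power_divide power_mult_distrib half)
  also have "\<dots> \<le> 1 / 2 * (x * (Gamma x)\<^sup>2 / (x * Gamma x)\<^sup>2)"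
    by (intro mult_left_mono divide_right_mono Gamma_half_shift_le x) auto
  also have "\<dots> = 1 / (2 * x)"
    using x pos by (simp add: power2_eq_square)
  also have "2 * x = d - 2" by (simp add: x_def)
  finally show ?thesis .
qed

text \<open>The right-hand side divided by the left-hand side decreases in \<open>m\<close> and tends to $1$. The limit
follows from log-convexity, which gives the weaker bound $m^2/(m+\frac12)$. The constant $\frac14$ matters: it
is responsible for the exponent $\frac34$ in the product bound.\<close>

lemma Gamma_half_shift_ge:
  assumes m: "m \<ge> 1"
  shows "real m - 1 / 4 \<le> (Gamma (real m + 1 / 2) / Gamma (real m))\<^sup>2"
proof -
  define p where "p = (\<lambda>m. (Gamma (real m + 1 / 2) / Gamma (real m))\<^sup>2)"
  \<comment> \<open>Decreasing because $(m+\frac12)^2(m-\frac14) = m^2(m+\frac34) - \frac1{16}$.\<close>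
  define q where "q = (\<lambda>m. p m / (real m - 1 / 4))"
  have rec: "Gamma (real m + 1) = real m * Gamma (real m)"
    "Gamma (real m + 1 / 2 + 1) = (real m + 1 / 2) * Gamma (real m + 1 / 2)"
    "Gamma (real m) > 0" "Gamma (real m + 1 / 2) > 0" if "m \<ge> 1" for m
  proof -
    have "x \<notin> \<int>\<^sub>\<le>\<^sub>0" if "x > 0" for x :: real using that by (auto elim!: nonpos_Ints_cases)
    then show "Gamma (real m + 1) = real m * Gamma (real m)"
      "Gamma (real m + 1 / 2 + 1) = (real m + 1 / 2) * Gamma (real m + 1 / 2)"
      using that by (intro Gamma_plus1; simp)+
  qed (use that in \<open>auto intro!: Gamma_real_pos\<close>)
  have low: "p m \<ge> (real m)\<^sup>2 / (real m + 1 / 2)" if "m \<ge> 1" for m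
  proof -
    have "(Gamma (real m + 1))\<^sup>2 \<le> (real m + 1 / 2) * (Gamma (real m + 1 / 2))\<^sup>2"
      using Gamma_half_shift_le[of "real m + 1 / 2"] that by (simp add: add_ac)
    then have *: "(real m)\<^sup>2 * (Gamma (real m))\<^sup>2 \<le> (real m + 1 / 2) * (Gamma (real m + 1 / 2))\<^sup>2"
      unfolding rec(1)[OF that] by (simp add: power_mult_distrib)
    have "a / b \<le> (g / h)\<^sup>2" if "a * h\<^sup>2 \<le> b * g\<^sup>2" "b > 0" "h > 0" for a b g h :: real
      using that by (simp add: power_divide field_simps)
    from this[OF *] show ?thesis using rec(3)[OF that] that by (simp add: p_def)
  qed
  have step: "q (Suc m) \<le> q m" if "m \<ge> 1" for m
  proof -
    have pS: "p (Suc m) = ((real m + 1 / 2) / real m)\<^sup>2 * p m"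
      using rec[OF that] by (simp add: p_def add_ac power_mult_distrib power_divide)
    have "((real m + 1 / 2) / real m)\<^sup>2 * (real m - 1 / 4) \<le> real m + 3 / 4"
    proof -
      have "(real m + 1 / 2)\<^sup>2 * (real m - 1 / 4) \<le> (real m + 3 / 4) * (real m)\<^sup>2"
        by (simp add: power2_eq_square field_simps)
      then show ?thesis using that by (simp add: power_divide field_simps)
    qed
    then have *: "((real m + 1 / 2) / real m)\<^sup>2 * (real m - 1 / 4) * p m \<le> (real m + 3 / 4) * p m"
      by (rule mult_right_mono) (simp add: p_def)
    have "c * P / b \<le> P / a" if "c * a * P \<le> b * P" "a > 0" "b > 0" for a b c P :: real
      using that by (simp add: field_simps)
    from this[OF *] show ?thesis using that by (simp add: q_def pS add.commute)
  qed
  have anti: "q (m + j) \<le> q m" for j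
  proof (induction j)
    case (Suc j)
    then show ?case using step[of "m + j"] m by simp
  qed simp
  have "1 \<le> q m"
  proof (rule LIMSEQ_le_const2)
    show "(\<lambda>j. (real m + real j)\<^sup>2 / (real m + real j + 1 / 2) / (real m + real j - 1 / 4)) \<longlonglongrightarrow> 1"
      by real_asymp
    have "(real m + real j)\<^sup>2 / (real m + real j + 1 / 2) / (real m + real j - 1 / 4) \<le> q m" for j
    proof -
      have "(real m + real j)\<^sup>2 / (real m + real j + 1 / 2) / (real m + real j - 1 / 4) \<le> q (m + j)"
        unfolding q_def of_nat_add[symmetric] using low[of "m + j"] m by (intro divide_right_mono) auto
      then show ?thesis using anti[of j] by simp
    qed
    then show "\<exists>N. \<forall>j\<ge>N. (real m + real j)\<^sup>2 / (real m + real j + 1 / 2) / (real m + real j - 1 / 4) \<le> q m"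
      by blast
  qed
  then show ?thesis
    unfolding q_def p_def using m by (subst (asm) le_divide_eq_1_pos) auto
qed

text \<open>With $z = r - \frac54$ the Gamma estimate bounds the left-hand side by $(z+\frac34)/z$. The weighted
arithmetic-geometric mean inequality $(z+\frac34)^{1/4}(z-\frac14)^{3/4} \le z$ turns this into a
telescoping factor.\<close>

lemma odd_chi_square_gamma_le:
  assumes r: "r \<ge> 2"
  shows "(2 * real r - 1) * (chi_square_gamma (2 * real r - 1))\<^sup>2
    \<le> ((real r - 1 / 2) / (real r - 3 / 2)) powr (3 / 4)"
proof -
  define z where "z = real r - 5 / 4"
  have z: "z \<ge> 3 / 4" using r by (simp add: z_def)
  have pos: "Gamma (real r - 1) > 0" "Gamma (real r - 1 / 2) > 0"
    using r by (auto intro!: Gamma_real_pos)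
  have "z \<le> (Gamma (real r - 1 / 2) / Gamma (real r - 1))\<^sup>2"
    using Gamma_half_shift_ge[of "r - 1"] r by (simp add: z_def of_nat_diff)
  then have ge: "z * (Gamma (real r - 1))\<^sup>2 \<le> (Gamma (real r - 1 / 2))\<^sup>2"
    using pos by (simp add: power_divide field_simps)
  have half: "(2 powr - (1 / 2) :: real)\<^sup>2 = 1 / 2"
    by (simp add: powr_minus_divide powr_half_sqrt power_divide)
  have args: "(2 * real r - 2) / 2 = real r - 1" "(2 * real r - 1) / 2 = real r - 1 / 2"
    by (simp_all add: field_simps)
  have "(chi_square_gamma (2 * real r - 1))\<^sup>2
      = 1 / 2 * ((Gamma (real r - 1))\<^sup>2 / (Gamma (real r - 1 / 2))\<^sup>2)"
    using r by (simp add: chi_square_gamma_eq power_divide power_mult_distrib half args)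
  also have "\<dots> \<le> 1 / 2 * (1 / z)"
    using ge pos z by (intro mult_left_mono) (simp_all add: field_simps)
  finally have "(2 * real r - 1) * (chi_square_gamma (2 * real r - 1))\<^sup>2 \<le> (2 * real r - 1) * (1 / 2 * (1 / z))"
    using r by (intro mult_left_mono) auto
  also have "\<dots> = (real r - 1 / 2) / z" by (simp add: field_simps)
  also have "\<dots> \<le> ((real r - 1 / 2) / (real r - 3 / 2)) powr (3 / 4)"
  proof -
    have xy: "real r - 1 / 2 = z + 3 / 4" "real r - 3 / 2 = z - 1 / 4" by (simp_all add: z_def)
    have "(z + 3 / 4) * (z - 1 / 4) ^ 3 \<le> z ^ 4"
    proof -
      have "z ^ 4 - (z + 3 / 4) * (z - 1 / 4) ^ 3 = 3 / 8 * (z - 1 / 6)\<^sup>2 + 1 / 768"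
        by (simp add: power2_eq_square power3_eq_cube power4_eq_xxxx field_simps)
      also have "\<dots> \<ge> 0" by simp
      finally show ?thesis by simp
    qed
    then have "((z + 3 / 4) / z) ^ 4 \<le> ((z + 3 / 4) / (z - 1 / 4)) ^ 3"
    proof -
      assume a: "(z + 3 / 4) * (z - 1 / 4) ^ 3 \<le> z ^ 4"
      have "(z + 3 / 4) ^ 4 * (z - 1 / 4) ^ 3 = (z + 3 / 4) ^ 3 * ((z + 3 / 4) * (z - 1 / 4) ^ 3)"
        by (simp add: power4_eq_xxxx power3_eq_cube mult_ac)
      also have "\<dots> \<le> (z + 3 / 4) ^ 3 * z ^ 4" using z a by (intro mult_left_mono) auto
      finally show ?thesis using z by (simp add: power_divide divide_le_eq le_divide_eq)
    qed
    then have "(((z + 3 / 4) / z) ^ 4) powr (1 / 4) \<le> (((z + 3 / 4) / (z - 1 / 4)) ^ 3) powr (1 / 4)"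
      using z by (intro powr_mono2) auto
    moreover have "(w ^ k) powr (1 / 4) = w powr (real k / 4)" if "w > 0" for w :: real and k
      using that by (simp add: powr_realpow[symmetric] powr_powr)
    ultimately show ?thesis
      unfolding xy using z by simp
  qed
  finally show ?thesis .
qed

lemma prod_odd_chi_square_gamma_le:
  assumes "n \<ge> 1"
  shows "(\<Prod>r=2..n. (2 * real r - 1) * (chi_square_gamma (2 * real r - 1))\<^sup>2) \<le> (2 * real n - 1) powr (3 / 4)"
  using assms
proof (induction n rule: nat_induct_at_least)
  case (Suc n)
  have "(\<Prod>r=2..Suc n. (2 * real r - 1) * (chi_square_gamma (2 * real r - 1))\<^sup>2)
      = (\<Prod>r=2..n. (2 * real r - 1) * (chi_square_gamma (2 * real r - 1))\<^sup>2)
        * ((2 * real (Suc n) - 1) * (chi_square_gamma (2 * real (Suc n) - 1))\<^sup>2)"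
    using Suc.hyps by (subst prod.cl_ivl_Suc) simp
  also have "\<dots> \<le> (2 * real n - 1) powr (3 / 4) * ((real (Suc n) - 1 / 2) / (real (Suc n) - 3 / 2)) powr (3 / 4)"
    by (intro mult_mono Suc.IH odd_chi_square_gamma_le) (use Suc.hyps in auto)
  also have "\<dots> = ((2 * real n - 1) * ((real (Suc n) - 1 / 2) / (real (Suc n) - 3 / 2))) powr (3 / 4)"
    using Suc.hyps by (subst powr_mult) auto
  also have "(2 * real n - 1) * ((real (Suc n) - 1 / 2) / (real (Suc n) - 3 / 2)) = 2 * real (Suc n) - 1"
    using Suc.hyps by (simp add: field_simps)
  finally show ?case .
qed simp

lemma double_fact_odd:
  assumes "n \<ge> 1"
  shows "real (double_fact (2 * n - 1)) = (\<Prod>r=2..n. 2 * real r - 1)"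
    and "real (double_fact (2 * n - 1)) = (\<Prod>q<n. 2 * real q + 1)"
proof -
  have "real (double_fact (2 * n - 1)) = (\<Prod>r=2..n. 2 * real r - 1)
      \<and> real (double_fact (2 * n - 1)) = (\<Prod>q<n. 2 * real q + 1)"
    using assms
  proof (induction n rule: nat_induct_at_least)
    case base
    then show ?case by (simp add: numeral_2_eq_2)
  next
    case (Suc n)
    have "double_fact (2 * Suc n - 1) = (2 * n + 1) * double_fact (2 * n - 1)"
      using Suc.hyps double_fact.simps(3)[of "2 * n - 1"] by (simp add: Suc_diff_le)
    then have "real (double_fact (2 * Suc n - 1)) = (2 * real n + 1) * real (double_fact (2 * n - 1))"
      by (simp add: distrib_right)
    with Suc show ?case by (simp add: prod.cl_ivl_Suc)
  qed
  then show "real (double_fact (2 * n - 1)) = (\<Prod>r=2..n. 2 * real r - 1)"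
    and "real (double_fact (2 * n - 1)) = (\<Prod>q<n. 2 * real q + 1)" by auto
qed

text \<open>Each factor is at most $1 + (3q+2)/(k-q-2)$ and $1 + x \le e^x$.\<close>

lemma prod_row_factors_le:
  assumes k: "k \<ge> n + 2"
  shows "(\<Prod>q<n. (real k + 2 * real q) * (chi_square_gamma (real k - real q))\<^sup>2)
    \<le> exp ((3 * (real n)\<^sup>2 + real n) / (2 * (real k - real n - 1)))"
proof -
  let ?D = "real k - real n - 1"
  have D: "?D > 0" using k by simp
  have "(\<Prod>q<n. (real k + 2 * real q) * (chi_square_gamma (real k - real q))\<^sup>2)
      \<le> (\<Prod>q<n. exp ((3 * real q + 2) / ?D))"
  proof (intro prod_mono conjI)
    fix q assume "q \<in> {..<n}"
    then have q: "real q + 1 \<le> real n" by auto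
    have "(real k + 2 * real q) * (chi_square_gamma (real k - real q))\<^sup>2
        \<le> (real k + 2 * real q) * (1 / (real k - real q - 2))"
      using q k by (intro mult_left_mono chi_square_gamma_square_le) auto
    also have "\<dots> = 1 + (3 * real q + 2) / (real k - real q - 2)"
      using q k by (simp add: field_simps)
    also have "\<dots> \<le> 1 + (3 * real q + 2) / ?D"
      using q D by (intro add_left_mono divide_left_mono mult_pos_pos) auto
    also have "\<dots> \<le> exp ((3 * real q + 2) / ?D)" by (rule exp_ge_add_one_self)
    finally show "(real k + 2 * real q) * (chi_square_gamma (real k - real q))\<^sup>2 \<le> exp ((3 * real q + 2) / ?D)" .
  qed simp
  also have "\<dots> = exp ((\<Sum>q<n. 3 * real q + 2) / ?D)"
    by (simp add: exp_sum sum_divide_distrib)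
  also have "(\<Sum>q<n. 3 * real q + 2) = (3 * (real n)\<^sup>2 + real n) / 2"
    by (induction n) (simp_all add: power2_eq_square field_simps)
  finally show ?thesis by simp
qed

lemma coefficient_bound:
  assumes n: "n \<ge> 1" and k: "k \<ge> n + 2"
    and \<sigma>: "\<sigma> \<ge> 0" "\<sigma>\<^sup>2 = real (double_fact (2 * n - 1)) * (\<Prod>q<n. real k + 2 * real q)"
  shows "sqrt (2 / pi) * \<sigma> * (\<Prod>j<n. chi_square_gamma (real k - real j)) * (\<Prod>r=2..n. chi_square_gamma (2 * real r - 1))
    \<le> 2 / sqrt pi * real n powr (3 / 8) * exp ((3 * (real n)\<^sup>2 + real n) / (4 * (real k - real n - 1)))"
    (is "?B \<le> ?R")
proof (rule power2_le_imp_le)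
  let ?E = "exp ((3 * (real n)\<^sup>2 + real n) / (2 * (real k - real n - 1)))"
  have "?B\<^sup>2 = 2 / pi * ((\<Prod>q<n. (real k + 2 * real q) * (chi_square_gamma (real k - real q))\<^sup>2)
      * (\<Prod>r=2..n. (2 * real r - 1) * (chi_square_gamma (2 * real r - 1))\<^sup>2))"
    unfolding power_mult_distrib \<sigma>(2) double_fact_odd(1)[OF n]
    by (simp add: prod.distrib prod_power_distrib)
  also have "\<dots> \<le> 2 / pi * (?E * (2 * real n - 1) powr (3 / 4))"
    using n by (intro mult_left_mono mult_mono prod_row_factors_le[OF k] prod_odd_chi_square_gamma_le[OF n] prod_nonneg) auto
  also have "\<dots> \<le> 2 / pi * (?E * (2 * real n powr (3 / 4)))"
  proof (intro mult_left_mono)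
    have "(2 * real n - 1) powr (3 / 4) \<le> (2 * real n) powr (3 / 4)"
      using n by (intro powr_mono2) auto
    also have "\<dots> = 2 powr (3 / 4) * real n powr (3 / 4)" using n by (simp add: powr_mult)
    also have "2 powr (3 / 4) \<le> (2::real) powr 1" by (intro powr_mono) auto
    finally show "(2 * real n - 1) powr (3 / 4) \<le> 2 * real n powr (3 / 4)" by (simp add: mult_right_mono)
  qed auto
  also have "\<dots> = ?R\<^sup>2"
  proof -
    have "(real n powr (3 / 8))\<^sup>2 = real n powr (3 / 4)"
      by (simp add: power2_eq_square flip: powr_add)
    moreover have "(exp (a / (4 * d)))\<^sup>2 = exp (a / (2 * d))" for a d :: real
      by (simp flip: exp_double)
    ultimately have "?R\<^sup>2 = (2 / sqrt pi)\<^sup>2 * real n powr (3 / 4) * ?E"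
      by (simp only: power_mult_distrib)
    then show ?thesis by (simp add: power_divide)
  qed
  finally show "?B\<^sup>2 \<le> ?R\<^sup>2" .
qed simp

section \<open>Anticoncentration of the Gram hafnian\<close>

theorem theorem2p1:
  fixes M :: "'w measure"
    and X :: "nat \<Rightarrow> nat \<Rightarrow> 'w \<Rightarrow> real"
    and n k :: nat
  assumes "prob_space M"
    and "n \<ge> 1"
    and "k \<ge> n + 1"
    and "gaussian_matrix M k (2 * n) X"
  shows "gram_hafnian_rms M k n X > 0 \<and>
         (gram_hafnian_rms M k n X)\<^sup>2
           = prob_space.expectation M (\<lambda>\<omega>. (gram_hafnian k n X \<omega>)\<^sup>2) \<and>
         prob_space.expectation M (\<lambda>\<omega>. (gram_hafnian k n X \<omega>)\<^sup>2)
           = real (double_fact (2 * n - 1)) * (\<Prod>q<n. real k + 2 * real q) \<and>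
         (\<exists>f :: real \<Rightarrow> real.
           distributed M lborel (gram_hafnian k n X) (\<lambda>z. ennreal (f z)) \<and>
           (\<forall>z. 0 \<le> f z) \<and> continuous_on UNIV f \<and> bounded (range f) \<and>
           (SUP z. f z) = f 0 \<and>
           f 0 \<le> B_real M k n X / (2 * gram_hafnian_rms M k n X)) \<and>
         (\<forall>z \<epsilon>. \<epsilon> \<ge> 0 \<longrightarrow>
           prob_space.prob M {\<omega> \<in> space M.
               \<bar>gram_hafnian k n X \<omega> - z\<bar> \<le> \<epsilon> * gram_hafnian_rms M k n X}
             \<le> min 1 (B_real M k n X * \<epsilon>)) \<and>
         (k \<ge> n + 2 \<longrightarrow>
           B_real M k n X
             \<le> 2 / sqrt pi * real n powr (3 / 8)
                 * exp ((3 * (real n)\<^sup>2 + real n) / (4 * (real k - real n - 1))))"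
proof -
  interpret prob_space M by fact
  let ?A = "{1..k}" and ?V = "{1..2 * n}" and ?\<sigma> = "gram_hafnian_rms M k n X"
  let ?E = "expectation (\<lambda>\<omega>. (gram_hafnian k n X \<omega>)\<^sup>2)"
  let ?B = "B_real M k n X"
  let ?\<Pi> = "(\<Prod>j<n. chi_square_gamma (real k - real j)) * (\<Prod>r=2..n. chi_square_gamma (2 * real r - 1))"
  have k: "k \<ge> 1" using assms(3) by simp
  note X [measurable] = gram_hafnian_measurable[OF assms(1,4,2) k]
  note law = distr_gram_hafnian[OF assms(1,4,2) k]
  have gram_haf [measurable]: "gram_haf ?A ?V \<in> borel_measurable gauss"
    using measurable_gram_haf[of "\<lambda>x. x" gauss ?A ?V] by simp
  have "?E = (\<integral>x. x\<^sup>2 \<partial>distr M borel (gram_hafnian k n X))"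
    by (subst integral_distr) auto
  also have "\<dots> = (\<integral>\<omega>. (gram_haf ?A ?V \<omega>)\<^sup>2 \<partial>gauss)"
    unfolding law by (subst integral_distr) auto
  also have "\<dots> = (\<Prod>q<n. (2 * real q + 1) * (real k + 2 * real q))"
    by (subst second_moment_gram_haf[of ?A ?V n]) auto
  finally have E: "?E = (\<Prod>q<n. (2 * real q + 1) * (real k + 2 * real q))" .
  then have E': "?E = real (double_fact (2 * n - 1)) * (\<Prod>q<n. real k + 2 * real q)"
    unfolding double_fact_odd(2)[OF assms(2)] by (simp add: prod.distrib)
  have "?E > 0"
    unfolding E using k by (intro prod_pos mult_pos_pos) auto
  then have \<sigma>: "?\<sigma> > 0" "?\<sigma>\<^sup>2 = ?E"
    by (simp_all add: gram_hafnian_rms_def)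
  have B: "?B = sqrt (2 / pi) * ?\<sigma> * ?\<Pi>"
    by (simp add: B_real_def mult.assoc)
  have "2 / (2 * sqrt (2 * pi)) = sqrt (2 / pi) / 2"
    by (simp add: real_sqrt_divide real_sqrt_mult field_simps)
  then have half_B: "?B / (2 * ?\<sigma>) = 1 / sqrt (2 * pi) * ?\<Pi>"
    using \<sigma>(1) unfolding B by (simp add: field_simps)
  have "card ?A \<ge> n + 1" "card ?V = 2 * n" using assms(3) by auto
  then obtain f :: "real \<Rightarrow> real" where f: "distributed gauss lborel (gram_haf ?A ?V) (\<lambda>z. ennreal (f z))"
      "\<And>z. 0 \<le> f z" "continuous_on UNIV f" "\<And>z. f z \<le> f 0" "f 0 \<le> 1 / sqrt (2 * pi) * ?\<Pi>"
    using gram_haf_density[OF assms(2), of ?A ?V] by (metis card_atLeastAtMost diff_Suc_1 finite_atLeastAtMost)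
  have "distr M lborel (gram_hafnian k n X) = distr gauss lborel (gram_haf ?A ?V)"
    using law by (simp cong: distr_cong)
  then have D: "distributed M lborel (gram_hafnian k n X) (\<lambda>z. ennreal (f z))"
    using f(1) X by (simp add: distributed_def)
  have f0: "f 0 \<le> ?B / (2 * ?\<sigma>)"
    unfolding half_B by (rule f(5))
  have "bounded (range f)"
    by (rule boundedI[of _ "f 0"]) (use f(2,4) in auto)
  moreover have "(SUP z. f z) = f 0"
    by (rule cSup_eq_maximum) (use f(4) in auto)
  moreover have "prob {\<omega> \<in> space M. \<bar>gram_hafnian k n X \<omega> - z\<bar> \<le> \<epsilon> * ?\<sigma>} \<le> min 1 (?B * \<epsilon>)"
    if "\<epsilon> \<ge> 0" for z \<epsilon>
  proof -
    have "prob {\<omega> \<in> space M. \<bar>gram_hafnian k n X \<omega> - z\<bar> \<le> \<epsilon> * ?\<sigma>} \<le> 2 * (?B / (2 * ?\<sigma>)) * (\<epsilon> * ?\<sigma>)"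
      using that \<sigma>(1) order_trans[OF f(2)[of 0] f0] order_trans[OF f(4) f0]
      by (intro prob_interval_le[OF D]) auto
    also have "\<dots> = ?B * \<epsilon>" using \<sigma>(1) by simp
    finally show ?thesis by simp
  qed
  moreover have "?B \<le> 2 / sqrt pi * real n powr (3 / 8)
      * exp ((3 * (real n)\<^sup>2 + real n) / (4 * (real k - real n - 1)))" if "k \<ge> n + 2"
    unfolding B_real_def
    by (rule coefficient_bound[OF assms(2) that]) (use \<sigma> E' in auto)
  ultimately show ?thesis
    using \<sigma> E' D f(2,3) f0 by (intro conjI exI[of _ f]) auto
qed

end
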